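(* Let $X=\mathbb{P}^1\setminus\{0,1,\infty\}$ and $j:X\to\mathbb{A}^1$ the inclusion. Let $\overline{\mathcal{L}_0}=[t;t]$, $\overline{\mathcal{L}_1}=[t;1-t]$ in $\mathcal{N}^1_{\mathbb{A}^1}(1)$, and $\overline{\mathcal{L}^1_{01}}=\nu^*(\overline{\mathcal{L}_0}\,\overline{\mathcal{L}_1})\in\mathcal{N}^{eq,1}_{\mathbb{A}^1}(2)$; put $\mathcal{L}_1=j^*(\overline{\mathcal{L}_1})$, $\mathcal{L}^1_{01}=j^*(\overline{\mathcal{L}^1_{01}})$. Define $$\overline{\mathcal{L}_{011}}=\mu^*(\overline{\mathcal{L}^1_{01}}\,\overline{\mathcal{L}_1}),\quad\overline{\mathcal{L}^1_{011}}=\nu^*(\overline{\mathcal{L}^1_{01}}\,\overline{\mathcal{L}_1}),\quad\mathcal{L}_{011}=j^*(\overline{\mathcal{L}_{011}}),\quad\mathcal{L}^1_{011}=j^*(\overline{\mathcal{L}^1_{011}}),$$ where $\mu^*,\nu^*$ are the pull-backs by the multiplication and twisted multiplication (defined in the context). Then: (1) $\mathcal{L}_{011}$ and $\mathcal{L}^1_{011}$ are in $\mathcal{N}^{eq,1}_X(3)$, and $\overline{\mathcal{L}_{011}}$ and $\overline{\mathcal{L}^1_{011}}$ are in $\mathcal{N}^{eq,1}_{\mathbb{A}^1}(3)$. (2) $\partial(\mathcal{L}_{011})=\partial(\mathcal{L}^1_{011})=\mathcal{L}^1_{01}\,\mathcal{L}_1=-\mathcal{L}_1\,\mathcal{L}^1_{01}$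 and $\partial_{\mathbb{A}^1}(\overline{\mathcal{L}_{011}})=\partial_{\mathbb{A}^1}(\overline{\mathcal{L}^1_{011}})=\overline{\mathcal{L}^1_{01}}\,\overline{\mathcal{L}_1}$. (3) The cycle $\overline{\mathcal{L}_{011}}$ (resp. $\overline{\mathcal{L}^1_{011}}$) has an empty fiber at $0$ (resp. at $1$).
   Context: The base field is $\mathbb{Q}$. Put $\square^1=\mathbb{P}^1\setminus\{1\}$ and $\square^n=(\square^1)^n$ with affine coordinates $u_1,\dots,u_n$. A face $F$ of $\square^n$ is a subvariety given by equations $u_{i_k}=\varepsilon_k$ with $\varepsilon_k\in\{0,\infty\}$. Let $Y$ be a smooth irreducible quasi-projective variety over $\mathbb{Q}$ (here $Y=\mathbb{A}^1$ or $Y=X$). $\mathcal{Z}^p(Y,n)$ is the free abelian group on the closed irreducible subvarieties $Z\subset Y\times\square^n$ of codimension $p$ such that for every face $F$, $Z\cap(Y\times F)$ is empty or of codimension $p$ in $Y\times F$. The group $G_n=(\mathbb{Z}/2\mathbb{Z})^n\rtimes\mathfrak{S}_n$ acts on $\square^n$ (permutation of factors, and $u\mapsto1/u$ on each factor); extend the sign character of $\mathfrak{S}_n$ to $G_n\to\{\pm1\}$ by letting each generator of a $\mathbb{Z}/2\mathbb{Z}$ have sign $-1$, and let $\mathcal{A}lt_n\in\mathbb{Q}[G_n]$ be the corresponding projector. Set $\mathcal{N}^k_Y(p)=\mathcal{A}lt_{2p-k}(\mathcal{Z}^p(Y,2p-k)\otimes\mathbb{Q})$, $\mathcal{N}^\bullet_Y=\bigoplus_{p\ge0}\mathcal{N}^\bullet_Y(p)$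 ($k$ is the cohomological degree, $p$ the weight), with differential $\partial=\partial_Y=\sum_i(-1)^{i-1}(\partial_i^0-\partial_i^\infty)$ raising $k$ by one, $\partial_i^\varepsilon$ being the pull-back to the face $u_i=\varepsilon$. Exterior product of cycles (concatenating the cube factors), pull-back along the diagonal of $Y$ and $\mathcal{A}lt$ give a product making $\mathcal{N}^\bullet_Y$ a graded commutative differential graded algebra. A morphism to $Y$ is equidimensional of relative dimension $r$ if every irreducible component of the source dominates $Y$ and every nonempty fiber has pure dimension $r$ (empty fibers are allowed). $\mathcal{Z}^p_{eq}(Y,n)$ is the free abelian group generated by the irreducible closed $Z\subset Y\times\square^n$ such that for every face $F$, $Z\cap(Y\times F)$ is empty or $Z\cap(Y\times F)\to Y$ is equidimensional of relative dimension $\dim(F)-p$; $\mathcal{N}^{eq,k}_Y(p)=\mathcal{A}lt_{2p-k}(\mathcal{Z}^p_{eq}(Y,2p-k)\otimes\mathbb{Q})\subset\mathcal{N}^k_Y(p)$. The fiber at $x\in Y$ of a generator $Z$ is $Z\cap(\{x\}\times\square^n)$, extended to $\mathcal{A}lt(\sum q_iZ_i)$ linearly. $j^*$ is the restriction of cycles from $\mathbb{A}^1$ to $X$. Notation: $[t;t]$ and $[t;1-t]$ are the images under $\mathcal{A}lt$ of the graphs of $t\mapsto t$ and $t\mapsto1-t$ restricted to $\mathbb{A}^1\times\square^1$. Definition of $\mu^*,\nu^*:\mathcal{N}^{eq,k}_{\mathbb{A}^1}(p)\to\mathcal{N}^{eq,k-1}_{\mathbb{A}^1}(p)$: let $\tau:\square^1\to\mathbb{A}^1$,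 $u\mapsto\frac1{1-u}$; $m:\mathbb{A}^1\times\mathbb{A}^1\to\mathbb{A}^1$ the multiplication; $\theta:\mathbb{A}^1\to\mathbb{A}^1$, $t\mapsto1-t$. With $n=2p-k$, let $\widetilde m=(m\circ(\mathrm{id}\times\tau))\times\mathrm{id}_{\square^n}:\mathbb{A}^1\times\square^1\times\square^n\to\mathbb{A}^1\times\square^n$ and $\widehat m=(\theta\times\mathrm{id}_{\square^n})\circ\widetilde m\circ(\theta\times\mathrm{id}_{\square^{n+1}})$. Let $h$ view a cycle on $(\mathbb{A}^1\times\square^1)\times\square^n$ as a cycle on $\mathbb{A}^1\times\square^{n+1}$ (the extra $\square^1$ being the first cubical factor). Then $\mu^*=h\circ\widetilde m^*$ and $\nu^*=h\circ\widehat m^*$, extended $\mathbb{Q}$-linearly and followed by $\mathcal{A}lt$. The products $\overline{\mathcal{L}_0}\,\overline{\mathcal{L}_1}$ and $\overline{\mathcal{L}^1_{01}}\,\overline{\mathcal{L}_1}$ lie in $\mathcal{N}^{eq,2}_{\mathbb{A}^1}(2)$ and $\mathcal{N}^{eq,2}_{\mathbb{A}^1}(3)$ respectively, so these maps apply to them. *)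

theory Defs
  imports
    "HOL-Algebra.Algebraic_Closure_Type"
    "HOL-Combinatorics.Permutations"
    "HOL-Computational_Algebra.Fraction_Field"
    "HOL-Library.Poly_Mapping"
    "HOL-Library.Extended_Nat"
begin

section \<open>Coordinate rings\<close>

text \<open>
  The cube factor \<open>\<square>\<^sup>1 = P\<^sup>1 - {1}\<close> with coordinate \<open>u\<close> is the affine variety with coordinate ring
  \<open>Q[1/(1-u)]\<close>.  Throughout, \<open>Cube i\<close> stands for the regular function \<open>1/(1-u\<^sub>i)\<close>, \<open>i = 1, 2, ...\<close>, so that
    \<open>u\<^sub>i = 0\<close> is \<open>Cube i = 1\<close>,  \<open>u\<^sub>i = \<infinity>\<close> is \<open>Cube i = 0\<close>,  and \<open>u\<^sub>i \<mapsto> 1/u\<^sub>i\<close> is \<open>Cube i \<mapsto> 1 - Cube i\<close>.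
  \<open>Base 0\<close> is the coordinate \<open>t\<close> of the affine line; \<open>Base 1\<close> is only used for \<open>Y \<times> Y\<close>.
\<close>

datatype coord = Base nat | Cube nat

text \<open>The order only serves to make polynomials over \<open>coord\<close> an integral domain.\<close>

instantiation coord :: linorder
begin

fun less_eq_coord :: "coord \<Rightarrow> coord \<Rightarrow> bool" where
  "less_eq_coord (Base i) (Base j) = (i \<le> j)"
| "less_eq_coord (Base i) (Cube j) = True"
| "less_eq_coord (Cube i) (Base j) = False"
| "less_eq_coord (Cube i) (Cube j) = (i \<le> j)"

definition less_coord :: "coord \<Rightarrow> coord \<Rightarrow> bool" where
  "less_coord x y \<longleftrightarrow> x \<le> y \<and> \<not> y \<le> x"

instance
proof
  fix x y z :: coord
  show "x < y \<longleftrightarrow> x \<le> y \<and> \<not> y \<le> x" by (rule less_coord_def)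
  show "x \<le> x" by (cases x) auto
  show "x \<le> y \<Longrightarrow> y \<le> z \<Longrightarrow> x \<le> z" by (cases x; cases y; cases z) auto
  show "x \<le> y \<Longrightarrow> y \<le> x \<Longrightarrow> x = y" by (cases x; cases y) auto
  show "x \<le> y \<or> y \<le> x" by (cases x; cases y) auto
qed

end

type_synonym mpoly = "(coord \<Rightarrow>\<^sub>0 nat) \<Rightarrow>\<^sub>0 rat"

definition Var :: "coord \<Rightarrow> mpoly" where
  "Var v = Poly_Mapping.single (Poly_Mapping.single v 1) 1"

definition Const :: "rat \<Rightarrow> mpoly" where
  "Const a = Poly_Mapping.single 0 a"

definition vars :: "mpoly \<Rightarrow> coord set" where
  "vars p = (\<Union>m\<in>Poly_Mapping.keys p. Poly_Mapping.keys m)"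

definition subst :: "(coord \<Rightarrow> mpoly) \<Rightarrow> mpoly \<Rightarrow> mpoly" where
  "subst \<sigma> p = (\<Sum>m\<in>Poly_Mapping.keys p. Const (Poly_Mapping.lookup p m) *
     (\<Prod>v\<in>Poly_Mapping.keys m. \<sigma> v ^ Poly_Mapping.lookup m v))"

text \<open>\<open>coord_ring b n\<close> is the coordinate ring of \<open>(A\<^sup>1)\<^sup>b \<times> \<square>\<^sup>n\<close>.\<close>

definition coord_ring :: "nat \<Rightarrow> nat \<Rightarrow> mpoly ring" where
  "coord_ring b n =
     ring_of_type_algebra\<lparr>carrier := {p. vars p \<subseteq> Base ` {..<b} \<union> Cube ` {1..n}}\<rparr>"


section \<open>Points, irreducible components, dimension\<close>

text \<open>
  The base \<open>Y\<close> is the open curve \<open>A\<^sup>1 - S\<close>, where \<open>S\<close> is a finite set of rational points; it is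
  represented by \<open>S\<close>.
\<close>

definition base_A1 :: "rat set" where "base_A1 = {}"

text \<open>\<open>P\<^sup>1 - {0,1,\<infinity>} = A\<^sup>1 - {0,1}\<close>\<close>

definition base_X :: "rat set" where "base_X = {0, 1}"

text \<open>
  The points of the scheme \<open>Y\<^sup>b \<times> \<square>\<^sup>n\<close>: prime ideals of the coordinate ring of \<open>(A\<^sup>1)\<^sup>b \<times> \<square>\<^sup>n\<close> lying
  in the open subscheme \<open>Y\<^sup>b \<times> \<square>\<^sup>n\<close>.  A point \<open>P\<close> stands for the closed irreducible subvariety of
  which it is the generic point, i.e. the one whose points are the \<open>Q \<supseteq> P\<close>.
\<close>

definition points :: "rat set \<Rightarrow> nat \<Rightarrow> nat \<Rightarrow> mpoly set set" where
  "points S b n = {Q. primeideal Q (coord_ring b n) \<and>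
     (\<forall>j<b. \<forall>a\<in>S. Var (Base j) - Const a \<notin> Q)}"

text \<open>Generic points of the irreducible components of a set \<open>W\<close> of points.\<close>

definition components :: "mpoly set set \<Rightarrow> mpoly set set" where
  "components W = {Q\<in>W. \<forall>Q'\<in>W. Q' \<subseteq> Q \<longrightarrow> Q' = Q}"

definition krull_dim :: "mpoly set set \<Rightarrow> enat" where
  "krull_dim W = (SUP d \<in> {d. \<exists>c. (\<forall>i\<le>d. c i \<in> W) \<and> (\<forall>i<d. c i \<subset> c (Suc i))}. enat d)"


section \<open>Cycles\<close>

text \<open>
  Cycles with rational coefficients on \<open>Y\<^sup>b \<times> \<square>\<^sup>n\<close> (the space, i.e. \<open>S\<close>, \<open>b\<close>, \<open>n\<close>, is passed
  separately to the operations below).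
\<close>

type_synonym cycle = "mpoly set \<Rightarrow>\<^sub>0 rat"

definition scale :: "rat \<Rightarrow> cycle \<Rightarrow> cycle" where
  "scale c C = Poly_Mapping.map ((*) c) C"

definition lin_ext :: "(mpoly set \<Rightarrow> cycle) \<Rightarrow> cycle \<Rightarrow> cycle" where
  "lin_ext f C = (\<Sum>P\<in>Poly_Mapping.keys C. scale (Poly_Mapping.lookup C P) (f P))"

text \<open>
  Multiplicities: \<open>localize b n Q I\<close> is the extension of the ideal \<open>I\<close> to the local ring \<open>A\<^sub>Q\<close> of
  \<open>A = coord_ring b n\<close> at \<open>Q\<close>, a subring of the fraction field, and \<open>int_mult b n Q I\<close> is the length of
  \<open>A\<^sub>Q / I A\<^sub>Q\<close>, measured by chains of ideals of \<open>A\<^sub>Q\<close> containing \<open>I A\<^sub>Q\<close>.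
\<close>

definition localize :: "nat \<Rightarrow> nat \<Rightarrow> mpoly set \<Rightarrow> mpoly set \<Rightarrow> mpoly fract set" where
  "localize b n Q I = {Fract a s | a s. a \<in> I \<and> s \<in> carrier (coord_ring b n) - Q}"

definition local_ring :: "nat \<Rightarrow> nat \<Rightarrow> mpoly set \<Rightarrow> mpoly fract ring" where
  "local_ring b n Q =
     ring_of_type_algebra\<lparr>carrier := localize b n Q (carrier (coord_ring b n))\<rparr>"

definition int_mult :: "nat \<Rightarrow> nat \<Rightarrow> mpoly set \<Rightarrow> mpoly set \<Rightarrow> enat" where
  "int_mult b n Q I = (SUP l \<in> {l. \<exists>J. (\<forall>i\<le>l. ideal (J i) (local_ring b n Q) \<and> localize b n Q I \<subseteq> J i) \<and>
     (\<forall>i<l. J i \<subset> J (Suc i))}. enat l)"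

text \<open>Fundamental cycle of the closed subscheme of \<open>Y\<^sup>b \<times> \<square>\<^sup>n\<close> with ideal \<open>I\<close>.\<close>

definition fund_cycle :: "rat set \<Rightarrow> nat \<Rightarrow> nat \<Rightarrow> mpoly set \<Rightarrow> cycle" where
  "fund_cycle S b n I = (\<Sum>Q\<in>components {Q\<in>points S b n. I \<subseteq> Q}.
     Poly_Mapping.single Q (of_nat (the_enat (int_mult b n Q I))))"

text \<open>
  Pull-back of cycles to \<open>Y\<^sup>b \<times> \<square>\<^sup>n\<close> along the morphism whose comorphism sends each coordinate \<open>v\<close>
  to \<open>\<sigma> v\<close>: the fundamental cycle of the scheme-theoretic inverse image, extended linearly.
  It is applied to flat morphisms, and to inclusions of the effective Cartier divisors \<open>u\<^sub>i = \<epsilon>\<close>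
  and of the diagonal of the curve \<open>Y\<close>, where for properly intersecting integral subschemes
  the higher Tor terms vanish and the lengths are the intersection multiplicities.
\<close>

definition pullback :: "rat set \<Rightarrow> nat \<Rightarrow> nat \<Rightarrow> (coord \<Rightarrow> mpoly) \<Rightarrow> cycle \<Rightarrow> cycle" where
  "pullback S b n \<sigma> = lin_ext (\<lambda>P. fund_cycle S b n (genideal (coord_ring b n) (subst \<sigma> ` P)))"

text \<open>Restriction of cycles on \<open>A\<^sup>1 \<times> \<square>\<^sup>n\<close> to \<open>X \<times> \<square>\<^sup>n\<close>.\<close>

definition j_pull :: "nat \<Rightarrow> cycle \<Rightarrow> cycle" where
  "j_pull n = pullback base_X 1 n Var"


section \<open>Alternating cycles, faces, differential\<close>

text \<open>
  An element of \<open>G\<^sub>n = (Z/2)\<^sup>n \<rtimes> S\<^sub>n\<close> is given by the set \<open>E\<close> of inverted coordinates and a permutation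
  \<open>\<pi>\<close>; it sends \<open>u\<close> to the point with \<open>i\<close>-th coordinate \<open>u\<^bsub>\<pi> i\<^esub>\<^sup>\<plusminus>\<^sup>1\<close>, inverted iff \<open>i \<in> E\<close>.
\<close>

definition G_subst :: "nat set \<Rightarrow> (nat \<Rightarrow> nat) \<Rightarrow> coord \<Rightarrow> mpoly" where
  "G_subst E \<pi> v = (case v of
       Base j \<Rightarrow> Var (Base j)
     | Cube i \<Rightarrow> if i \<in> E then 1 - Var (Cube (\<pi> i)) else Var (Cube (\<pi> i)))"

definition Alt :: "rat set \<Rightarrow> nat \<Rightarrow> cycle \<Rightarrow> cycle" where
  "Alt S n C = scale (1 / (2 ^ n * fact n))
     (\<Sum>E\<in>Pow {1..n}. \<Sum>\<pi> | \<pi> permutes {1..n}.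
        scale ((- 1) ^ card E * of_int (sign \<pi>)) (pullback S 1 n (G_subst E \<pi>) C))"

datatype eps = Zero | Infty

text \<open>The value of \<open>1/(1-u)\<close> at \<open>u = 0\<close> and at \<open>u = \<infinity>\<close>.\<close>

fun eps_val :: "eps \<Rightarrow> mpoly" where
  "eps_val Zero = 1"
| "eps_val Infty = 0"

text \<open>A face of \<open>\<square>\<^sup>n\<close> with equations \<open>u\<^sub>i = \<epsilon>\<close> for \<open>F i = Some \<epsilon>\<close>; the whole cube is a face.\<close>

definition is_face :: "nat \<Rightarrow> (nat \<rightharpoonup> eps) \<Rightarrow> bool" where
  "is_face n F \<longleftrightarrow> dom F \<subseteq> {1..n}"

definition face_dim :: "nat \<Rightarrow> (nat \<rightharpoonup> eps) \<Rightarrow> nat" where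
  "face_dim n F = n - card (dom F)"

definition face_points :: "rat set \<Rightarrow> nat \<Rightarrow> (nat \<rightharpoonup> eps) \<Rightarrow> mpoly set set" where
  "face_points S n F =
     {Q\<in>points S 1 n. \<forall>i \<epsilon>. F i = Some \<epsilon> \<longrightarrow> Var (Cube i) - eps_val \<epsilon> \<in> Q}"

text \<open>Comorphism of the inclusion \<open>Y \<times> \<square>\<^bsup>n-1\<^esup> \<rightarrow> Y \<times> \<square>\<^sup>n\<close> of the face \<open>u\<^sub>i = \<epsilon>\<close>.\<close>

definition face_subst :: "nat \<Rightarrow> eps \<Rightarrow> coord \<Rightarrow> mpoly" where
  "face_subst i \<epsilon> v = (case v of
       Base j \<Rightarrow> Var (Base j)
     | Cube l \<Rightarrow> if l < i then Var (Cube l) else if l = i then eps_val \<epsilon> else Var (Cube (l - 1)))"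

definition face_pull :: "rat set \<Rightarrow> nat \<Rightarrow> nat \<Rightarrow> eps \<Rightarrow> cycle \<Rightarrow> cycle" where
  "face_pull S n i \<epsilon> = pullback S 1 (n - 1) (face_subst i \<epsilon>)"

definition bdry :: "rat set \<Rightarrow> nat \<Rightarrow> cycle \<Rightarrow> cycle" where
  "bdry S n C = (\<Sum>i=1..n. scale ((- 1) ^ (i - 1)) (face_pull S n i Zero C - face_pull S n i Infty C))"


section \<open>The groups of admissible and of equidimensional cycles\<close>

text \<open>
  The codimension of the closure of \<open>Q\<close> in \<open>Y \<times> F\<close> is the maximal length of chains of irreducible
  closed subsets of \<open>Y \<times> F\<close> starting at it, i.e. of chains of points ending at \<open>Q\<close>.
\<close>

definition Z_gens :: "rat set \<Rightarrow> nat \<Rightarrow> nat \<Rightarrow> mpoly set set" where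
  "Z_gens S p n = {P\<in>points S 1 n.
     krull_dim {Q\<in>points S 1 n. Q \<subseteq> P} = enat p \<and>
     (\<forall>F. is_face n F \<longrightarrow>
        (\<forall>Q\<in>components {Q\<in>face_points S n F. P \<subseteq> Q}.
           krull_dim {Q'\<in>face_points S n F. Q' \<subseteq> Q} = enat p))}"

text \<open>
  Fiber over the point \<open>y\<close> of \<open>Y\<close> of a closed subset \<open>W\<close> of \<open>Y \<times> \<square>\<^sup>n\<close>; as a topological space it is
  the scheme-theoretic fiber.
\<close>

definition fiber_over :: "mpoly set set \<Rightarrow> mpoly set \<Rightarrow> mpoly set set" where
  "fiber_over W y = {Q\<in>W. Q \<inter> carrier (coord_ring 1 0) = y}"

definition equidimensional :: "rat set \<Rightarrow> mpoly set set \<Rightarrow> int \<Rightarrow> bool" where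
  "equidimensional S W r \<longleftrightarrow>
     (\<forall>Q\<in>components W. Q \<inter> carrier (coord_ring 1 0) = {0}) \<and>
     (\<forall>y\<in>points S 1 0. \<forall>Q\<in>components (fiber_over W y).
        \<exists>d. krull_dim {Q'\<in>fiber_over W y. Q \<subseteq> Q'} = enat d \<and> int d = r)"

definition Zeq_gens :: "rat set \<Rightarrow> nat \<Rightarrow> nat \<Rightarrow> mpoly set set" where
  "Zeq_gens S p n = {P\<in>points S 1 n.
     \<forall>F. is_face n F \<longrightarrow>
        {Q\<in>face_points S n F. P \<subseteq> Q} = {} \<or>
        equidimensional S {Q\<in>face_points S n F. P \<subseteq> Q} (int (face_dim n F) - int p)}"

definition N :: "rat set \<Rightarrow> int \<Rightarrow> nat \<Rightarrow> cycle set" where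
  "N S k p = (if k \<le> 2 * int p
     then (let n = nat (2 * int p - k) in Alt S n ` {C. Poly_Mapping.keys C \<subseteq> Z_gens S p n})
     else {0})"

definition Neq :: "rat set \<Rightarrow> int \<Rightarrow> nat \<Rightarrow> cycle set" where
  "Neq S k p = (if k \<le> 2 * int p
     then (let n = nat (2 * int p - k) in Alt S n ` {C. Poly_Mapping.keys C \<subseteq> Zeq_gens S p n})
     else {0})"


section \<open>Product\<close>

definition ext_left :: "coord \<Rightarrow> mpoly" where
  "ext_left = Var"

definition ext_right :: "nat \<Rightarrow> coord \<Rightarrow> mpoly" where
  "ext_right n v = (case v of Base j \<Rightarrow> Var (Base (j + 1)) | Cube i \<Rightarrow> Var (Cube (n + i)))"

text \<open>Exterior product of cycles on \<open>Y \<times> \<square>\<^sup>n\<close> and \<open>Y \<times> \<square>\<^sup>m\<close>: a cycle on \<open>Y\<^sup>2 \<times> \<square>\<^bsup>n+m\<^esup>\<close>.\<close>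

definition ext_prod :: "rat set \<Rightarrow> nat \<Rightarrow> nat \<Rightarrow> cycle \<Rightarrow> cycle \<Rightarrow> cycle" where
  "ext_prod S n m C D = lin_ext (\<lambda>P. lin_ext (\<lambda>Q.
     fund_cycle S 2 (n + m)
       (genideal (coord_ring 2 (n + m)) (subst ext_left ` P \<union> subst (ext_right n) ` Q))) D) C"

definition diag_subst :: "coord \<Rightarrow> mpoly" where
  "diag_subst v = (case v of Base j \<Rightarrow> Var (Base 0) | Cube i \<Rightarrow> Var (Cube i))"

definition cprod :: "rat set \<Rightarrow> nat \<Rightarrow> nat \<Rightarrow> cycle \<Rightarrow> cycle \<Rightarrow> cycle" where
  "cprod S n m C D = Alt S (n + m) (pullback S 1 (n + m) diag_subst (ext_prod S n m C D))"


section \<open>Pull-back by the (twisted) multiplication\<close>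

text \<open>
  Comorphism of \<open>(t, u\<^sub>0, u) \<mapsto> (t \<sqdot> \<tau>(u\<^sub>0), u)\<close> with \<open>\<tau>(u\<^sub>0) = 1/(1-u\<^sub>0)\<close>; the coordinates of the source are
  renumbered so that \<open>u\<^sub>0\<close> becomes the first cubical coordinate.
\<close>

definition m_subst :: "coord \<Rightarrow> mpoly" where
  "m_subst v = (case v of
       Base j \<Rightarrow> Var (Base j) * Var (Cube 1)
     | Cube i \<Rightarrow> Var (Cube (i + 1)))"

definition theta_subst :: "coord \<Rightarrow> mpoly" where
  "theta_subst v = (case v of Base j \<Rightarrow> 1 - Var (Base j) | Cube i \<Rightarrow> Var (Cube i))"

definition mhat_subst :: "coord \<Rightarrow> mpoly" where
  "mhat_subst v = subst theta_subst (subst m_subst (theta_subst v))"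

definition mu_pull :: "nat \<Rightarrow> cycle \<Rightarrow> cycle" where
  "mu_pull n C = Alt base_A1 (n + 1) (pullback base_A1 1 (n + 1) m_subst C)"

definition nu_pull :: "nat \<Rightarrow> cycle \<Rightarrow> cycle" where
  "nu_pull n C = Alt base_A1 (n + 1) (pullback base_A1 1 (n + 1) mhat_subst C)"


section \<open>The polylogarithm cycles\<close>

text \<open>
  The intersection of the graph of \<open>f\<close> with \<open>A\<^sup>1 \<times> \<square>\<^sup>1\<close>: as \<open>u \<noteq> 1\<close> and \<open>f(t) \<noteq> \<infinity>\<close>, the equation \<open>u = f(t)\<close>
  is equivalent to \<open>(1 - f(t)) / (1 - u) = 1\<close>.
\<close>

definition graph_ideal :: "mpoly \<Rightarrow> mpoly set" where
  "graph_ideal f = genideal (coord_ring 1 1) {(1 - f) * Var (Cube 1) - 1}"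

definition graph_cycle :: "mpoly \<Rightarrow> cycle" where
  "graph_cycle f = Alt base_A1 1 (Poly_Mapping.single (graph_ideal f) 1)"

definition L0_bar :: cycle where
  "L0_bar = graph_cycle (Var (Base 0))"

definition L1_bar :: cycle where
  "L1_bar = graph_cycle (1 - Var (Base 0))"

definition L1_01_bar :: cycle where
  "L1_01_bar = nu_pull 2 (cprod base_A1 1 1 L0_bar L1_bar)"

definition L_011_bar :: cycle where
  "L_011_bar = mu_pull 4 (cprod base_A1 3 1 L1_01_bar L1_bar)"

definition L1_011_bar :: cycle where
  "L1_011_bar = nu_pull 4 (cprod base_A1 3 1 L1_01_bar L1_bar)"

definition L1 :: cycle where "L1 = j_pull 1 L1_bar"
definition L1_01 :: cycle where "L1_01 = j_pull 3 L1_01_bar"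
definition L_011 :: cycle where "L_011 = j_pull 5 L_011_bar"
definition L1_011 :: cycle where "L1_011 = j_pull 5 L1_011_bar"

text \<open>
  \<open>Z \<inter> ({a} \<times> \<square>\<^sup>n)\<close> for a rational point \<open>a\<close> of \<open>Y\<close>.  A cycle has empty fiber at \<open>a\<close> if this holds
  for every subvariety occurring in its reduced expression, so that no cancellation
  between fibers is allowed.
\<close>

definition fiber :: "rat set \<Rightarrow> nat \<Rightarrow> rat \<Rightarrow> mpoly set \<Rightarrow> mpoly set set" where
  "fiber S n a P = {Q\<in>points S 1 n. P \<subseteq> Q \<and> Var (Base 0) - Const a \<in> Q}"

definition empty_fiber_at :: "rat set \<Rightarrow> nat \<Rightarrow> rat \<Rightarrow> cycle \<Rightarrow> bool" where
  "empty_fiber_at S n a C \<longleftrightarrow> (\<forall>P\<in>Poly_Mapping.keys C. fiber S n a P = {})"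

end

theory Submission
  imports Defs "HOL-Computational_Algebra.Fundamental_Theorem_Algebra"
begin

text \<open>
  In the coordinates \<open>t\<close> and \<open>x\<^sub>i = 1/(1 - u\<^sub>i)\<close> every cycle that occurs is, up to \<open>Alt\<close>, a single graph:
  a subvariety given by equations \<open>f\<^sub>w x\<^sub>w = 1\<close>, where the \<open>f\<^sub>w\<close> only involve the remaining (free) coordinates.
  Such an ideal is the kernel of a homomorphism to a field, hence prime, and pull-backs act
  on the equations, so that all multiplicities are 1.  Explicitly, \<open>L_011_bar\<close> and \<open>L1_011_bar\<close> come from
    \<open>(1 - t x\<^sub>1) x\<^sub>2 x\<^sub>3 = 1, (1 - (1 - t x\<^sub>1) x\<^sub>2) x\<^sub>4 = 1, t x\<^sub>1 x\<^sub>5 = 1\<close>  and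
    \<open>(1 - t) x\<^sub>1 x\<^sub>2 x\<^sub>3 = 1, (1 - (1 - t) x\<^sub>1 x\<^sub>2) x\<^sub>4 = 1, (1 - (1 - t) x\<^sub>1) x\<^sub>5 = 1\<close>.
  Both meet only the faces \<open>u\<^sub>1 = 0\<close> and \<open>u\<^sub>2 = 0\<close>.  The first gives the product cycle; the second is symmetric
  in two coordinates and is killed by \<open>Alt\<close>.  As the boundary commutes with \<open>Alt\<close>, this gives the differential.
  The fiber of a graph over a point \<open>y\<close> is an open subset of an affine space over the residue field of \<open>y\<close>;
  chains of primes in it are bounded by the number of free coordinates because that many plus one elements
  are algebraically dependent, and a chain of this length is obtained by specialising the free coordinates
  one at a time to rational numbers.
\<close>


section \<open>Evaluation of polynomials\<close>

text \<open>Multiplicity one comes from primality: if the equations of a pulled-back graph generate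
  a prime ideal, that ideal extends to the maximal ideal of the local ring at its own generic point,
  so the length is 1. The boundary commutes with \<open>Alt\<close> for two reasons: on an
  alternating cycle all 2n faces contribute equally, so that only \<open>u_1 = 0\<close> has to be
  computed, and the signed permutations split into cosets of the subgroup acting on the other
  coordinates, one coset for each face. The dependence behind the upper bound on chains comes from
  counting: r+1 elements have more products of bounded exponents than there are monomials of the
  corresponding degrees in r variables. The residue field of a point of the line is made concrete by
  a field that contains it: the complex numbers for a closed point, through a root of its equation,
  and a fraction field of polynomials for the generic point; only the kernel of the evaluation
  matters. The weight one cycles need an argument of their own: the graphs of \<open>t\<close> and
  \<open>1 - t\<close> meet \<open>u_1 = 0\<close> over a single point of the line, so they are
  admissible without being equidimensional.\<close>

abbreviation lk where "lk \<equiv> Poly_Mapping.lookup"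
abbreviation ks where "ks \<equiv> Poly_Mapping.keys"

text \<open>A predicate between types, so that substitution, evaluation at a point and passage to a
  fraction field or to univariate polynomials are instances of one notion and share the uniqueness
  principle \<open>hom_eqI\<close>.\<close>

definition hom_on :: "('a::comm_ring_1 \<Rightarrow> 'b::comm_ring_1) \<Rightarrow> bool" where
  "hom_on c \<longleftrightarrow> c 1 = 1 \<and> (\<forall>a b. c (a + b) = c a + c b) \<and> (\<forall>a b. c (a * b) = c a * c b)"

lemma hom_on_1: "hom_on c \<Longrightarrow> c 1 = 1"
  and hom_on_add: "hom_on c \<Longrightarrow> c (a + b) = c a + c b"
  and hom_on_mult: "hom_on c \<Longrightarrow> c (a * b) = c a * c b"
  by (auto simp: hom_on_def)

lemma hom_on_0: "hom_on c \<Longrightarrow> c 0 = 0"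
  using hom_on_add[of c 0 0] by simp

lemma hom_on_uminus: "hom_on c \<Longrightarrow> c (- a) = - c a"
  using hom_on_add[of c a "- a"] by (simp add: hom_on_0 eq_neg_iff_add_eq_0 add.commute)

lemma hom_on_diff: "hom_on c \<Longrightarrow> c (a - b) = c a - c b"
  using hom_on_add[of c a "- b"] by (simp add: hom_on_uminus)

lemma hom_on_power: "hom_on c \<Longrightarrow> c (a ^ n) = c a ^ n"
  by (induction n) (auto simp: hom_on_1 hom_on_mult)

lemma hom_on_sum: "hom_on c \<Longrightarrow> c (sum f A) = (\<Sum>x\<in>A. c (f x))"
  by (induction A rule: infinite_finite_induct) (auto simp: hom_on_0 hom_on_add)

lemma hom_on_prod: "hom_on c \<Longrightarrow> c (prod f A) = (\<Prod>x\<in>A. c (f x))"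
  by (induction A rule: infinite_finite_induct) (auto simp: hom_on_1 hom_on_mult)

lemmas hom_on_simps = hom_on_1 hom_on_0 hom_on_add hom_on_mult hom_on_uminus hom_on_diff hom_on_power

lemma hom_on_comp: "hom_on f \<Longrightarrow> hom_on g \<Longrightarrow> hom_on (\<lambda>x. f (g x))"
  by (simp add: hom_on_def)

lemma hom_on_id: "hom_on (\<lambda>x. x)"
  by (simp add: hom_on_def)

definition mono_val :: "('v \<Rightarrow> 'b::comm_ring_1) \<Rightarrow> ('v \<Rightarrow>\<^sub>0 nat) \<Rightarrow> 'b" where
  "mono_val \<phi> m = (\<Prod>v\<in>ks m. \<phi> v ^ lk m v)"

lemma mono_val_superset:
  assumes "finite A" "ks m \<subseteq> A"
  shows "mono_val \<phi> m = (\<Prod>v\<in>A. \<phi> v ^ lk m v)"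
  unfolding mono_val_def using assms by (intro prod.mono_neutral_left) (auto simp: in_keys_iff)

lemma mono_val_add: "mono_val \<phi> (m + m') = mono_val \<phi> m * mono_val \<phi> m'"
proof -
  let ?A = "ks m \<union> ks m'"
  have "mono_val \<phi> (m + m') = (\<Prod>v\<in>?A. \<phi> v ^ lk (m + m') v)"
    using Poly_Mapping.keys_add[of m m'] by (intro mono_val_superset) auto
  also have "\<dots> = (\<Prod>v\<in>?A. \<phi> v ^ lk m v) * (\<Prod>v\<in>?A. \<phi> v ^ lk m' v)"
    by (simp add: lookup_add power_add prod.distrib)
  also have "\<dots> = mono_val \<phi> m * mono_val \<phi> m'"
    using mono_val_superset[of ?A m \<phi>] mono_val_superset[of ?A m' \<phi>] by simp
  finally show ?thesis .
qed

lemma mono_val_0 [simp]: "mono_val \<phi> 0 = 1"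
  by (simp add: mono_val_def)

lemma mono_val_single [simp]: "mono_val \<phi> (Poly_Mapping.single v k) = \<phi> v ^ k"
  by (cases "k = 0") (auto simp: mono_val_def)

text \<open>The coefficient ring is left open: besides \<open>rat\<close> it is later the residue
  field of a point, and the target may be a field, a polynomial ring or univariate
  polynomials.\<close>

definition ev :: "('k::comm_ring_1 \<Rightarrow> 'b::comm_ring_1) \<Rightarrow> ('v \<Rightarrow> 'b) \<Rightarrow> (('v \<Rightarrow>\<^sub>0 nat) \<Rightarrow>\<^sub>0 'k) \<Rightarrow> 'b" where
  "ev c \<phi> p = (\<Sum>m\<in>ks p. c (lk p m) * mono_val \<phi> m)"

lemma ev_superset:
  assumes "hom_on c" "finite A" "ks p \<subseteq> A"
  shows "ev c \<phi> p = (\<Sum>m\<in>A. c (lk p m) * mono_val \<phi> m)"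
  unfolding ev_def using assms
  by (intro sum.mono_neutral_left) (auto simp: in_keys_iff hom_on_0)

lemma ev_single: "hom_on c \<Longrightarrow> ev c \<phi> (Poly_Mapping.single m a) = c a * mono_val \<phi> m"
  using ev_superset[of c "{m}" "Poly_Mapping.single m a" \<phi>] by simp

lemma ev_add: assumes "hom_on c" shows "ev c \<phi> (p + q) = ev c \<phi> p + ev c \<phi> q"
proof -
  let ?A = "ks p \<union> ks q"
  have "ev c \<phi> (p + q) = (\<Sum>m\<in>?A. c (lk (p + q) m) * mono_val \<phi> m)"
    using Poly_Mapping.keys_add[of p q] by (intro ev_superset[OF assms]) auto
  also have "\<dots> = (\<Sum>m\<in>?A. c (lk p m) * mono_val \<phi> m) + (\<Sum>m\<in>?A. c (lk q m) * mono_val \<phi> m)"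
    by (simp add: lookup_add hom_on_add[OF assms] distrib_right sum.distrib)
  also have "\<dots> = ev c \<phi> p + ev c \<phi> q"
    using ev_superset[OF assms, of ?A p \<phi>] ev_superset[OF assms, of ?A q \<phi>] by simp
  finally show ?thesis .
qed

lemma ev_0 [simp]: "ev c \<phi> 0 = 0"
  by (simp add: ev_def)

lemma ev_sum: "hom_on c \<Longrightarrow> ev c \<phi> (sum f A) = (\<Sum>x\<in>A. ev c \<phi> (f x))"
  by (induction A rule: infinite_finite_induct) (auto simp: ev_add)

lemma poly_mapping_sum_single: "(\<Sum>m\<in>ks p. Poly_Mapping.single m (lk p m)) = p"
  by (rule poly_mapping_eqI)
     (auto simp: lookup_sum lookup_single when_def sum.delta in_keys_iff)

lemma ev_mult: assumes "hom_on c" shows "ev c \<phi> (p * q) = ev c \<phi> p * ev c \<phi> q"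
proof -
  have "p * q = (\<Sum>m\<in>ks p. \<Sum>m'\<in>ks q. Poly_Mapping.single m (lk p m) * Poly_Mapping.single m' (lk q m'))"
    by (simp only: sum_product[symmetric] poly_mapping_sum_single)
  hence "ev c \<phi> (p * q) = (\<Sum>m\<in>ks p. \<Sum>m'\<in>ks q. (c (lk p m) * mono_val \<phi> m) * (c (lk q m') * mono_val \<phi> m'))"
    by (simp add: ev_sum[OF assms] mult_single ev_single[OF assms] hom_on_mult[OF assms] mono_val_add ac_simps)
  thus ?thesis by (simp add: sum_product ev_def)
qed

lemma ev_1 [simp]: "hom_on c \<Longrightarrow> ev c \<phi> 1 = 1"
  using ev_single[of c \<phi> 0 1] by (simp add: hom_on_1)

lemma hom_ev: "hom_on c \<Longrightarrow> hom_on (ev c \<phi>)"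
  by (simp add: hom_on_def[of "ev c \<phi>"] ev_add ev_mult)

lemmas ev_simps = ev_add ev_mult hom_on_diff[OF hom_ev] hom_on_uminus[OF hom_ev] hom_on_power[OF hom_ev]

text \<open>The coefficient embedding and the variables over an arbitrary coefficient ring; for
  coefficients in \<open>rat\<close> and variables in \<open>coord\<close> they are \<open>Const\<close> and \<open>Var\<close>.\<close>

definition cst :: "'k::comm_ring_1 \<Rightarrow> (('v \<Rightarrow>\<^sub>0 nat) \<Rightarrow>\<^sub>0 'k)" where
  "cst a = Poly_Mapping.single 0 a"

definition vr :: "'v \<Rightarrow> (('v \<Rightarrow>\<^sub>0 nat) \<Rightarrow>\<^sub>0 'k::comm_ring_1)" where
  "vr v = Poly_Mapping.single (Poly_Mapping.single v 1) 1"

lemma Const_cst: "Const = cst" by (auto simp: fun_eq_iff Const_def cst_def)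
lemma Var_vr: "Var = vr" by (auto simp: fun_eq_iff Var_def vr_def)

lemma hom_cst: "hom_on cst"
  by (auto simp: hom_on_def cst_def single_add mult_single)

lemma hom_Const: "hom_on Const"
  unfolding Const_cst by (rule hom_cst)

lemma Const_0 [simp]: "Const 0 = 0" and Const_1 [simp]: "Const 1 = 1"
  by (auto simp: hom_on_0 hom_on_1 hom_Const)

lemma cst_eq_iff [simp]: "cst a = cst b \<longleftrightarrow> a = b"
  by (metis cst_def lookup_single_eq)

lemma ev_cst [simp]: "hom_on c \<Longrightarrow> ev c \<phi> (cst a) = c a"
  by (simp add: cst_def ev_single)

lemma ev_vr [simp]: "hom_on c \<Longrightarrow> ev c \<phi> (vr v) = \<phi> v"
  by (simp add: vr_def ev_single hom_on_1)

lemma ev_Const [simp]: "hom_on c \<Longrightarrow> ev c \<phi> (Const a) = c a"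
  by (simp add: Const_cst)

lemma ev_Var [simp]: "hom_on c \<Longrightarrow> ev c \<phi> (Var v) = \<phi> v"
  by (simp add: Var_vr)

lemma single_prod_sum:
  "finite A \<Longrightarrow> Poly_Mapping.single (\<Sum>v\<in>A. f v) (1::'k::comm_ring_1) = (\<Prod>v\<in>A. Poly_Mapping.single (f v) (1::'k))"
proof (induction A rule: finite_induct)
  case (insert x F)
  thus ?case by (simp add: mult_single flip: insert.IH)
qed simp

lemma vr_power: "vr v ^ k = Poly_Mapping.single (Poly_Mapping.single v k) 1"
  by (induction k) (auto simp: vr_def mult_single simp flip: single_add)

lemma ev_cst_vr: "ev cst vr (p :: ('v \<Rightarrow>\<^sub>0 nat) \<Rightarrow>\<^sub>0 'k::comm_ring_1) = p"
proof -
  have "mono_val vr m = (Poly_Mapping.single m 1 :: ('v \<Rightarrow>\<^sub>0 nat) \<Rightarrow>\<^sub>0 'k)" for m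
    by (simp add: mono_val_def vr_power single_prod_sum[symmetric] poly_mapping_sum_single)
  hence "ev cst vr p = (\<Sum>m\<in>ks p. Poly_Mapping.single m (lk p m))"
    unfolding ev_def cst_def by (simp add: mult_single)
  thus ?thesis by (simp add: poly_mapping_sum_single)
qed

lemma hom_eq_ev:
  assumes h: "hom_on h"
  shows "h p = ev (\<lambda>a. h (cst a)) (\<lambda>v. h (vr v)) p"
proof -
  have "h p = h (ev cst vr p)" by (simp add: ev_cst_vr)
  also have "\<dots> = ev (\<lambda>a. h (cst a)) (\<lambda>v. h (vr v)) p"
    by (simp add: ev_def mono_val_def hom_on_sum[OF h] hom_on_mult[OF h] hom_on_prod[OF h] hom_on_power[OF h])
  finally show ?thesis .
qed

text \<open>Comparing values only on the variables of \<open>p\<close> allows maps that differ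
  elsewhere, such as restriction to the diagonal and the identity, to be identified on a
  subring.\<close>

lemma hom_eqI:
  assumes "hom_on h" "hom_on h'" "\<And>a. h (Const a) = h' (Const a)" "\<And>v. v \<in> vars p \<Longrightarrow> h (Var v) = h' (Var v)"
  shows "h p = h' p"
proof -
  have "ev (\<lambda>a. h (cst a)) (\<lambda>v. h (vr v)) p = ev (\<lambda>a. h' (cst a)) (\<lambda>v. h' (vr v)) p"
    unfolding ev_def mono_val_def using assms(3,4)
    by (intro sum.cong arg_cong2[of _ _ _ _ "(*)"] prod.cong arg_cong2[of _ _ _ _ "(^)"])
       (auto simp: vars_def Const_cst Var_vr)
  thus ?thesis using hom_eq_ev[OF assms(1), of p] hom_eq_ev[OF assms(2), of p] by simp
qed

lemma subst_ev: "subst \<sigma> = ev Const \<sigma>"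
  by (auto simp: fun_eq_iff subst_def ev_def mono_val_def)

lemma hom_subst: "hom_on (subst \<sigma>)"
  by (simp add: subst_ev hom_ev hom_Const)

lemma subst_simps [simp]:
  "subst \<sigma> (Var v) = \<sigma> v" "subst \<sigma> (Const a) = Const a" "subst \<sigma> 0 = 0" "subst \<sigma> 1 = 1"
  "subst \<sigma> (p + q) = subst \<sigma> p + subst \<sigma> q" "subst \<sigma> (p - q) = subst \<sigma> p - subst \<sigma> q"
  "subst \<sigma> (p * q) = subst \<sigma> p * subst \<sigma> q" "subst \<sigma> (- p) = - subst \<sigma> p"
  "subst \<sigma> (p ^ n) = subst \<sigma> p ^ n"
  by (simp_all add: hom_on_simps[OF hom_subst]) (simp_all add: subst_ev hom_Const)

lemma subst_subst: "subst \<tau> (subst \<sigma> p) = subst (\<lambda>v. subst \<tau> (\<sigma> v)) p"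
  by (rule hom_eqI[OF hom_on_comp[OF hom_subst hom_subst] hom_subst]) auto

lemma subst_cong: "(\<And>v. v \<in> vars p \<Longrightarrow> \<sigma> v = \<tau> v) \<Longrightarrow> subst \<sigma> p = subst \<tau> p"
  by (rule hom_eqI[OF hom_subst hom_subst]) auto

lemma subst_Var [simp]: "subst Var p = p"
  by (rule hom_eqI[OF hom_subst hom_on_id]) auto

lemma vars_Const [simp]: "vars (Const a) = {}" and vars_0 [simp]: "vars 0 = {}"
  and vars_1 [simp]: "vars 1 = {}" and vars_Var [simp]: "vars (Var v) = {v}"
  by (auto simp: vars_def Const_def Var_def split: if_splits)

lemma vars_add: "vars (p + q) \<subseteq> vars p \<union> vars q"
  using Poly_Mapping.keys_add[of p q] by (auto simp: vars_def)

lemma vars_uminus [simp]: "vars (- p) = vars p"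
  by (auto simp: vars_def in_keys_iff)

lemma vars_diff: "vars (p - q) \<subseteq> vars p \<union> vars q"
  using vars_add[of p "- q"] by simp

lemma vars_mult: "vars (p * q) \<subseteq> vars p \<union> vars q"
proof
  fix v assume "v \<in> vars (p * q)"
  then obtain m where m: "m \<in> ks (p * q)" "v \<in> ks m" by (auto simp: vars_def)
  with Poly_Mapping.keys_mult[of p q] obtain a b where "m = a + b" "a \<in> ks p" "b \<in> ks q" by auto
  with m show "v \<in> vars p \<union> vars q" using Poly_Mapping.keys_add[of a b] by (auto simp: vars_def)
qed

text \<open>Any set of coordinates is allowed: the argument also uses the ring of the free
  coordinates \<open>V - U\<close> of a graph, the ring \<open>PV {t0}\<close> of the base and the
  constants \<open>PV {}\<close>.\<close>

definition PV :: "coord set \<Rightarrow> mpoly set" where "PV V = {p. vars p \<subseteq> V}"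

lemma PV_intros [simp, intro]:
  "Const a \<in> PV V" "0 \<in> PV V" "1 \<in> PV V" "v \<in> V \<Longrightarrow> Var v \<in> PV V"
  "p \<in> PV V \<Longrightarrow> q \<in> PV V \<Longrightarrow> p + q \<in> PV V" "p \<in> PV V \<Longrightarrow> q \<in> PV V \<Longrightarrow> p - q \<in> PV V"
  "p \<in> PV V \<Longrightarrow> q \<in> PV V \<Longrightarrow> p * q \<in> PV V" "p \<in> PV V \<Longrightarrow> - p \<in> PV V"
  using vars_add[of p q] vars_diff[of p q] vars_mult[of p q] by (auto simp: PV_def)

lemma PV_power [simp, intro]: "p \<in> PV V \<Longrightarrow> p ^ n \<in> PV V"
  by (induction n) auto

lemma PV_sum [intro]: "(\<And>x. x \<in> A \<Longrightarrow> f x \<in> PV V) \<Longrightarrow> sum f A \<in> PV V"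
  by (induction A rule: infinite_finite_induct) auto

lemma PV_prod [intro]: "(\<And>x. x \<in> A \<Longrightarrow> f x \<in> PV V) \<Longrightarrow> prod f A \<in> PV V"
  by (induction A rule: infinite_finite_induct) auto

lemma PV_mono: "V \<subseteq> W \<Longrightarrow> p \<in> PV V \<Longrightarrow> p \<in> PV W"
  by (auto simp: PV_def)

lemma subst_PV: "p \<in> PV V \<Longrightarrow> (\<And>v. v \<in> V \<Longrightarrow> \<sigma> v \<in> PV W) \<Longrightarrow> subst \<sigma> p \<in> PV W"
  unfolding subst_def by (intro PV_sum PV_intros PV_prod PV_power) (auto simp: PV_def vars_def)

lemma PV_induct [consumes 1, case_names Const Var add mult]:
  assumes "p \<in> PV V" "\<And>a. P (Const a)" "\<And>v. v \<in> V \<Longrightarrow> P (Var v)"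
    "\<And>p q. p \<in> PV V \<Longrightarrow> q \<in> PV V \<Longrightarrow> P p \<Longrightarrow> P q \<Longrightarrow> P (p + q)"
    "\<And>p q. p \<in> PV V \<Longrightarrow> q \<in> PV V \<Longrightarrow> P p \<Longrightarrow> P q \<Longrightarrow> P (p * q)"
  shows "P p"
proof -
  have pow: "P (q ^ n) \<and> q ^ n \<in> PV V" if "P q" "q \<in> PV V" for q n
    using that assms(2)[of 1] assms(5) by (induction n) auto
  have prod: "P (prod f A) \<and> prod f A \<in> PV V" if "\<And>x. x \<in> A \<Longrightarrow> P (f x) \<and> f x \<in> PV V" for f :: "coord \<Rightarrow> mpoly" and A
    using that assms(2)[of 1] assms(5) by (induction A rule: infinite_finite_induct) auto
  have sm: "P (sum f A) \<and> sum f A \<in> PV V" if "\<And>x. x \<in> A \<Longrightarrow> P (f x) \<and> f x \<in> PV V" for f :: "(coord \<Rightarrow>\<^sub>0 nat) \<Rightarrow> mpoly" and A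
    using that assms(2)[of 0] assms(4) by (induction A rule: infinite_finite_induct) auto
  \<comment> \<open>\<open>subst Var p\<close> equals \<open>p\<close> and unfolds to its expansion
    into coefficients times monomials.\<close>
  have "P (subst Var p) \<and> subst Var p \<in> PV V"
    unfolding subst_def
  proof (intro sm)
    fix m assume m: "m \<in> ks p"
    let ?q = "\<Prod>v\<in>ks m. Var v ^ lk m v"
    have "ks m \<subseteq> V" using m assms(1) by (auto simp: PV_def vars_def)
    hence "P ?q \<and> ?q \<in> PV V"
      by (intro prod pow) (auto intro!: assms(3))
    thus "P (Const (lk p m) * ?q) \<and> Const (lk p m) * ?q \<in> PV V"
      using assms(2,5) by auto
  qed
  thus ?thesis by simp
qed

section \<open>Ideals and points\<close>

definition subr :: "'a::comm_ring_1 set \<Rightarrow> bool" where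
  "subr C \<longleftrightarrow> 0 \<in> C \<and> 1 \<in> C \<and> (\<forall>a\<in>C. - a \<in> C) \<and> (\<forall>a\<in>C. \<forall>b\<in>C. a + b \<in> C \<and> a * b \<in> C)"

definition TR :: "'a::comm_ring_1 set \<Rightarrow> 'a ring" where
  "TR C = ring_of_type_algebra\<lparr>carrier := C\<rparr>"

lemma type_ring_simps [simp]:
  "carrier (TR C) = C"
  "x \<oplus>\<^bsub>TR C\<^esub> y = x + y" "x \<otimes>\<^bsub>TR C\<^esub> y = x * y"
  "\<zero>\<^bsub>TR C\<^esub> = 0" "\<one>\<^bsub>TR C\<^esub> = 1"
  by (simp_all add: TR_def ring_of_type_algebra_def)

lemma cring_subr:
  assumes "subr C"
  shows "cring (TR C)"
proof -
  have "\<exists>y\<in>C. y + x = 0" if "x \<in> C" for x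
    using that assms by (intro bexI[of _ "- x"]) (auto simp: subr_def)
  thus ?thesis using assms
    by (intro cringI abelian_groupI comm_monoidI) (auto simp: ac_simps distrib_left distrib_right subr_def)
qed

definition idlc :: "'a::comm_ring_1 set \<Rightarrow> 'a set \<Rightarrow> bool" where
  "idlc C I \<longleftrightarrow> I \<subseteq> C \<and> 0 \<in> I \<and> (\<forall>a\<in>I. \<forall>b\<in>I. a + b \<in> I) \<and> (\<forall>a\<in>C. \<forall>i\<in>I. a * i \<in> I)"

lemma ideal_subr_iff:
  assumes C: "subr C"
  shows "ideal I (TR C) \<longleftrightarrow> idlc C I"
proof
  let ?R = "TR C"
  have R: "ring ?R" using cring_subr[OF C] by (rule cring.axioms)
  {
    assume "ideal I ?R"
    then interpret ideal I ?R .
    show "idlc C I"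
      using a_subset additive_subgroup.zero_closed[OF is_additive_subgroup]
        additive_subgroup.a_closed[OF is_additive_subgroup] I_l_closed by (auto simp: idlc_def)
  next
    assume I: "idlc C I"
    have m: "a_inv ?R x = - x" if "x \<in> C" for x
      using that C by (intro abelian_group.minus_equality[OF ring.is_abelian_group[OF R]]) (auto simp: subr_def)
    show "ideal I ?R"
    proof (intro idealI R subgroup.intro)
      show "inv\<^bsub>add_monoid ?R\<^esub> x \<in> I" if "x \<in> I" for x
      proof -
        have "x \<in> C" "- 1 * x \<in> I" using I C that unfolding idlc_def subr_def by blast+
        thus ?thesis using m[of x] by (simp add: a_inv_def)
      qed
    next
      show "a \<otimes>\<^bsub>TR C\<^esub> x \<in> I" if "a \<in> I" "x \<in> carrier (TR C)" for a x
      proof -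
        have "x * a \<in> I" using I that by (auto simp: idlc_def)
        thus ?thesis by (simp add: mult.commute)
      qed
    qed (use I in \<open>auto simp: idlc_def\<close>)
  }
qed

definition Rg :: "coord set \<Rightarrow> mpoly ring" where
  "Rg V = TR (PV V)"

definition cs :: "nat \<Rightarrow> nat \<Rightarrow> coord set" where
  "cs b n = Base ` {..<b} \<union> Cube ` {1..n}"

lemma coord_ring_Rg: "coord_ring b n = Rg (cs b n)"
  by (simp add: coord_ring_def Rg_def TR_def PV_def cs_def)

lemma finite_cs [simp]: "finite (cs b n)"
  by (simp add: cs_def)

lemma Base_in_cs [simp]: "Base j \<in> cs b n \<longleftrightarrow> j < b"
  and Cube_in_cs [simp]: "Cube i \<in> cs b n \<longleftrightarrow> 1 \<le> i \<and> i \<le> n"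
  by (auto simp: cs_def)

lemma subr_PV: "subr (PV V)"
  by (auto simp: subr_def)

lemma Rg_simps [simp]: "carrier (Rg V) = PV V"
  by (simp add: Rg_def)

lemma cring_Rg: "cring (Rg V)"
  unfolding Rg_def by (rule cring_subr[OF subr_PV])

definition idl :: "coord set \<Rightarrow> mpoly set \<Rightarrow> bool" where
  "idl V I \<longleftrightarrow> I \<subseteq> PV V \<and> 0 \<in> I \<and> (\<forall>a\<in>I. \<forall>b\<in>I. a + b \<in> I) \<and> (\<forall>a\<in>PV V. \<forall>i\<in>I. a * i \<in> I)"

lemma ideal_iff: "ideal I (Rg V) \<longleftrightarrow> idl V I"
  by (simp add: Rg_def ideal_subr_iff[OF subr_PV] idl_def idlc_def)

lemma idlD: assumes "idl V I"
  shows "a \<in> I \<Longrightarrow> a \<in> PV V" "0 \<in> I" "a \<in> I \<Longrightarrow> b \<in> I \<Longrightarrow> a + b \<in> I"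
    "a \<in> PV V \<Longrightarrow> i \<in> I \<Longrightarrow> a * i \<in> I" "i \<in> I \<Longrightarrow> a \<in> PV V \<Longrightarrow> i * a \<in> I"
  using assms by (auto simp: idl_def mult.commute)

lemma idl_uminus: "idl V I \<Longrightarrow> a \<in> I \<Longrightarrow> - a \<in> I"
  using idlD(4)[of V I "- 1" a] by auto

lemma idl_diff: "idl V I \<Longrightarrow> a \<in> I \<Longrightarrow> b \<in> I \<Longrightarrow> a - b \<in> I"
  using idlD(3)[of V I a "- b"] idl_uminus by auto

lemma idl_sum: "idl V I \<Longrightarrow> (\<And>x. x \<in> A \<Longrightarrow> f x \<in> I) \<Longrightarrow> sum f A \<in> I"
  by (induction A rule: infinite_finite_induct) (auto simp: idlD)

lemma idl_cancel: "idl V I \<Longrightarrow> a - b \<in> I \<Longrightarrow> a \<in> I \<longleftrightarrow> b \<in> I"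
  using idlD(3)[of V I "a - b" b] idl_diff[of V I a "a - b"] by auto

lemma idl_one: "idl V I \<Longrightarrow> 1 \<in> I \<Longrightarrow> a \<in> PV V \<Longrightarrow> a \<in> I"
  using idlD(4)[of V I a 1] by auto

definition prime_idl :: "coord set \<Rightarrow> mpoly set \<Rightarrow> bool" where
  "prime_idl V Q \<longleftrightarrow> idl V Q \<and> 1 \<notin> Q \<and> (\<forall>a\<in>PV V. \<forall>b\<in>PV V. a * b \<in> Q \<longrightarrow> a \<in> Q \<or> b \<in> Q)"

lemma primeideal_iff: "primeideal Q (Rg V) \<longleftrightarrow> prime_idl V Q"
proof
  assume "primeideal Q (Rg V)"
  then interpret primeideal Q "Rg V" .
  have "idl V Q" using is_ideal by (simp add: ideal_iff)
  moreover have "1 \<notin> Q" using I_notcarr idl_one[OF \<open>idl V Q\<close>] idlD(1)[OF \<open>idl V Q\<close>] by auto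
  ultimately show "prime_idl V Q" using I_prime by (auto simp: prime_idl_def Rg_def)
next
  assume "prime_idl V Q"
  thus "primeideal Q (Rg V)"
    by (intro primeidealI cring_Rg) (auto simp: prime_idl_def ideal_iff, auto simp: Rg_def)
qed

lemma prime_idlD: assumes "prime_idl V Q"
  shows "idl V Q" "1 \<notin> Q" "a \<in> PV V \<Longrightarrow> b \<in> PV V \<Longrightarrow> a * b \<in> Q \<Longrightarrow> a \<in> Q \<or> b \<in> Q"
  using assms by (auto simp: prime_idl_def)

lemma prime_idl_power: "prime_idl V Q \<Longrightarrow> a \<in> PV V \<Longrightarrow> a ^ n \<in> Q \<Longrightarrow> a \<in> Q"
  by (induction n) (auto dest: prime_idlD)

lemma points_iff: "Q \<in> points S b n \<longleftrightarrow>
    prime_idl (cs b n) Q \<and> (\<forall>j<b. \<forall>a\<in>S. Var (Base j) - Const a \<notin> Q)"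
  by (simp add: points_def coord_ring_Rg primeideal_iff)

definition gen :: "coord set \<Rightarrow> mpoly set \<Rightarrow> mpoly set" where
  "gen V F = \<Inter>{I. idl V I \<and> F \<subseteq> I}"

lemma genideal_gen: "genideal (Rg V) F = gen V F"
  by (simp add: genideal_def gen_def ideal_iff)

lemma gen_incl: "F \<subseteq> gen V F"
  by (auto simp: gen_def)

lemma gen_least: "idl V I \<Longrightarrow> F \<subseteq> I \<Longrightarrow> gen V F \<subseteq> I"
  by (auto simp: gen_def)

lemma idl_PV: "idl V (PV V)"
  by (auto simp: idl_def)

lemma idl_gen: "F \<subseteq> PV V \<Longrightarrow> idl V (gen V F)"
  using idl_PV[of V] by (auto simp: idl_def gen_def)

lemma gen_subset_iff: "idl V I \<Longrightarrow> gen V F \<subseteq> I \<longleftrightarrow> F \<subseteq> I"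
  using gen_least gen_incl by blast

lemma gen_idl: "idl V I \<Longrightarrow> gen V I = I"
  by (simp add: gen_incl gen_least subset_antisym)

definition maps :: "coord set \<Rightarrow> coord set \<Rightarrow> (coord \<Rightarrow> mpoly) \<Rightarrow> bool" where
  "maps V W \<sigma> \<longleftrightarrow> (\<forall>v\<in>V. \<sigma> v \<in> PV W)"

lemma maps_PV: "maps V W \<sigma> \<Longrightarrow> p \<in> PV V \<Longrightarrow> subst \<sigma> p \<in> PV W"
  by (auto simp: maps_def intro: subst_PV)

text \<open>The preimage of \<open>J\<close> under the substitution is an ideal of
  \<open>PV V\<close>, so it contains \<open>gen V F\<close> as soon as it contains
  \<open>F\<close>.\<close>

lemma subst_gen_subset_iff:
  assumes "maps V W \<sigma>" "idl W J" "F \<subseteq> PV V"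
  shows "subst \<sigma> ` gen V F \<subseteq> J \<longleftrightarrow> subst \<sigma> ` F \<subseteq> J"
proof
  assume "subst \<sigma> ` F \<subseteq> J"
  moreover have "idl V {p\<in>PV V. subst \<sigma> p \<in> J}"
    using assms by (auto simp: idl_def maps_PV)
  ultimately have "gen V F \<subseteq> {p\<in>PV V. subst \<sigma> p \<in> J}"
    using assms by (intro gen_least) auto
  thus "subst \<sigma> ` gen V F \<subseteq> J" by auto
qed (use gen_incl[of F V] in auto)

lemma gen_subst_gen:
  assumes "maps V W \<sigma>" "F \<subseteq> PV V"
  shows "gen W (subst \<sigma> ` gen V F) = gen W (subst \<sigma> ` F)"
proof -
  have "{I. idl W I \<and> subst \<sigma> ` gen V F \<subseteq> I} = {I. idl W I \<and> subst \<sigma> ` F \<subseteq> I}"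
    using subst_gen_subset_iff[OF assms(1) _ assms(2)] by blast
  thus ?thesis by (simp add: gen_def)
qed

lemma gen_subst_gen_Un:
  assumes "maps V W \<sigma>" "F \<subseteq> PV V" "maps V' W \<sigma>'" "F' \<subseteq> PV V'"
  shows "gen W (subst \<sigma> ` gen V F \<union> subst \<sigma>' ` gen V' F') = gen W (subst \<sigma> ` F \<union> subst \<sigma>' ` F')"
proof -
  have "{I. idl W I \<and> subst \<sigma> ` gen V F \<union> subst \<sigma>' ` gen V' F' \<subseteq> I}
      = {I. idl W I \<and> subst \<sigma> ` F \<union> subst \<sigma>' ` F' \<subseteq> I}"
    using subst_gen_subset_iff[OF assms(1) _ assms(2)] subst_gen_subset_iff[OF assms(3) _ assms(4)]
    by (simp add: le_sup_iff cong: conj_cong)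
  thus ?thesis by (simp add: gen_def)
qed

lemma subst_image_subst: "subst \<tau> ` subst \<sigma> ` F = subst (\<lambda>v. subst \<tau> (\<sigma> v)) ` F"
  by (simp add: image_image subst_subst)

text \<open>For mutually inverse substitutions the image of an ideal is its preimage under the
  inverse, and preimages inherit the ideal and prime ideal properties.\<close>

lemma aut_ideal:
  assumes "maps V V \<sigma>" "maps V V \<sigma>'" "\<And>v. v \<in> V \<Longrightarrow> subst \<sigma> (\<sigma>' v) = Var v"
    "\<And>v. v \<in> V \<Longrightarrow> subst \<sigma>' (\<sigma> v) = Var v"
  shows "p \<in> PV V \<Longrightarrow> subst \<sigma> (subst \<sigma>' p) = p"
    and "I \<subseteq> PV V \<Longrightarrow> subst \<sigma> ` I = {p\<in>PV V. subst \<sigma>' p \<in> I}"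
    and "idl V I \<Longrightarrow> idl V (subst \<sigma> ` I)"
    and "prime_idl V I \<Longrightarrow> prime_idl V (subst \<sigma> ` I)"
proof -
  have inv: "subst \<sigma> (subst \<sigma>' p) = p" "subst \<sigma>' (subst \<sigma> p) = p" if "p \<in> PV V" for p
  proof -
    have "subst (\<lambda>v. subst \<sigma> (\<sigma>' v)) p = subst Var p" "subst (\<lambda>v. subst \<sigma>' (\<sigma> v)) p = subst Var p"
      by (rule subst_cong; use that assms(3,4) in \<open>auto simp: PV_def\<close>)+
    thus "subst \<sigma> (subst \<sigma>' p) = p" "subst \<sigma>' (subst \<sigma> p) = p" by (simp_all add: subst_subst)
  qed
  show "p \<in> PV V \<Longrightarrow> subst \<sigma> (subst \<sigma>' p) = p" by (rule inv(1))
  have *: "subst \<sigma> ` I = {p\<in>PV V. subst \<sigma>' p \<in> I}" if "I \<subseteq> PV V" for I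
  proof (intro equalityI subsetI)
    fix p assume "p \<in> subst \<sigma> ` I"
    then obtain q where "q \<in> I" "p = subst \<sigma> q" by blast
    thus "p \<in> {p\<in>PV V. subst \<sigma>' p \<in> I}"
      using that inv(2)[of q] maps_PV[OF assms(1), of q] by auto
  next
    fix p assume "p \<in> {p\<in>PV V. subst \<sigma>' p \<in> I}"
    thus "p \<in> subst \<sigma> ` I" using inv(1)[of p] by (intro image_eqI[of _ _ "subst \<sigma>' p"]) simp_all
  qed
  show "I \<subseteq> PV V \<Longrightarrow> subst \<sigma> ` I = {p\<in>PV V. subst \<sigma>' p \<in> I}" by (rule *)
  have id: "idl V (subst \<sigma> ` I)" if I: "idl V I" for I
  proof -
    have "I \<subseteq> PV V" using idlD(1)[OF I] by blast
    show ?thesis unfolding idl_def *[OF \<open>I \<subseteq> PV V\<close>]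
      using idlD(2-4)[OF I] maps_PV[OF assms(2)] by auto
  qed
  thus "idl V I \<Longrightarrow> idl V (subst \<sigma> ` I)" .
  show "prime_idl V (subst \<sigma> ` I)" if I: "prime_idl V I"
  proof -
    have "I \<subseteq> PV V" using idlD(1)[OF prime_idlD(1)[OF I]] by blast
    show ?thesis unfolding prime_idl_def
    proof (intro conjI id prime_idlD(1)[OF I] ballI impI)
      show "1 \<notin> subst \<sigma> ` I" using prime_idlD(2)[OF I] by (simp add: *[OF \<open>I \<subseteq> PV V\<close>])
      fix a b assume "a \<in> PV V" "b \<in> PV V" "a * b \<in> subst \<sigma> ` I"
      thus "a \<in> subst \<sigma> ` I \<or> b \<in> subst \<sigma> ` I"
        using prime_idlD(3)[OF I maps_PV[OF assms(2)] maps_PV[OF assms(2)], of a b]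
        by (simp add: *[OF \<open>I \<subseteq> PV V\<close>])
    qed
  qed
qed

section \<open>Ideals of graphs\<close>

text \<open>
  \<open>gdata V U f\<close> describes the graph of the rational map with components \<open>1 / f w\<close>, \<open>w \<in> U\<close>, on the
  affine space with coordinates \<open>V - U\<close>.
\<close>

definition geq :: "(coord \<Rightarrow> mpoly) \<Rightarrow> coord \<Rightarrow> mpoly" where
  "geq f w = f w * Var w - 1"

definition gdata :: "coord set \<Rightarrow> coord set \<Rightarrow> (coord \<Rightarrow> mpoly) \<Rightarrow> bool" where
  "gdata V U f \<longleftrightarrow> finite V \<and> U \<subseteq> V \<and> (\<forall>w\<in>U. f w \<in> PV (V - U))"

definition gprod :: "coord set \<Rightarrow> (coord \<Rightarrow> mpoly) \<Rightarrow> mpoly" where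
  "gprod U f = (\<Prod>w\<in>U. f w)"

lemma gdataD: assumes "gdata V U f"
  shows "finite V" "finite U" "U \<subseteq> V" "w \<in> U \<Longrightarrow> f w \<in> PV (V - U)" "w \<in> U \<Longrightarrow> f w \<in> PV V"
    "gprod U f \<in> PV (V - U)" "gprod U f \<in> PV V" "geq f ` U \<subseteq> PV V"
proof -
  show 1: "finite V" "finite U" "U \<subseteq> V" and 2: "w \<in> U \<Longrightarrow> f w \<in> PV (V - U)" for w
    using assms finite_subset by (auto simp: gdata_def)
  show 3: "w \<in> U \<Longrightarrow> f w \<in> PV V" for w using 2[of w] PV_mono[of "V - U" V] by auto
  show 4: "gprod U f \<in> PV (V - U)" using 2 by (auto simp: gprod_def)
  show "gprod U f \<in> PV V" using 4 PV_mono[of "V - U" V] by auto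
  show "geq f ` U \<subseteq> PV V" using 1 3 by (auto simp: geq_def)
qed

lemma idl_prod_cong:
  assumes "idl V J" "finite U" "\<And>w. w \<in> U \<Longrightarrow> g w - 1 \<in> J" "\<And>w. w \<in> U \<Longrightarrow> g w \<in> PV V"
  shows "(\<Prod>w\<in>U. g w) - 1 \<in> J"
  using assms(2,3,4)
proof (induction U rule: finite_induct)
  case (insert w U)
  have "(g w - 1) * (\<Prod>w\<in>U. g w) + ((\<Prod>w\<in>U. g w) - 1) \<in> J"
    using insert by (intro idlD(3)[OF assms(1)] idlD(5)[OF assms(1)]) auto
  thus ?case using insert by (simp add: algebra_simps)
qed (use assms in \<open>simp add: idlD\<close>)

text \<open>Modulo the equations each \<open>f w\<close> is inverse to \<open>Var w\<close>, so the
  common denominator is a unit on the graph.\<close>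

lemma gprod_unit:
  assumes "gdata V U f" "idl V J" "geq f ` U \<subseteq> J"
  shows "gprod U f * (\<Prod>w\<in>U. Var w) - 1 \<in> J"
  unfolding gprod_def prod.distrib[symmetric]
  using assms gdataD[OF assms(1)] by (intro idl_prod_cong) (auto simp: geq_def)

lemma gprod_power_cancel:
  assumes "gdata V U f" "idl V J" "geq f ` U \<subseteq> J" "p \<in> PV V" "gprod U f ^ n * p \<in> J"
  shows "p \<in> J"
proof -
  define F where "F = gprod U f"
  define w where "w = (\<Prod>w\<in>U. Var w)"
  have FP: "F \<in> PV V" "w \<in> PV V" using gdataD[OF assms(1)] by (auto simp: F_def w_def)
  have "F * w - 1 \<in> J" using gprod_unit[OF assms(1-3)] by (simp add: F_def w_def)
  have "F ^ n * p \<in> J \<Longrightarrow> p \<in> J" for n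
  proof (induction n)
    case (Suc n)
    have "w * (F ^ Suc n * p) - (F * w - 1) * (F ^ n * p) \<in> J"
      using Suc.prems FP assms(4) \<open>F * w - 1 \<in> J\<close>
      by (intro idl_diff[OF assms(2) idlD(4)[OF assms(2)] idlD(5)[OF assms(2)]]) auto
    thus ?case using Suc.IH by (simp add: algebra_simps)
  qed auto
  thus ?thesis using assms(5) by (simp add: F_def)
qed

text \<open>Elimination of the dependent coordinates: on the graph \<open>Var w\<close> is
  \<open>1 / f w\<close>, and a power of the common denominator \<open>gprod U f\<close> clears all
  fractions.\<close>

lemma graph_reduce:
  assumes "gdata V U f" "p \<in> PV V"
  obtains n q where "q \<in> PV (V - U)" "gprod U f ^ n * p - q \<in> gen V (geq f ` U)"
proof -
  define F where "F = gprod U f"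
  define J where "J = gen V (geq f ` U)"
  note D = gdataD[OF assms(1)]
  have J: "idl V J" unfolding J_def using D by (intro idl_gen)
  have F: "F \<in> PV V" "F \<in> PV (V - U)" using D by (auto simp: F_def)
  have sub: "q \<in> PV (V - U) \<Longrightarrow> q \<in> PV V" for q using PV_mono[of "V - U" V] by auto
  have "\<exists>n. \<exists>q\<in>PV (V - U). F ^ n * p - q \<in> J"
    using assms(2)
  proof (induction p rule: PV_induct)
    case (Const a)
    thus ?case by (intro exI[of _ 0] bexI[of _ "Const a"]) (auto simp: idlD[OF J])
  next
    case (Var v)
    show ?case
    proof (cases "v \<in> U")
      case False
      thus ?thesis using Var by (intro exI[of _ 0] bexI[of _ "Var v"]) (auto simp: idlD[OF J])
    next
      case True
      have "geq f v \<in> J" using True gen_incl[of "geq f ` U" V] by (auto simp: J_def)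
      \<comment> \<open>The common denominator times \<open>1 / f v\<close> is the product of the
        other denominators.\<close>
      have FF: "F = f v * (\<Prod>w\<in>U - {v}. f w)" using True D by (simp add: F_def gprod_def prod.remove)
      have R: "(\<Prod>w\<in>U - {v}. f w) \<in> PV (V - U)" using D by auto
      have "F ^ 1 * Var v - (\<Prod>w\<in>U - {v}. f w) = (\<Prod>w\<in>U - {v}. f w) * geq f v"
        by (simp add: FF geq_def algebra_simps)
      also have "\<dots> \<in> J" using R sub \<open>geq f v \<in> J\<close> by (intro idlD(4)[OF J]) auto
      finally show ?thesis using R by blast
    qed
  next
    case (add p q)
    then obtain n m p' q' where *: "p' \<in> PV (V - U)" "q' \<in> PV (V - U)" "F ^ n * p - p' \<in> J" "F ^ m * q - q' \<in> J"
      by blast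
    have "F ^ (n + m) * (p + q) - (F ^ m * p' + F ^ n * q') = F ^ m * (F ^ n * p - p') + F ^ n * (F ^ m * q - q')"
      by (simp add: algebra_simps power_add)
    also have "\<dots> \<in> J" using * F by (intro idlD(3)[OF J idlD(4)[OF J] idlD(4)[OF J]]) auto
    finally show ?case using * F by blast
  next
    case (mult p q)
    then obtain n m p' q' where *: "p' \<in> PV (V - U)" "q' \<in> PV (V - U)" "F ^ n * p - p' \<in> J" "F ^ m * q - q' \<in> J"
      by blast
    have "F ^ (n + m) * (p * q) - (p' * q') = F ^ m * q * (F ^ n * p - p') + p' * (F ^ m * q - q')"
      by (simp add: algebra_simps power_add)
    also have "\<dots> \<in> J" using * F mult.hyps sub[OF *(1)] by (intro idlD(3)[OF J idlD(4)[OF J] idlD(4)[OF J]]) auto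
    finally show ?case using * F by blast
  qed
  thus ?thesis using that by (auto simp: F_def J_def)
qed

text \<open>
  For a homomorphism \<open>ev c \<psi>\<close> to a domain in which the denominators \<open>f w\<close> do not vanish,
  \<open>gker V U f c \<psi>\<close> is the kernel of its extension to the coordinate ring of the graph.
\<close>

definition frc :: "'d::idom \<Rightarrow> 'd fract" where "frc a = Fract a 1"

lemma hom_frc: "hom_on frc"
  by (auto simp: hom_on_def frc_def One_fract_def)

lemma frc_eq_iff [simp]: "frc a = frc b \<longleftrightarrow> a = b"
  by (simp add: frc_def eq_fract)

lemma frc_0 [simp]: "frc 0 = 0"
  by (rule hom_on_0[OF hom_frc])

lemma frc_0_iff [simp]: "frc a = 0 \<longleftrightarrow> a = 0"
  using frc_eq_iff[of a 0] by simp

definition gmap :: "coord set \<Rightarrow> (coord \<Rightarrow> mpoly) \<Rightarrow> (rat \<Rightarrow> 'd::idom) \<Rightarrow> (coord \<Rightarrow> 'd) \<Rightarrow> mpoly \<Rightarrow> 'd fract" where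
  "gmap U f c \<psi> = ev (\<lambda>a. frc (c a)) (\<lambda>v. if v \<in> U then inverse (frc (ev c \<psi> (f v))) else frc (\<psi> v))"

definition gker :: "coord set \<Rightarrow> coord set \<Rightarrow> (coord \<Rightarrow> mpoly) \<Rightarrow> (rat \<Rightarrow> 'd::idom) \<Rightarrow> (coord \<Rightarrow> 'd) \<Rightarrow> mpoly set" where
  "gker V U f c \<psi> = {p\<in>PV V. gmap U f c \<psi> p = 0}"

context
  fixes V U f and c :: "rat \<Rightarrow> 'd::idom" and \<psi>
  assumes g: "gdata V U f" and c: "hom_on c" and nz: "\<And>w. w \<in> U \<Longrightarrow> ev c \<psi> (f w) \<noteq> 0"
begin

lemma hom_gmap: "hom_on (gmap U f c \<psi>)"
  unfolding gmap_def by (intro hom_ev hom_on_comp[OF hom_frc c])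

lemma gmap_poly: "p \<in> PV (V - U) \<Longrightarrow> gmap U f c \<psi> p = frc (ev c \<psi> p)"
  by (rule hom_eqI[OF hom_gmap hom_on_comp[OF hom_frc hom_ev[OF c]]])
     (auto simp: gmap_def hom_on_comp[OF hom_frc c] c PV_def)

lemma prime_gker: "prime_idl V (gker V U f c \<psi>)"
  by (auto simp: prime_idl_def idl_def gker_def hom_on_simps[OF hom_gmap])

lemma gker_geq: "geq f ` U \<subseteq> gker V U f c \<psi>"
proof
  fix p assume "p \<in> geq f ` U"
  then obtain w where w: "w \<in> U" "p = geq f w" by auto
  have "gmap U f c \<psi> (Var w) = inverse (frc (ev c \<psi> (f w)))"
    using w by (simp add: gmap_def hom_on_comp[OF hom_frc c])
  moreover have "frc (ev c \<psi> (f w)) \<noteq> 0" using nz[OF w(1)] by simp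
  ultimately show "p \<in> gker V U f c \<psi>"
    using w gdataD[OF g] gmap_poly[OF gdataD(4)[OF g w(1)]]
    by (auto simp: gker_def geq_def hom_on_simps[OF hom_gmap] image_subset_iff)
qed

lemma gker_poly_iff: "p \<in> PV (V - U) \<Longrightarrow> p \<in> gker V U f c \<psi> \<longleftrightarrow> ev c \<psi> p = 0"
  using PV_mono[of "V - U" V p] by (auto simp: gker_def gmap_poly)

text \<open>The common denominator is a unit modulo the equations, so membership of \<open>p\<close>
  can be tested on its reduced form \<open>q\<close>, where only the evaluation of free coordinates
  is involved.\<close>

lemma gker_iff:
  assumes "p \<in> PV V" "q \<in> PV (V - U)" "gprod U f ^ n * p - q \<in> gen V (geq f ` U)"
  shows "p \<in> gker V U f c \<psi> \<longleftrightarrow> ev c \<psi> q = 0"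
proof -
  let ?K = "gker V U f c \<psi>"
  have K: "prime_idl V ?K" by (rule prime_gker)
  have "gprod U f ^ n * p - q \<in> ?K"
    using assms(3) gen_least[OF prime_idlD(1)[OF K] gker_geq] by auto
  hence "gprod U f ^ n * p \<in> ?K \<longleftrightarrow> q \<in> ?K" by (rule idl_cancel[OF prime_idlD(1)[OF K]])
  moreover have "gprod U f ^ n * p \<in> ?K \<longleftrightarrow> p \<in> ?K"
    using gprod_power_cancel[OF g prime_idlD(1)[OF K] gker_geq assms(1)] idlD(4)[OF prime_idlD(1)[OF K]]
      gdataD(7)[OF g] by blast
  ultimately show ?thesis using gker_poly_iff[OF assms(2)] by simp
qed

end

lemma ev_Const_Var [simp]: "ev Const Var p = p"
  by (simp add: Const_cst Var_vr ev_cst_vr)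

text \<open>Under the tautological evaluation a kernel element has reduced form 0; hence a power of
  a unit times the element lies in the ideal of the equations, and so does the element.\<close>

lemma gen_graph_gker:
  assumes "gdata V U f" "\<And>w. w \<in> U \<Longrightarrow> f w \<noteq> 0"
  shows "gen V (geq f ` U) = gker V U f Const Var"
proof
  have nz: "ev Const Var (f w) \<noteq> 0" if "w \<in> U" for w using assms(2) that by simp
  note K = prime_gker[OF assms(1) hom_Const nz] gker_geq[OF assms(1) hom_Const nz]
  show "gen V (geq f ` U) \<subseteq> gker V U f Const Var"
    using K by (intro gen_least) (auto dest: prime_idlD)
  show "gker V U f Const Var \<subseteq> gen V (geq f ` U)"
  proof
    fix p assume p: "p \<in> gker V U f Const Var"
    hence pV: "p \<in> PV V" by (simp add: gker_def)
    obtain n q where q: "q \<in> PV (V - U)" "gprod U f ^ n * p - q \<in> gen V (geq f ` U)"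
      by (rule graph_reduce[OF assms(1) pV])
    have "q = 0" using gker_iff[OF assms(1) hom_Const nz pV q] p by simp
    thus "p \<in> gen V (geq f ` U)"
      using q gdataD[OF assms(1)] by (intro gprod_power_cancel[OF assms(1) idl_gen gen_incl pV]) auto
  qed
qed

lemma
  assumes "gdata V U f" "\<And>w. w \<in> U \<Longrightarrow> f w \<noteq> 0"
  shows prime_graph: "prime_idl V (gen V (geq f ` U))"
    and graph_poly_iff: "p \<in> PV (V - U) \<Longrightarrow> p \<in> gen V (geq f ` U) \<longleftrightarrow> p = 0"
  using prime_gker[OF assms(1) hom_Const] gker_poly_iff[OF assms(1) hom_Const] assms(2)
  by (auto simp: gen_graph_gker[OF assms])

lemma Var_Const_neq [simp]: "Var v \<noteq> Const a"
proof
  assume "Var v = Const a"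
  hence "ev (\<lambda>x. x) (\<lambda>_. a + 1) (Var v) = ev (\<lambda>x. x) (\<lambda>_. a + 1) (Const a)" by simp
  thus False by (simp add: hom_on_id)
qed

text \<open>The base coordinates are free, and a non-zero polynomial in the free coordinates is not
  in the ideal of a graph; this applies to \<open>t - a\<close> for every \<open>a\<close>.\<close>

lemma graph_points:
  assumes "gdata (cs b n) U f" "\<And>w. w \<in> U \<Longrightarrow> f w \<noteq> 0" "\<And>j. Base j \<notin> U"
  shows "gen (cs b n) (geq f ` U) \<in> points S b n"
proof -
  have "Var (Base j) - Const a \<notin> gen (cs b n) (geq f ` U)" if "j < b" for j a
    using that assms(3) by (subst graph_poly_iff[OF assms(1,2)]) auto
  thus ?thesis using prime_graph[OF assms(1,2)] by (simp add: points_iff)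
qed

section \<open>Cycles\<close>

lemma lk_scale [simp]: "lk (scale c C) P = c * lk C P"
  by (simp add: scale_def Poly_Mapping.map.rep_eq when_def)

lemma scale_simps [simp]:
  "scale 1 C = C" "scale 0 C = 0" "scale c 0 = 0" "scale c (scale d C) = scale (c * d) C"
  by (auto intro!: poly_mapping_eqI simp: lookup_add lookup_minus algebra_simps)

lemma scale_distrib:
  "scale c (C + D) = scale c C + scale c D" "scale c (C - D) = scale c C - scale c D"
  "scale c (- C) = scale (- c) C" "scale (c + d) C = scale c C + scale d C"
  by (auto intro!: poly_mapping_eqI simp: lookup_add lookup_minus algebra_simps)

lemma scale_minus1: "scale (- 1) C = - C"
  by (auto intro!: poly_mapping_eqI)

lemma scale_sum: "scale c (sum f A) = (\<Sum>x\<in>A. scale c (f x))"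
  by (induction A rule: infinite_finite_induct) (auto simp: scale_distrib)

lemma sum_scale: "(\<Sum>x\<in>A. scale (f x) C) = scale (sum f A) C"
  by (induction A rule: infinite_finite_induct) (auto simp: scale_distrib)

lemma scale_single [simp]: "scale c (Poly_Mapping.single P d) = Poly_Mapping.single P (c * d)"
  by (auto intro!: poly_mapping_eqI simp: lookup_single when_def)

lemma lin_ext_superset:
  "finite A \<Longrightarrow> ks C \<subseteq> A \<Longrightarrow> lin_ext f C = (\<Sum>P\<in>A. scale (lk C P) (f P))"
  unfolding lin_ext_def by (intro sum.mono_neutral_left) (auto simp: in_keys_iff)

lemma lin_ext_add: "lin_ext f (C + D) = lin_ext f C + lin_ext f D"
proof -
  let ?A = "ks C \<union> ks D"
  have "lin_ext f (C + D) = (\<Sum>P\<in>?A. scale (lk (C + D) P) (f P))"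
    using Poly_Mapping.keys_add[of C D] by (intro lin_ext_superset) auto
  also have "\<dots> = (\<Sum>P\<in>?A. scale (lk C P) (f P)) + (\<Sum>P\<in>?A. scale (lk D P) (f P))"
    by (simp add: lookup_add scale_distrib sum.distrib)
  finally show ?thesis
    using lin_ext_superset[of ?A C f] lin_ext_superset[of ?A D f] by simp
qed

lemma lin_ext_scale: "lin_ext f (scale c C) = scale c (lin_ext f C)"
proof -
  have "lin_ext f (scale c C) = (\<Sum>P\<in>ks C. scale (lk (scale c C) P) (f P))"
    by (intro lin_ext_superset) (auto simp: in_keys_iff)
  thus ?thesis by (simp add: lin_ext_def scale_sum)
qed

lemma lin_ext_0 [simp]: "lin_ext f 0 = 0"
  by (simp add: lin_ext_def)

lemma lin_ext_diff: "lin_ext f (C - D) = lin_ext f C - lin_ext f D"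
  using lin_ext_add[of f C "scale (- 1) D"] unfolding lin_ext_scale unfolding scale_minus1 by simp

lemma lin_ext_sum: "lin_ext f (sum g A) = (\<Sum>x\<in>A. lin_ext f (g x))"
  by (induction A rule: infinite_finite_induct) (auto simp: lin_ext_add)

lemma lin_ext_single [simp]: "lin_ext f (Poly_Mapping.single P c) = scale c (f P)"
  by (cases "c = 0") (auto simp: lin_ext_def)

text \<open>\<open>Q A\<^sub>Q\<close> is the maximal ideal of \<open>A\<^sub>Q\<close>, so the only ideals in the chains are \<open>Q A\<^sub>Q\<close> and \<open>A\<^sub>Q\<close>.\<close>

lemma int_mult_self:
  assumes Q: "prime_idl (cs b n) Q"
  shows "int_mult b n Q Q = 1"
proof -
  define V where "V = cs b n"
  define L where "L = localize b n Q (PV V)"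
  define M where "M = localize b n Q Q"
  have Q': "prime_idl V Q" using Q by (simp add: V_def)
  note QD = prime_idlD[OF Q'] idlD[OF prime_idlD(1)[OF Q']]
  have LE: "localize b n Q I = {Fract a s | a s. a \<in> I \<and> s \<in> PV V \<and> s \<notin> Q}" for I
    by (simp add: localize_def coord_ring_Rg V_def)
  have LI: "Fract a s \<in> L" if "a \<in> PV V" "s \<in> PV V" "s \<notin> Q" for a s
    using that by (auto simp: L_def LE)
  have MI: "Fract a s \<in> M" if "a \<in> Q" "s \<in> PV V" "s \<notin> Q" for a s
    using that by (auto simp: M_def LE)
  have nz: "s \<noteq> 0" if "s \<notin> Q" for s using that QD by auto
  have sm: "s * s' \<notin> Q" if "s \<in> PV V" "s' \<in> PV V" "s \<notin> Q" "s' \<notin> Q" for s s'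
    using that QD(3)[of s s'] by blast
  have LC: "x \<in> L \<Longrightarrow> \<exists>a s. x = Fract a s \<and> a \<in> PV V \<and> s \<in> PV V \<and> s \<notin> Q" for x
    by (auto simp: L_def LE)
  have MC: "x \<in> M \<Longrightarrow> \<exists>a s. x = Fract a s \<and> a \<in> Q \<and> s \<in> PV V \<and> s \<notin> Q" for x
    by (auto simp: M_def LE)
  have L01: "0 \<in> L" "1 \<in> L" using LI[of 0 1] LI[of 1 1] QD(2) by (auto simp: Zero_fract_def One_fract_def)
  have Lneg: "- x \<in> L" if x: "x \<in> L" for x
  proof -
    obtain a s where "x = Fract a s" "a \<in> PV V" "s \<in> PV V" "s \<notin> Q" using LC[OF x] by blast
    thus ?thesis using LI[of "- a" s] by simp
  qed
  have Lop: "x + y \<in> L \<and> x * y \<in> L" if x: "x \<in> L" and y: "y \<in> L" for x y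
  proof -
    obtain a s where 1: "x = Fract a s" "a \<in> PV V" "s \<in> PV V" "s \<notin> Q" using LC[OF x] by blast
    obtain a' s' where 2: "y = Fract a' s'" "a' \<in> PV V" "s' \<in> PV V" "s' \<notin> Q" using LC[OF y] by blast
    show ?thesis
      using 1 2 sm[of s s'] nz[of s] nz[of s'] LI[of "a * s' + a' * s" "s * s'"] LI[of "a * a'" "s * s'"] by simp
  qed
  have sL: "subr L" using L01 Lneg Lop by (simp add: subr_def)
  have idiff: "ideal J (local_ring b n Q) \<longleftrightarrow> idlc L J" for J
    using ideal_subr_iff[OF sL, of J] by (simp add: local_ring_def TR_def L_def coord_ring_Rg V_def)
  have MsubL: "M \<subseteq> L" using QD(4) by (auto simp: M_def L_def LE)
  have "M \<noteq> L"
  proof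
    assume "M = L"
    then obtain a s where "1 = Fract a s" "a \<in> Q" "s \<in> PV V" "s \<notin> Q" using MC[of 1] L01 by auto
    thus False using nz[of s] by (auto simp: One_fract_def eq_fract)
  qed
  have "idlc L L" using sL by (auto simp: idlc_def subr_def)
  have M: "idlc L M"
    unfolding idlc_def
  proof (intro conjI ballI)
    show "0 \<in> M" using MI[of 0 1] QD by (auto simp: Zero_fract_def)
    fix x y assume x: "x \<in> M"
    obtain a s where 1: "x = Fract a s" "a \<in> Q" "s \<in> PV V" "s \<notin> Q" using MC[OF x] by blast
    {
      assume y: "y \<in> M"
      obtain a' s' where 2: "y = Fract a' s'" "a' \<in> Q" "s' \<in> PV V" "s' \<notin> Q" using MC[OF y] by blast
      have "a * s' + a' * s \<in> Q" using 1 2 by (intro QD(6) QD(8))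
      thus "x + y \<in> M"
        using 1 2 sm[of s s'] nz[of s] nz[of s'] MI[of "a * s' + a' * s" "s * s'"] by simp
    }
  next
    fix x y assume x: "x \<in> L" and y: "y \<in> M"
    obtain a s where 1: "x = Fract a s" "a \<in> PV V" "s \<in> PV V" "s \<notin> Q" using LC[OF x] by blast
    obtain a' s' where 2: "y = Fract a' s'" "a' \<in> Q" "s' \<in> PV V" "s' \<notin> Q" using MC[OF y] by blast
    have "a * a' \<in> Q" using 1 2 by (intro QD(7))
    thus "x * y \<in> M" using 1 2 sm[of s s'] MI[of "a * a'" "s * s'"] by simp
  qed (rule MsubL)
  \<comment> \<open>An element of the local ring outside \<open>M\<close> has its numerator outside
    \<open>Q\<close>, hence is a unit.\<close>
  have big: "J = L" if J: "idlc L J" "M \<subset> J" for J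
  proof -
    obtain x where x: "x \<in> J" "x \<notin> M" using J by blast
    hence "x \<in> L" using J by (auto simp: idlc_def)
    then obtain a s where 1: "x = Fract a s" "a \<in> PV V" "s \<in> PV V" "s \<notin> Q" using LC by blast
    with x MI[of a s] have a: "a \<notin> Q" by blast
    hence "Fract s a \<in> L" using LI 1 by blast
    hence "Fract s a * x \<in> J" using J x by (auto simp: idlc_def)
    moreover have "Fract s a * x = 1" using 1 nz[OF a] nz[of s] by (simp add: One_fract_def eq_fract mult.commute)
    ultimately have "1 \<in> J" by simp
    hence "y \<in> J" if "y \<in> L" for y using J that mult_1_right[of y] unfolding idlc_def by metis
    thus ?thesis using J by (auto simp: idlc_def)
  qed
  define T where "T = {l. \<exists>J. (\<forall>i\<le>l. idlc L (J i) \<and> M \<subseteq> J i) \<and> (\<forall>i<l. J i \<subset> J (Suc i))}"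
  \<comment> \<open>In a chain of length 2 the ideal \<open>J 1\<close> would lie strictly above
    \<open>M\<close>, hence be all of \<open>L\<close>, leaving no room for
    \<open>J 2\<close>.\<close>
  have up: "enat l \<le> enat 1" if lT: "l \<in> T" for l
  proof (rule ccontr)
    assume "\<not> enat l \<le> enat 1"
    hence l: "2 \<le> l" by simp
    obtain J where J: "\<forall>i\<le>l. idlc L (J i) \<and> M \<subseteq> J i" "\<forall>i<l. J i \<subset> J (Suc i)"
      using lT unfolding T_def mem_Collect_eq by (elim exE conjE)
    have "J 0 \<subset> J 1" "J 1 \<subset> J 2" using spec[OF J(2), of 0] spec[OF J(2), of 1] l by (auto simp: numeral_2_eq_2)
    moreover have "idlc L (J 1)" "idlc L (J 2)" "M \<subseteq> J 0" using J(1) l by auto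
    ultimately show False using big[of "J 1"] by (auto simp: idlc_def)
  qed
  have "\<exists>J. (\<forall>i\<le>1. idlc L (J i) \<and> M \<subseteq> J i) \<and> (\<forall>i<1::nat. J i \<subset> J (Suc i))"
    using M \<open>idlc L L\<close> MsubL \<open>M \<noteq> L\<close> by (intro exI[of _ "\<lambda>i. if i = 0 then M else L"]) auto
  hence "1 \<in> T" unfolding T_def by blast
  have "Sup (enat ` T) = enat 1"
  proof (rule antisym)
    show "Sup (enat ` T) \<le> enat 1" by (rule SUP_least) (rule up)
    show "enat 1 \<le> Sup (enat ` T)" by (rule SUP_upper) fact
  qed
  thus ?thesis by (simp add: int_mult_def T_def idiff M_def[symmetric] one_enat_def)
qed

lemma components_self: "Q \<in> W \<Longrightarrow> (\<And>Q'. Q' \<in> W \<Longrightarrow> Q \<subseteq> Q') \<Longrightarrow> components W = {Q}"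
  unfolding components_def by blast

lemma fund_cycle_point:
  assumes "Q \<in> points S b n"
  shows "fund_cycle S b n Q = Poly_Mapping.single Q 1"
proof -
  have "components {Q'\<in>points S b n. Q \<subseteq> Q'} = {Q}"
    using assms by (intro components_self) auto
  moreover have "int_mult b n Q Q = 1"
    using assms by (intro int_mult_self) (simp add: points_iff)
  ultimately show ?thesis by (simp add: fund_cycle_def one_enat_def)
qed

lemma fund_cycle_unit:
  assumes "1 \<in> I"
  shows "fund_cycle S b n I = 0"
proof -
  have "{Q\<in>points S b n. I \<subseteq> Q} = {}"
    using assms by (auto simp: points_iff dest: prime_idlD)
  hence "components {Q\<in>points S b n. I \<subseteq> Q} = {}" unfolding components_def by blast
  thus ?thesis by (simp add: fund_cycle_def)
qed

definition cyc :: "rat set \<Rightarrow> nat \<Rightarrow> nat \<Rightarrow> mpoly set \<Rightarrow> cycle" where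
  "cyc S b n F = fund_cycle S b n (gen (cs b n) F)"

text \<open>The unit ideal is allowed since faces may miss a graph.\<close>

definition integral :: "rat set \<Rightarrow> nat \<Rightarrow> nat \<Rightarrow> mpoly set \<Rightarrow> bool" where
  "integral S b n F \<longleftrightarrow> F \<subseteq> PV (cs b n) \<and> (gen (cs b n) F \<in> points S b n \<or> 1 \<in> gen (cs b n) F)"

lemma integralD: "integral S b n F \<Longrightarrow> F \<subseteq> PV (cs b n)"
  by (simp add: integral_def)

lemma integral_cases [consumes 1, case_names point unit]:
  assumes "integral S b n F"
  obtains "F \<subseteq> PV (cs b n)" "gen (cs b n) F \<in> points S b n" "cyc S b n F = Poly_Mapping.single (gen (cs b n) F) 1"
    | "F \<subseteq> PV (cs b n)" "1 \<in> gen (cs b n) F" "cyc S b n F = 0"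
  using assms fund_cycle_point fund_cycle_unit by (auto simp: integral_def cyc_def)

lemma cyc_keys: "integral S b n F \<Longrightarrow> ks (cyc S b n F) \<subseteq> points S b n"
  by (cases rule: integral_cases) auto

lemma pullback_add: "pullback S b n \<sigma> (C + D) = pullback S b n \<sigma> C + pullback S b n \<sigma> D"
  and pullback_diff: "pullback S b n \<sigma> (C - D) = pullback S b n \<sigma> C - pullback S b n \<sigma> D"
  and pullback_scale: "pullback S b n \<sigma> (scale c C) = scale c (pullback S b n \<sigma> C)"
  and pullback_sum: "pullback S b n \<sigma> (sum g A) = (\<Sum>x\<in>A. pullback S b n \<sigma> (g x))"
  and pullback_0: "pullback S b n \<sigma> 0 = 0"
  by (simp_all add: pullback_def lin_ext_add lin_ext_diff lin_ext_scale lin_ext_sum)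

lemmas pullback_lin = pullback_add pullback_diff pullback_scale pullback_sum pullback_0

lemma pullback_single:
  "pullback S b n \<sigma> (Poly_Mapping.single P c) = scale c (cyc S b n (subst \<sigma> ` P))"
  by (simp add: pullback_def cyc_def coord_ring_Rg genideal_gen)

lemma cyc_subst_gen:
  "maps (cs b n) (cs b' n') \<sigma> \<Longrightarrow> F \<subseteq> PV (cs b n) \<Longrightarrow>
    cyc S b' n' (subst \<sigma> ` gen (cs b n) F) = cyc S b' n' (subst \<sigma> ` F)"
  by (simp add: cyc_def gen_subst_gen)

lemma gen_unit_subst:
  assumes "maps V W \<sigma>" "F \<subseteq> PV V" "1 \<in> gen V F"
  shows "1 \<in> gen W (subst \<sigma> ` F)"
proof -
  have "subst \<sigma> ` F \<subseteq> PV W" using maps_PV[OF assms(1)] assms(2) by auto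
  hence "subst \<sigma> ` gen V F \<subseteq> gen W (subst \<sigma> ` F)"
    using subst_gen_subset_iff[OF assms(1) idl_gen assms(2)] gen_incl[of "subst \<sigma> ` F" W] by simp
  moreover have "subst \<sigma> 1 \<in> subst \<sigma> ` gen V F" using assms(3) by (rule imageI)
  ultimately show ?thesis by auto
qed

text \<open>A prime ideal contributes one key with coefficient 1, whose pull-back is computed on its
  generators; a unit ideal stays a unit ideal, and both sides are 0.\<close>

lemma pullback_cyc:
  assumes "integral S b n F" "maps (cs b n) (cs b' n') \<sigma>"
  shows "pullback S' b' n' \<sigma> (cyc S b n F) = cyc S' b' n' (subst \<sigma> ` F)"
  using assms(1)
proof (cases rule: integral_cases)
  case point
  thus ?thesis using cyc_subst_gen[OF assms(2)] by (simp add: pullback_single)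
next
  case unit
  hence "1 \<in> gen (cs b' n') (subst \<sigma> ` F)" by (intro gen_unit_subst[OF assms(2)])
  thus ?thesis using unit by (simp add: pullback_lin cyc_def fund_cycle_unit)
qed

definition lin :: "(cycle \<Rightarrow> cycle) \<Rightarrow> bool" where
  "lin f \<longleftrightarrow> (\<forall>C D. f (C + D) = f C + f D) \<and> (\<forall>c C. f (scale c C) = scale c (f C))"

lemma lin_sum: assumes "lin f" shows "f (\<Sum>x\<in>A. g x) = (\<Sum>x\<in>A. f (g x))"
proof -
  have "f 0 = 0" using assms scale_simps(2) unfolding lin_def by metis
  thus ?thesis using assms by (induction A rule: infinite_finite_induct) (auto simp: lin_def)
qed

text \<open>The keys of a \<open>cycle\<close> are arbitrary sets of polynomials, while
  functoriality of pull-backs is controlled on points; \<open>T\<close> confines the comparison to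
  those.\<close>

lemma lin_eqI:
  assumes "lin f" "lin g" "ks C \<subseteq> T" "\<And>P. P \<in> T \<Longrightarrow> f (Poly_Mapping.single P 1) = g (Poly_Mapping.single P 1)"
  shows "f C = g C"
proof -
  have *: "h C = (\<Sum>P\<in>ks C. scale (lk C P) (h (Poly_Mapping.single P 1)))" if "lin h" for h
  proof -
    have "h C = h (\<Sum>P\<in>ks C. scale (lk C P) (Poly_Mapping.single P 1))"
      by (simp add: poly_mapping_sum_single)
    also have "\<dots> = (\<Sum>P\<in>ks C. h (scale (lk C P) (Poly_Mapping.single P 1)))" by (rule lin_sum[OF that])
    finally show ?thesis using that by (simp add: lin_def del: scale_single)
  qed
  have "(\<Sum>P\<in>ks C. scale (lk C P) (f (Poly_Mapping.single P 1))) = (\<Sum>P\<in>ks C. scale (lk C P) (g (Poly_Mapping.single P 1)))"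
    using assms(3,4) by (intro sum.cong) auto
  thus ?thesis using *[OF assms(1)] *[OF assms(2)] by simp
qed

lemma lin_pullback: "lin (pullback S b n \<sigma>)"
  by (simp add: lin_def pullback_lin)

lemma lin_comp: "lin f \<Longrightarrow> lin g \<Longrightarrow> lin (\<lambda>C. f (g C))"
  by (simp add: lin_def)

section \<open>The group of signed permutations\<close>

type_synonym sperm = "nat set \<times> (nat \<Rightarrow> nat)"

definition sperms :: "nat \<Rightarrow> sperm set" where
  "sperms n = Pow {1..n} \<times> {\<pi>. \<pi> permutes {1..n}}"

definition sg :: "sperm \<Rightarrow> rat" where
  "sg g = (- 1) ^ card (fst g) * of_int (sign (snd g))"

definition gs :: "sperm \<Rightarrow> coord \<Rightarrow> mpoly" where
  "gs g = G_subst (fst g) (snd g)"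

definition act :: "rat set \<Rightarrow> nat \<Rightarrow> sperm \<Rightarrow> cycle \<Rightarrow> cycle" where
  "act S n g C = pullback S 1 n (gs g) C"

definition flp :: "bool \<Rightarrow> mpoly \<Rightarrow> mpoly" where
  "flp b p = (if b then 1 - p else p)"

lemma gs_Base [simp]: "gs g (Base j) = Var (Base j)"
  and gs_Cube: "gs g (Cube i) = flp (i \<in> fst g) (Var (Cube (snd g i)))"
  by (simp_all add: gs_def G_subst_def flp_def)

lemma subst_flp [simp]: "subst \<sigma> (flp b p) = flp b (subst \<sigma> p)"
  and flp_flp [simp]: "flp b (flp c p) = flp (b \<noteq> c) p"
  and flp_False [simp]: "flp False p = p"
  and flp_PV [simp]: "p \<in> PV V \<Longrightarrow> flp b p \<in> PV V"
  by (auto simp: flp_def)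

lemma spermsD: assumes "g \<in> sperms n"
  shows "fst g \<subseteq> {1..n}" "snd g permutes {1..n}" "finite (fst g)" "permutation (snd g)"
    "i \<notin> {1..n} \<Longrightarrow> snd g i = i" "snd g i \<in> {1..n} \<longleftrightarrow> i \<in> {1..n}"
proof -
  show 1: "fst g \<subseteq> {1..n}" "snd g permutes {1..n}" using assms by (auto simp: sperms_def)
  show "finite (fst g)" using 1 finite_subset by blast
  show "permutation (snd g)" using 1 permutes_imp_permutation by blast
  show "i \<notin> {1..n} \<Longrightarrow> snd g i = i" by (rule permutes_not_in[OF 1(2)])
  show "snd g i \<in> {1..n} \<longleftrightarrow> i \<in> {1..n}" by (rule permutes_in_image[OF 1(2)])
qed

lemma spermsI: "E \<subseteq> {1..n} \<Longrightarrow> \<pi> permutes {1..n} \<Longrightarrow> (E, \<pi>) \<in> sperms n"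
  by (simp add: sperms_def)

lemma sperms_mono: "g \<in> sperms n \<Longrightarrow> n \<le> m \<Longrightarrow> g \<in> sperms m"
  using permutes_subset[of "snd g" "{1..n}" "{1..m}"] spermsD(1,2)[of g n] spermsI[of "fst g" m "snd g"]
    subset_trans[of "fst g" "{1..n}" "{1..m}"]
  by simp

lemma finite_sperms [simp]: "finite (sperms n)"
  unfolding sperms_def by (intro finite_cartesian_product finite_permutations finite_Pow_iff[THEN iffD2]) simp_all

lemma card_sperms: "card (sperms n) = 2 ^ n * fact n"
proof -
  have "card {\<pi>. \<pi> permutes {1..n}} = fact n" by (rule card_permutations) auto
  thus ?thesis by (simp add: sperms_def card_cartesian_product card_Pow)
qed

text \<open>The product for which \<open>gs\<close> becomes multiplicative under substitution, see
  \<open>gs_smul\<close>: the inversions of \<open>g\<close> are transported back along the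
  permutation of \<open>h\<close>.\<close>

definition smul :: "sperm \<Rightarrow> sperm \<Rightarrow> sperm" where
  "smul g h = ({i. (i \<in> fst h) \<noteq> (snd h i \<in> fst g)}, snd g \<circ> snd h)"

definition sinv :: "sperm \<Rightarrow> sperm" where
  "sinv g = (snd g ` fst g, inv_into UNIV (snd g))"

lemma gs_smul: "subst (gs g) (gs h v) = gs (smul g h) v"
  by (cases v) (auto simp: gs_Cube smul_def)

lemma smul_in: assumes "g \<in> sperms n" "h \<in> sperms n" shows "smul g h \<in> sperms n"
  unfolding smul_def
proof (rule spermsI)
  show "snd g \<circ> snd h permutes {1..n}" using assms spermsD(2) permutes_compose by blast
  show "{i. (i \<in> fst h) \<noteq> (snd h i \<in> fst g)} \<subseteq> {1..n}"
    using spermsD(1)[OF assms(1)] spermsD(1)[OF assms(2)] spermsD(6)[OF assms(2)] by blast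
qed

lemma smul_assoc: "smul (smul f g) h = smul f (smul g h)"
  by (auto simp: smul_def o_assoc)

lemma smul_id [simp]: "smul g ({}, id) = g" "smul ({}, id) g = g"
  by (cases g; simp add: smul_def)+

lemma sinv_in: assumes "g \<in> sperms n" shows "sinv g \<in> sperms n"
  unfolding sinv_def
proof (rule spermsI)
  show "inv_into UNIV (snd g) permutes {1..n}" using spermsD(2)[OF assms] by (rule permutes_inv)
  show "snd g ` fst g \<subseteq> {1..n}" using spermsD(1,6)[OF assms] by blast
qed

lemma smul_sinv: assumes "g \<in> sperms n" shows "smul g (sinv g) = ({}, id)" "smul (sinv g) g = ({}, id)"
proof -
  note p = spermsD(2)[OF assms]
  have "snd g (inv_into UNIV (snd g) i) = i" "inv_into UNIV (snd g) (snd g i) = i" for i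
    using permutes_inverses[OF p] by auto
  hence "i \<in> snd g ` fst g \<longleftrightarrow> inv_into UNIV (snd g) i \<in> fst g" "snd g i \<in> snd g ` fst g \<longleftrightarrow> i \<in> fst g" for i
    by (metis imageE imageI)+
  thus "smul g (sinv g) = ({}, id)" "smul (sinv g) g = ({}, id)"
    using permutes_inv_o[OF p] by (auto simp: smul_def sinv_def)
qed

lemma sg_smul: assumes "g \<in> sperms n" "h \<in> sperms n" shows "sg (smul g h) = sg g * sg h"
proof -
  \<comment> \<open>The sign of the inversions is written as a product over all coordinates, so that
    a permutation acts by reindexing and a symmetric difference becomes a product of
    factors.\<close>
  let ?s = "\<lambda>E i. if i \<in> E then - 1 else 1 :: rat"
  have c: "(\<Prod>i\<in>{1..n}. ?s E i) = (- 1) ^ card E" if "E \<subseteq> {1..n}" for E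
  proof -
    have "{1..n} \<inter> E = E" using that by blast
    thus ?thesis by (simp add: prod.If_cases Int_commute)
  qed
  have "(- 1) ^ card (fst (smul g h)) = (\<Prod>i\<in>{1..n}. ?s (fst (smul g h)) i)"
    using spermsD(1)[OF smul_in[OF assms]] by (rule c[symmetric])
  also have "\<dots> = (\<Prod>i\<in>{1..n}. ?s (fst h) i * ?s (fst g) (snd h i))"
    by (intro prod.cong) (auto simp: smul_def)
  also have "\<dots> = (\<Prod>i\<in>{1..n}. ?s (fst h) i) * (\<Prod>i\<in>{1..n}. ?s (fst g) (snd h i))"
    by (rule prod.distrib)
  also have "(\<Prod>i\<in>{1..n}. ?s (fst g) (snd h i)) = (\<Prod>i\<in>{1..n}. ?s (fst g) i)"
    using prod.permute[OF spermsD(2)[OF assms(2)], of "?s (fst g)"] by (simp add: o_def)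
  finally have "(- 1) ^ card (fst (smul g h)) = ((- 1) ^ card (fst h) * (- 1) ^ card (fst g) :: rat)"
    using c[OF spermsD(1)[OF assms(1)]] c[OF spermsD(1)[OF assms(2)]] by simp
  moreover have "sign (snd (smul g h)) = sign (snd g) * sign (snd h)"
    using sign_compose[OF spermsD(4)[OF assms(1)] spermsD(4)[OF assms(2)]] by (simp add: smul_def)
  ultimately show ?thesis by (simp add: sg_def)
qed

lemma sg_sq [simp]: "sg g * sg g = 1"
proof -
  have "(of_int (sign (snd g)) :: rat) * of_int (sign (snd g)) = 1"
    by (simp flip: of_int_mult)
  thus ?thesis by (simp add: sg_def algebra_simps flip: power_add)
qed

lemma sg_sq' [simp]: "sg g * (sg g * x) = x"
  by (simp flip: mult.assoc)

lemma maps_gs: assumes "g \<in> sperms n" shows "maps (cs b n) (cs b n) (gs g)"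
  unfolding maps_def
proof
  fix v assume "v \<in> cs b n"
  thus "gs g v \<in> PV (cs b n)" using spermsD(6)[OF assms] by (cases v) (auto simp: gs_Cube)
qed

lemma gs_id: "gs ({}, id) = Var"
proof
  show "gs ({}, id) v = Var v" for v by (cases v) (auto simp: gs_Cube)
qed

lemma gs_inverse: assumes "g \<in> sperms n"
  shows "subst (gs g) (gs (sinv g) v) = Var v" "subst (gs (sinv g)) (gs g v) = Var v"
  using smul_sinv[OF assms] by (auto simp: gs_smul gs_id)

lemmas gs_aut = aut_ideal[OF maps_gs maps_gs[OF sinv_in] gs_inverse(1) gs_inverse(2)]

lemma points_gs:
  assumes g: "g \<in> sperms n" and P: "P \<in> points S b n"
  shows "subst (gs g) ` P \<in> points S b n"
proof -
  have p: "prime_idl (cs b n) P" using P by (simp add: points_iff)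
  have "P \<subseteq> PV (cs b n)" using idlD(1)[OF prime_idlD(1)[OF p]] by blast
  hence "subst (gs g) ` P = {p\<in>PV (cs b n). subst (gs (sinv g)) p \<in> P}"
    by (rule gs_aut(2)[OF g g g g])
  thus ?thesis using gs_aut(4)[OF g g g g p] P by (auto simp: points_iff)
qed

lemma gen_gs:
  assumes g: "g \<in> sperms n" and F: "F \<subseteq> PV (cs b n)"
  shows "gen (cs b n) (subst (gs g) ` F) = subst (gs g) ` gen (cs b n) F"
  using gen_subst_gen[OF maps_gs[OF g] F] gen_idl[OF gs_aut(3)[OF g g g g idl_gen[OF F]]] by simp

lemma integral_gs: assumes g: "g \<in> sperms n" and F: "integral S b n F"
  shows "integral S b n (subst (gs g) ` F)"
proof -
  have "F \<subseteq> PV (cs b n)" using F by (rule integralD)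
  moreover have "subst (gs g) 1 \<in> subst (gs g) ` I" if "1 \<in> I" for I using that by (rule imageI)
  ultimately show ?thesis
    using F points_gs[OF g, of "gen (cs b n) F" S b] maps_PV[OF maps_gs[OF g, of b]]
    by (auto simp: integral_def gen_gs[OF g])
qed

lemma act_cyc: "g \<in> sperms n \<Longrightarrow> integral S 1 n F \<Longrightarrow> act S n g (cyc S 1 n F) = cyc S 1 n (subst (gs g) ` F)"
  unfolding act_def by (rule pullback_cyc[OF _ maps_gs])

lemma act_single:
  assumes "g \<in> sperms n" "P \<in> points S 1 n"
  shows "act S n g (Poly_Mapping.single P 1) = Poly_Mapping.single (subst (gs g) ` P) 1"
proof -
  have "idl (cs 1 n) (subst (gs g) ` P)"
    using points_gs[OF assms] by (auto simp: points_iff dest: prime_idlD)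
  thus ?thesis using fund_cycle_point[OF points_gs[OF assms]]
    by (simp add: act_def pullback_single cyc_def gen_idl)
qed

lemma lin_act: "lin (act S n g)"
  unfolding act_def by (rule lin_pullback)

lemma act_lin: "act S n g (scale c C) = scale c (act S n g C)" "act S n g (C + D) = act S n g C + act S n g D"
  "act S n g (sum f A) = (\<Sum>x\<in>A. act S n g (f x))"
  by (simp_all add: act_def pullback_lin)

text \<open>Functoriality of pull-back, which holds here because a signed permutation carries a
  point to a single point with coefficient 1.\<close>

lemma pullback_act:
  assumes "g \<in> sperms n" "ks C \<subseteq> points S 1 n"
  shows "pullback S' b' n' \<tau> (act S n g C) = pullback S' b' n' (\<lambda>v. subst \<tau> (gs g v)) C"
  by (rule lin_eqI[OF lin_comp[OF lin_pullback lin_act] lin_pullback assms(2)])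
     (use assms in \<open>simp add: act_single pullback_single subst_image_subst\<close>)

lemma act_act:
  assumes "h \<in> sperms n" "ks C \<subseteq> points S 1 n"
  shows "act S n g (act S n h C) = act S n (smul g h) C"
  using pullback_act[OF assms, of S 1 n "gs g"] by (simp add: act_def gs_smul)

lemma Alt_sperms:
  "Alt S n C = scale (1 / (2 ^ n * fact n)) (\<Sum>g\<in>sperms n. scale (sg g) (act S n g C))"
  by (simp add: Alt_def sperms_def sum.cartesian_product sg_def act_def gs_def case_prod_beta)

lemma lin_Alt: "lin (Alt S n)"
  by (auto simp: lin_def Alt_sperms act_lin scale_distrib sum.distrib scale_sum ac_simps)

lemma Alt_lin: "Alt S n (C + D) = Alt S n C + Alt S n D" "Alt S n (scale c C) = scale c (Alt S n C)"
  "Alt S n (C - D) = Alt S n C - Alt S n D" "Alt S n 0 = 0" "Alt S n (sum f A) = (\<Sum>x\<in>A. Alt S n (f x))"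
proof -
  show 1: "Alt S n (C + D) = Alt S n C + Alt S n D" "Alt S n (scale c C) = scale c (Alt S n C)" for C D c
    using lin_Alt by (auto simp: lin_def)
  show 2: "Alt S n 0 = 0" using 1(2)[of 0 0] by simp
  have "Alt S n (C + scale (- 1) D) = Alt S n C + scale (- 1) (Alt S n D)" unfolding 1 ..
  thus "Alt S n (C - D) = Alt S n C - Alt S n D" unfolding scale_minus1 by simp
  show "Alt S n (sum f A) = (\<Sum>x\<in>A. Alt S n (f x))" by (rule lin_sum[OF lin_Alt])
qed

text \<open>Right translation by \<open>h\<close> permutes the group and changes every sign by
  \<open>sg h\<close>; the companion \<open>act_Alt\<close> uses left translation.\<close>

lemma Alt_act:
  assumes h: "h \<in> sperms n" and C: "ks C \<subseteq> points S 1 n"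
  shows "Alt S n (act S n h C) = scale (sg h) (Alt S n C)"
proof -
  have "(\<Sum>g\<in>sperms n. scale (sg g) (act S n g (act S n h C)))
      = (\<Sum>g\<in>sperms n. scale (sg h * sg (smul g h)) (act S n (smul g h) C))"
    using sg_smul[OF _ h] by (intro sum.cong) (simp_all add: act_act[OF h C] ac_simps)
  also have "\<dots> = (\<Sum>g\<in>sperms n. scale (sg h * sg g) (act S n g C))"
    by (rule sum.reindex_bij_witness[where i = "\<lambda>g. smul g (sinv h)" and j = "\<lambda>g. smul g h"])
       (simp_all add: smul_assoc smul_sinv[OF h] smul_in h sinv_in)
  also have "\<dots> = scale (sg h) (\<Sum>g\<in>sperms n. scale (sg g) (act S n g C))"
    by (simp add: scale_sum)
  finally show ?thesis by (simp add: Alt_sperms)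
qed

lemma act_Alt:
  assumes h: "h \<in> sperms n" and C: "ks C \<subseteq> points S 1 n"
  shows "act S n h (Alt S n C) = scale (sg h) (Alt S n C)"
proof -
  have "(\<Sum>g\<in>sperms n. scale (sg g) (act S n h (act S n g C)))
      = (\<Sum>g\<in>sperms n. scale (sg h * sg (smul h g)) (act S n (smul h g) C))"
    using sg_smul[OF h] by (intro sum.cong) (simp_all add: act_act[OF _ C])
  also have "\<dots> = (\<Sum>g\<in>sperms n. scale (sg h * sg g) (act S n g C))"
    by (rule sum.reindex_bij_witness[where i = "\<lambda>g. smul (sinv h) g" and j = "\<lambda>g. smul h g"])
       (simp_all add: smul_assoc[symmetric] smul_sinv[OF h] smul_in h sinv_in)
  also have "\<dots> = scale (sg h) (\<Sum>g\<in>sperms n. scale (sg g) (act S n g C))"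
    by (simp add: scale_sum)
  finally show ?thesis by (simp only: Alt_sperms act_lin) (simp only: scale_simps mult.commute)
qed

lemma ks_sum_subset: "(\<And>x. x \<in> A \<Longrightarrow> ks (f x) \<subseteq> T) \<Longrightarrow> ks (sum f A) \<subseteq> T"
  using Poly_Mapping.keys_sum[of f A] by blast

lemma ks_scale: "ks (scale c C) \<subseteq> ks C"
  by (auto simp: in_keys_iff)

text \<open>Only an inclusion, since summands may cancel. It suffices for
  \<open>empty_fiber_at\<close>, which quantifies over the keys that remain.\<close>

lemma ks_Alt_cyc:
  assumes "integral S 1 n F"
  shows "ks (Alt S n (cyc S 1 n F)) \<subseteq> {subst (gs g) ` gen (cs 1 n) F | g. g \<in> sperms n}"
  unfolding Alt_sperms
proof (intro subset_trans[OF ks_scale] ks_sum_subset)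
  fix g assume g: "g \<in> sperms n"
  from assms show "ks (act S n g (cyc S 1 n F)) \<subseteq> {subst (gs g) ` gen (cs 1 n) F | g. g \<in> sperms n}"
  proof (cases rule: integral_cases)
    case point
    have "ks (act S n g (cyc S 1 n F)) = {subst (gs g) ` gen (cs 1 n) F}"
      using point g by (simp only: act_single) simp
    thus ?thesis using g by blast
  qed (simp add: act_def pullback_lin)
qed

lemma ks_Alt_points:
  assumes "integral S 1 n F"
  shows "ks (Alt S n (cyc S 1 n F)) \<subseteq> points S 1 n"
  unfolding Alt_sperms
proof (intro subset_trans[OF ks_scale] ks_sum_subset)
  fix g assume g: "g \<in> sperms n"
  from assms show "ks (act S n g (cyc S 1 n F)) \<subseteq> points S 1 n"
  proof (cases rule: integral_cases)
    case point
    thus ?thesis using g points_gs[OF g, of _ S 1] by (auto simp: act_single simp del: One_nat_def)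
  qed (simp add: act_def pullback_lin)
qed

lemma image_intertwine:
  assumes "\<And>v. v \<in> V \<Longrightarrow> subst \<sigma> (\<rho> v) = subst \<rho>' (\<sigma> v)" "F \<subseteq> PV V"
  shows "subst \<sigma> ` subst \<rho> ` F = subst \<rho>' ` subst \<sigma> ` F"
  unfolding subst_image_subst
  by (intro image_cong refl subst_cong) (use assms in \<open>auto simp: PV_def\<close>)

text \<open>An inner \<open>Alt\<close> may be dropped: the morphism intertwines \<open>g\<close>
  with \<open>\<phi> g\<close>, which has the same sign, so every summand of the inner average
  contributes the same as the identity.\<close>

lemma Alt_pullback_Alt:
  assumes "\<And>g. g \<in> sperms n \<Longrightarrow> \<phi> g \<in> sperms n' \<and> sg (\<phi> g) = sg g"
    and "\<And>g v. g \<in> sperms n \<Longrightarrow> v \<in> cs 1 n \<Longrightarrow> subst \<sigma> (gs g v) = subst (gs (\<phi> g)) (\<sigma> v)"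
    and F: "integral S 1 n F" and F': "integral S' 1 n' (subst \<sigma> ` F)" and \<sigma>: "maps (cs 1 n) (cs 1 n') \<sigma>"
  shows "Alt S' n' (pullback S' 1 n' \<sigma> (Alt S n (cyc S 1 n F))) = Alt S' n' (cyc S' 1 n' (subst \<sigma> ` F))"
proof -
  have "Alt S' n' (pullback S' 1 n' \<sigma> (act S n g (cyc S 1 n F))) = scale (sg g) (Alt S' n' (cyc S' 1 n' (subst \<sigma> ` F)))"
    if g: "g \<in> sperms n" for g
  proof -
    have "pullback S' 1 n' \<sigma> (act S n g (cyc S 1 n F)) = cyc S' 1 n' (subst \<sigma> ` subst (gs g) ` F)"
      by (simp only: act_cyc[OF g F] pullback_cyc[OF integral_gs[OF g F] \<sigma>])
    also have "subst \<sigma> ` subst (gs g) ` F = subst (gs (\<phi> g)) ` subst \<sigma> ` F"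
      using assms(2)[OF g] integralD[OF F] by (rule image_intertwine)
    also have "cyc S' 1 n' \<dots> = act S' n' (\<phi> g) (cyc S' 1 n' (subst \<sigma> ` F))"
      using assms(1)[OF g] F' by (simp only: act_cyc)
    finally show ?thesis
      using assms(1)[OF g] Alt_act[OF _ cyc_keys[OF F'], of "\<phi> g"] by simp
  qed
  hence "Alt S' n' (pullback S' 1 n' \<sigma> (Alt S n (cyc S 1 n F)))
      = scale (1 / (2 ^ n * fact n)) (\<Sum>g\<in>sperms n. Alt S' n' (cyc S' 1 n' (subst \<sigma> ` F)))"
    by (simp add: Alt_sperms[of S n] pullback_lin Alt_lin)
  also have "(\<Sum>g\<in>sperms n. Alt S' n' (cyc S' 1 n' (subst \<sigma> ` F))) = scale (of_nat (card (sperms n))) (Alt S' n' (cyc S' 1 n' (subst \<sigma> ` F)))"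
    using sum_scale[of "\<lambda>_. 1" _ "sperms n"] by simp
  finally show ?thesis by (simp add: card_sperms)
qed

text \<open>The embedding of the signed permutations of \<open>m\<close> coordinates as those of the
  last \<open>m\<close> out of \<open>k + m\<close>.\<close>

definition gsh :: "nat \<Rightarrow> sperm \<Rightarrow> sperm" where
  "gsh k g = ((+) k ` fst g, \<lambda>i. if i \<le> k then i else k + snd g (i - k))"

lemma gsh_props:
  assumes g: "g \<in> sperms m"
  shows "gsh k g \<in> sperms (k + m)" "sg (gsh k g) = sg g"
proof -
  note D = spermsD[OF g]
  have inj: "inj_on ((+) k) {1..m}" by (auto simp: inj_on_def)
  have bij: "bij_betw ((+) k) {1..m} {k + 1..k + m}"
    using inj by (auto simp: bij_betw_def)
  have 0: "snd g 0 = 0" using D(5)[of 0] by simp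
  \<comment> \<open>As a transported permutation, \<open>snd (gsh k g)\<close> inherits both the
    permutation property and the sign.\<close>
  have eq: "snd (gsh k g) = map_permutation {1..m} ((+) k) (snd g)"
  proof
    fix i
    have p: "map_permutation {1..m} ((+) k) (snd g) permutes {k + 1..k + m}"
      by (rule map_permutation_permutes[OF bij D(2)])
    show "snd (gsh k g) i = map_permutation {1..m} ((+) k) (snd g) i"
    proof (cases "i \<in> {k + 1..k + m}")
      case True
      hence "i - k \<in> {1..m}" "i = k + (i - k)" by auto
      thus ?thesis using map_permutation_apply[OF inj, of "i - k" "snd g"] True by (auto simp: gsh_def)
    next
      case False
      hence "snd g (i - k) = i - k" using 0 by (intro D(5)) auto
      thus ?thesis using False permutes_not_in[OF p False] by (auto simp: gsh_def)
    qed
  qed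
  have "snd (gsh k g) permutes {1..k + m}"
    unfolding eq by (rule permutes_subset[OF map_permutation_permutes[OF bij D(2)]]) auto
  moreover have "fst (gsh k g) \<subseteq> {1..k + m}" using D(1) by (auto simp: gsh_def)
  ultimately show "gsh k g \<in> sperms (k + m)" using spermsI[of "fst (gsh k g)" _ "snd (gsh k g)"] by simp
  have "sign (snd (gsh k g)) = sign (snd g)" unfolding eq by (rule sign_map_permutation[OF inj D(2)]) auto
  thus "sg (gsh k g) = sg g" by (simp add: sg_def gsh_def card_image)
qed

lemma gs_gsh:
  assumes "g \<in> sperms m"
  shows "i \<le> k \<Longrightarrow> gs (gsh k g) (Cube i) = Var (Cube i)"
    "gs (gsh k g) (Cube (k + i)) = (if i = 0 then Var (Cube k) else flp (i \<in> fst g) (Var (Cube (k + snd g i))))"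
proof -
  have "(i \<le> k \<longrightarrow> i \<notin> (+) k ` fst g) \<and> (k + i \<in> (+) k ` fst g \<longleftrightarrow> i \<in> fst g) \<and> 0 \<notin> fst g"
    using spermsD(1)[OF assms] by (auto simp: image_iff)
  thus "i \<le> k \<Longrightarrow> gs (gsh k g) (Cube i) = Var (Cube i)"
    "gs (gsh k g) (Cube (k + i)) = (if i = 0 then Var (Cube k) else flp (i \<in> fst g) (Var (Cube (k + snd g i))))"
    by (auto simp: gs_Cube gsh_def)
qed

lemma snd_pos: "g \<in> sperms n \<Longrightarrow> i \<ge> 1 \<Longrightarrow> snd g i \<ge> 1"
  using spermsD(5,6)[of g n i] by (cases "i \<in> {1..n}") auto

text \<open>The case of the two multiplication maps: the old cube coordinates are shifted past the
  new first one, and the base coordinate becomes a polynomial in \<open>t\<close> and the new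
  coordinate, both fixed by \<open>gsh 1 g\<close>.\<close>

lemma Alt_pullback_shift:
  assumes "\<And>i. \<sigma> (Cube i) = Var (Cube (i + 1))" "\<sigma> (Base 0) \<in> PV {Base 0, Cube 1}"
    and F: "integral S 1 n F" and F': "integral S 1 (n + 1) (subst \<sigma> ` F)"
  shows "Alt S (n + 1) (pullback S 1 (n + 1) \<sigma> (Alt S n (cyc S 1 n F))) = Alt S (n + 1) (cyc S 1 (n + 1) (subst \<sigma> ` F))"
proof (rule Alt_pullback_Alt[where \<phi> = "gsh 1"])
  fix g assume g: "g \<in> sperms n"
  show "gsh 1 g \<in> sperms (n + 1) \<and> sg (gsh 1 g) = sg g"
    using gsh_props[OF g, of 1] by (simp add: add.commute)
  fix v assume v: "v \<in> cs 1 n"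
  show "subst \<sigma> (gs g v) = subst (gs (gsh 1 g)) (\<sigma> v)"
  proof (cases v)
    case (Base j)
    have "subst (gs (gsh 1 g)) (\<sigma> (Base 0)) = subst Var (\<sigma> (Base 0))"
      using assms(2) gs_gsh(1)[OF g, of 1 1] by (intro subst_cong) (auto simp: PV_def)
    thus ?thesis using v Base by simp
  next
    case (Cube i)
    thus ?thesis using v gs_gsh(2)[OF g, of 1 i] snd_pos[OF g, of i] by (simp add: assms(1) gs_Cube)
  qed
next
  show "maps (cs 1 n) (cs 1 (n + 1)) \<sigma>"
    unfolding maps_def
  proof
    fix v assume "v \<in> cs 1 n"
    thus "\<sigma> v \<in> PV (cs 1 (n + 1))"
      using PV_mono[OF _ assms(2), of "cs 1 (n + 1)"] by (cases v) (auto simp: assms(1))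
  qed
qed (use F F' in auto)

section \<open>Products and boundaries of alternating cycles\<close>

lemma ext_prod_cyc:
  assumes "integral S 1 n F" "integral S 1 m F'"
  shows "ext_prod S n m (cyc S 1 n F) (cyc S 1 m F')
    = cyc S 2 (n + m) (subst ext_left ` F \<union> subst (ext_right n) ` F')"
proof -
  have el: "maps (cs 1 n) (cs 2 (n + m)) ext_left" and er: "maps (cs 1 m) (cs 2 (n + m)) (ext_right n)"
    by (auto simp: maps_def cs_def ext_left_def ext_right_def)
  have FP: "F \<subseteq> PV (cs 1 n)" "F' \<subseteq> PV (cs 1 m)" using assms by (auto dest: integralD)
  have *: "fund_cycle S 2 (n + m) (genideal (coord_ring 2 (n + m))
        (subst ext_left ` gen (cs 1 n) F \<union> subst (ext_right n) ` gen (cs 1 m) F'))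
      = cyc S 2 (n + m) (subst ext_left ` F \<union> subst (ext_right n) ` F')"
    by (simp add: cyc_def coord_ring_Rg genideal_gen gen_subst_gen_Un[OF el FP(1) er FP(2), simplified])
  have 0: "cyc S 2 (n + m) (subst ext_left ` F \<union> subst (ext_right n) ` F') = 0"
    if "1 \<in> gen (cs 1 n) F \<or> 1 \<in> gen (cs 1 m) F'"
  proof -
    have "subst ext_left ` F \<union> subst (ext_right n) ` F' \<subseteq> PV (cs 2 (n + m))"
      using FP maps_PV[OF el] maps_PV[OF er] by auto
    hence "gen (cs 2 (n + m)) (subst ext_left ` F) \<subseteq> gen (cs 2 (n + m)) (subst ext_left ` F \<union> subst (ext_right n) ` F')"
      "gen (cs 2 (n + m)) (subst (ext_right n) ` F') \<subseteq> gen (cs 2 (n + m)) (subst ext_left ` F \<union> subst (ext_right n) ` F')"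
      using gen_incl[of "subst ext_left ` F \<union> subst (ext_right n) ` F'" "cs 2 (n + m)"]
      by (intro gen_least idl_gen; simp)+
    thus ?thesis using that gen_unit_subst[OF el FP(1)] gen_unit_subst[OF er FP(2)]
      by (auto simp: cyc_def intro!: fund_cycle_unit)
  qed
  from assms(1) show ?thesis
  proof (cases rule: integral_cases)
    case point
    from assms(2) show ?thesis
    proof (cases rule: integral_cases)
      case point' : point
      show ?thesis unfolding ext_prod_def point(3) point'(3) using * by simp
    next
      case unit
      show ?thesis unfolding ext_prod_def point(3) unit(3) using 0 unit(2) by simp
    qed
  next
    case unit
    show ?thesis unfolding ext_prod_def unit(3) using 0 unit(2) by simp
  qed
qed

lemma ext_prod_bilin:
  "ext_prod S n m (scale a (\<Sum>x\<in>A. scale (c x) (f x))) (scale b (\<Sum>y\<in>B. scale (d y) (h y)))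
    = scale (a * b) (\<Sum>x\<in>A. \<Sum>y\<in>B. scale (c x * d y) (ext_prod S n m (f x) (h y)))"
proof -
  have l: "ext_prod S n m (scale c C) D = scale c (ext_prod S n m C D)" for c C D
    by (simp add: ext_prod_def lin_ext_scale)
  have ls: "ext_prod S n m (sum f A) D = (\<Sum>x\<in>A. ext_prod S n m (f x) D)" for f :: "'a \<Rightarrow> _" and A D
    by (simp add: ext_prod_def lin_ext_sum)
  have r: "ext_prod S n m C (scale c D) = scale c (ext_prod S n m C D)" for c C D
    by (simp add: ext_prod_def lin_ext_scale) (simp add: lin_ext_def scale_sum ac_simps)
  have rs: "ext_prod S n m C (sum f A) = (\<Sum>x\<in>A. ext_prod S n m C (f x))" for f :: "'b \<Rightarrow> _" and A C
    by (simp add: ext_prod_def lin_ext_sum) (simp add: lin_ext_def scale_sum sum.swap[of _ A])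
  show ?thesis
    by (simp add: l ls r rs scale_sum ac_simps) (rule sum.swap)
qed

text \<open>The embedding of the right factor of a product after restriction to the diagonal of the
  base.\<close>

definition sh :: "nat \<Rightarrow> coord \<Rightarrow> mpoly" where
  "sh n v = subst diag_subst (ext_right n v)"

lemma sh_simps [simp]: "sh n (Base j) = Var (Base 0)" "sh n (Cube i) = Var (Cube (n + i))"
  by (simp_all add: sh_def ext_right_def diag_subst_def)

text \<open>Acting by \<open>g\<close> on the left factor and by \<open>h\<close> on the right one
  is the action of \<open>smul g (gsh n h)\<close>, whose sign is the product of both. The outer
  \<open>Alt\<close> therefore turns all pairs into equal contributions, and the average is one of
  them.\<close>

lemma cprod_Alt:
  assumes F: "integral S 1 n F" and F': "integral S 1 m F'"
    and o2: "integral S 2 (n + m) (F \<union> subst (ext_right n) ` F')" and o1: "integral S 1 (n + m) (F \<union> subst (sh n) ` F')"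
  shows "cprod S n m (Alt S n (cyc S 1 n F)) (Alt S m (cyc S 1 m F'))
    = Alt S (n + m) (cyc S 1 (n + m) (F \<union> subst (sh n) ` F'))"
proof -
  let ?N = "n + m"
  let ?X = "cyc S 1 ?N (F \<union> subst (sh n) ` F')"
  have diag: "maps (cs 2 ?N) (cs 1 ?N) diag_subst"
    by (auto simp: maps_def cs_def diag_subst_def)
  have FP: "F \<subseteq> PV (cs 1 n)" "F' \<subseteq> PV (cs 1 m)" using F F' by (auto dest: integralD)
  have el: "subst ext_left = (\<lambda>p. p)" by (rule ext) (simp add: ext_left_def)
  have trm: "Alt S ?N (pullback S 1 ?N diag_subst (ext_prod S n m (act S n g (cyc S 1 n F)) (act S m h (cyc S 1 m F'))))
      = scale (sg g * sg h) (Alt S ?N ?X)" if g: "g \<in> sperms n" and h: "h \<in> sperms m" for g h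
  proof -
    define k where "k = smul g (gsh n h)"
    have k: "k \<in> sperms ?N" "sg k = sg g * sg h"
      using smul_in[OF sperms_mono[OF g] gsh_props(1)[OF h]] sg_smul[OF sperms_mono[OF g] gsh_props(1)[OF h]]
        gsh_props(2)[OF h] by (auto simp: k_def)
    have gsk: "gs k v = subst (gs g) (gs (gsh n h) v)" for v by (simp add: k_def gs_smul)
    have L: "gs g v = gs k v" if "v \<in> cs 1 n" for v
      using that gs_gsh(1)[OF h] by (cases v) (auto simp: gsk)
    have R: "subst (ext_right n) (gs h v) = subst (gs k) (ext_right n v)" if "v \<in> cs 1 m" for v
    proof (cases v)
      case (Cube i)
      have i: "1 \<le> i" "1 \<le> snd h i" using that Cube snd_pos[OF h, of i] by auto
      have "n + snd h i \<notin> fst g" "snd g (n + snd h i) = n + snd h i"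
        using spermsD(1)[OF g] spermsD(5)[OF g, of "n + snd h i"] i by auto
      thus ?thesis using i Cube gs_gsh(2)[OF h, of n i]
        by (simp add: gsk ext_right_def gs_Cube[of h] gs_Cube[of g])
    qed (simp add: ext_right_def)
    have L': "subst (gs g) ` F = subst (gs k) ` F"
      using FP by (intro image_cong refl subst_cong L) (auto simp: PV_def)
    have R': "subst (ext_right n) ` subst (gs h) ` F' = subst (gs k) ` subst (ext_right n) ` F'"
      by (rule image_intertwine[OF R FP(2)])
    have "ext_prod S n m (act S n g (cyc S 1 n F)) (act S m h (cyc S 1 m F'))
        = cyc S 2 ?N (subst (gs k) ` (F \<union> subst (ext_right n) ` F'))"
      using ext_prod_cyc[OF integral_gs[OF g F] integral_gs[OF h F']]
      by (simp only: act_cyc[OF g F] act_cyc[OF h F'] el image_ident L' R' image_Un)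
    hence "pullback S 1 ?N diag_subst (ext_prod S n m (act S n g (cyc S 1 n F)) (act S m h (cyc S 1 m F')))
        = cyc S 1 ?N (subst diag_subst ` subst (gs k) ` (F \<union> subst (ext_right n) ` F'))"
      by (simp only: pullback_cyc[OF integral_gs[OF k(1) o2] diag])
    also have "subst diag_subst ` subst (gs k) ` (F \<union> subst (ext_right n) ` F')
        = subst (gs k) ` subst diag_subst ` (F \<union> subst (ext_right n) ` F')"
    proof (rule image_intertwine[OF _ integralD[OF o2]])
      show "subst diag_subst (gs k v) = subst (gs k) (diag_subst v)" for v
        by (cases v) (auto simp: diag_subst_def gs_Cube)
    qed
    also have "subst diag_subst ` (F \<union> subst (ext_right n) ` F') = F \<union> subst (sh n) ` F'"
    proof -
      have "subst diag_subst p = subst Var p" if "p \<in> F" for p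
      proof (rule subst_cong)
        fix v assume "v \<in> vars p"
        hence "v \<in> cs 1 n" using that FP by (auto simp: PV_def)
        thus "diag_subst v = Var v" by (cases v) (auto simp: diag_subst_def)
      qed
      hence "subst diag_subst ` F = F" by simp
      thus ?thesis by (simp add: image_Un subst_image_subst sh_def[symmetric])
    qed
    also have "cyc S 1 ?N (subst (gs k) ` (F \<union> subst (sh n) ` F')) = act S ?N k ?X"
      using act_cyc[OF k(1) o1] by simp
    finally show ?thesis using Alt_act[OF k(1) cyc_keys[OF o1]] k(2) by simp
  qed
  have one: "sg g * sg h * (sg g * sg h) = 1" for g h
  proof -
    have "sg g * sg h * (sg g * sg h) = (sg g * sg g) * (sg h * sg h)" by (simp only: ac_simps)
    thus ?thesis by simp
  qed
  have "cprod S n m (Alt S n (cyc S 1 n F)) (Alt S m (cyc S 1 m F'))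
      = scale (1 / (2 ^ n * fact n) * (1 / (2 ^ m * fact m))) (\<Sum>g\<in>sperms n. \<Sum>h\<in>sperms m. Alt S ?N ?X)"
    unfolding cprod_def Alt_sperms[of S n] Alt_sperms[of S m] ext_prod_bilin
    unfolding pullback_lin Alt_lin
    by (intro arg_cong[of _ _ "scale _"] sum.cong refl) (simp only: trm scale_simps one)
  also have "(\<Sum>g\<in>sperms n. \<Sum>h\<in>sperms m. Alt S ?N ?X) = scale (of_nat (card (sperms n)) * of_nat (card (sperms m))) (Alt S ?N ?X)"
    using sum_scale[of "\<lambda>_. 1" "Alt S ?N ?X" "sperms m"] sum_scale[of "\<lambda>_. of_nat (card (sperms m))" "Alt S ?N ?X" "sperms n"] by simp
  finally show ?thesis by (simp add: card_sperms)
qed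

section \<open>Faces of alternating cycles and the boundary\<close>

lemma face_transpose:
  assumes "1 \<le> i"
  shows "subst (face_subst i \<epsilon>) (gs ({}, Transposition.transpose i (Suc i)) v) = face_subst (Suc i) \<epsilon> v"
  using assms by (cases v) (auto simp: gs_Cube face_subst_def Transposition.transpose_def)

lemma face_flip: "subst (face_subst i Zero) (gs ({i}, id) v) = face_subst i Infty v"
  by (cases v) (auto simp: gs_Cube face_subst_def flp_def)

lemma sperms_elem:
  assumes "1 \<le> i" "i < n"
  shows "({}, Transposition.transpose i (Suc i)) \<in> sperms n" "sg ({}, Transposition.transpose i (Suc i)) = - 1"
  using assms by (auto intro!: spermsI permutes_swap_id simp: sg_def sign_swap_id)

lemma sperms_flip:
  assumes "1 \<le> i" "i \<le> n"
  shows "({i}, id) \<in> sperms n" "sg ({i}, id) = - 1"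
  using assms by (auto intro!: spermsI permutes_id simp: sg_def)

text \<open>Inverting \<open>u_i\<close> exchanges its two faces and an adjacent transposition moves
  \<open>u_i\<close> to \<open>u_(i+1)\<close>, each at the cost of a sign. These signs are exactly
  those of the boundary, so all \<open>2 * n\<close> terms equal the face
  \<open>u_1 = 0\<close>.\<close>

lemma bdry_alternating:
  assumes C: "ks C \<subseteq> points S 1 n" and A: "\<And>g. g \<in> sperms n \<Longrightarrow> act S n g C = scale (sg g) C"
  shows "bdry S n C = scale (2 * of_nat n) (face_pull S n 1 Zero C)"
proof -
  have flip: "face_pull S n i Infty C = scale (- 1) (face_pull S n i Zero C)" if "1 \<le> i" "i \<le> n" for i
    using pullback_act[OF sperms_flip(1)[OF that] C, of S 1 "n - 1" "face_subst i Zero"]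
      A[OF sperms_flip(1)[OF that]] sperms_flip(2)[OF that]
    by (simp add: face_pull_def face_flip pullback_lin)
  have step: "face_pull S n (Suc i) Zero C = scale (- 1) (face_pull S n i Zero C)" if "1 \<le> i" "i < n" for i
    using pullback_act[OF sperms_elem(1)[OF that] C, of S 1 "n - 1" "face_subst i Zero"]
      A[OF sperms_elem(1)[OF that]] sperms_elem(2)[OF that]
    by (simp add: face_pull_def face_transpose[OF that(1)] pullback_lin)
  have fi: "face_pull S n i Zero C = scale ((- 1) ^ (i - 1)) (face_pull S n 1 Zero C)" if "1 \<le> i" "i \<le> n" for i
    using that
  proof (induction i rule: nat_induct_at_least)
    case (Suc i)
    thus ?case using step[of i] by (cases i) auto
  qed simp
  have "scale ((- 1) ^ (i - 1)) (face_pull S n i Zero C - face_pull S n i Infty C) = scale 2 (face_pull S n 1 Zero C)"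
    if "i \<in> {1..n}" for i
  proof -
    have e: "(- 1) ^ (i - 1) * (- 1) ^ (i - 1) = (1 :: rat)" by (simp flip: power_mult_distrib)
    have "scale ((- 1) ^ (i - 1)) (scale ((- 1) ^ (i - 1)) D - scale (- 1) (scale ((- 1) ^ (i - 1)) D)) = scale 2 D" for D
      by (rule poly_mapping_eqI) (use e in \<open>simp add: lookup_minus algebra_simps\<close>)
    thus ?thesis using that flip[of i] fi[of i] by simp
  qed
  hence "bdry S n C = (\<Sum>i=1..n. scale 2 (face_pull S n 1 Zero C))" by (simp add: bdry_def)
  also have "\<dots> = scale (2 * of_nat n) (face_pull S n 1 Zero C)"
    using sum_scale[of "\<lambda>_. 2" "face_pull S n 1 Zero C" "{1..n}"] by (simp add: mult.commute)
  finally show ?thesis .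
qed

text \<open>For positive \<open>l\<close>, the cycle sending \<open>l\<close> to 1 and each positive
  \<open>j < l\<close> to \<open>j + 1\<close>; composing adjacent transpositions lets sign and
  effect on faces follow by induction.\<close>

fun cyperm :: "nat \<Rightarrow> nat \<Rightarrow> nat" where
  "cyperm 0 = id"
| "cyperm (Suc 0) = id"
| "cyperm (Suc (Suc i)) = cyperm (Suc i) \<circ> Transposition.transpose (Suc i) (Suc (Suc i))"

text \<open>\<open>rep l \<epsilon>\<close> moves the face \<open>u\<^sub>l = \<epsilon>\<close> to the face \<open>u\<^sub>1 = 0\<close>, keeping the order of the other coordinates.\<close>

definition rep :: "nat \<Rightarrow> eps \<Rightarrow> sperm" where
  "rep l \<epsilon> = (if \<epsilon> = Infty then {l} else {}, cyperm l)"

definition eps_sg :: "eps \<Rightarrow> rat" where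
  "eps_sg \<epsilon> = (if \<epsilon> = Zero then 1 else - 1)"

lemma cyperm_l: "1 \<le> l \<Longrightarrow> cyperm l l = 1"
  by (induction l rule: cyperm.induct) auto

lemma rep_Suc: "1 \<le> l \<Longrightarrow> rep (Suc l) Zero = smul (rep l Zero) ({}, Transposition.transpose l (Suc l))"
  by (cases l) (auto simp: rep_def smul_def)

lemma rep_Infty: "rep l Infty = smul (rep l Zero) ({l}, id)"
  by (auto simp: rep_def smul_def)

lemma rep_Zero_props:
  assumes "1 \<le> l" "l \<le> n"
  shows "rep l Zero \<in> sperms n \<and> sg (rep l Zero) = (- 1) ^ (l - 1) \<and>
    (\<forall>v. subst (face_subst 1 Zero) (gs (rep l Zero) v) = face_subst l Zero v)"
  using assms
proof (induction l rule: nat_induct_at_least)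
  case base
  thus ?case by (auto simp: rep_def sperms_def permutes_id sg_def gs_id)
next
  case (Suc l)
  let ?t = "({}, Transposition.transpose l (Suc l)) :: sperm"
  have l: "1 \<le> l" "l < n" using Suc by auto
  have IH: "rep l Zero \<in> sperms n" "sg (rep l Zero) = (- 1) ^ (l - 1)"
    "\<And>v. subst (face_subst 1 Zero) (gs (rep l Zero) v) = face_subst l Zero v" using Suc by auto
  have "subst (face_subst 1 Zero) (gs (smul (rep l Zero) ?t) v) = face_subst (Suc l) Zero v" for v
    using face_transpose[OF l(1)] by (simp only: gs_smul[symmetric] subst_subst IH(3))
  moreover have "(- 1) ^ (l - 1) * (- 1) = ((- 1) ^ (Suc l - 1) :: rat)" using l by (cases l) auto
  ultimately show ?case
    using IH smul_in[OF IH(1) sperms_elem(1)[OF l]] sg_smul[OF IH(1) sperms_elem(1)[OF l]] sperms_elem(2)[OF l]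
    by (simp only: rep_Suc[OF l(1)] simp_thms)
qed

lemma rep_props:
  assumes "1 \<le> l" "l \<le> n"
  shows "rep l \<epsilon> \<in> sperms n" "sg (rep l \<epsilon>) = (- 1) ^ (l - 1) * eps_sg \<epsilon>"
    "subst (face_subst 1 Zero) (gs (rep l \<epsilon>) v) = face_subst l \<epsilon> v"
proof -
  note Z = rep_Zero_props[OF assms]
  have I: "rep l Infty \<in> sperms n" "sg (rep l Infty) = - ((- 1) ^ (l - 1))"
    using Z smul_in[OF _ sperms_flip(1)[OF assms], of "rep l Zero"] sg_smul[OF _ sperms_flip(1)[OF assms], of "rep l Zero"]
      sperms_flip(2)[OF assms] by (auto simp: rep_Infty)
  have F: "subst (face_subst 1 Zero) (gs (rep l Infty) v) = face_subst l Infty v"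
    using Z face_flip[of l v] by (simp only: rep_Infty gs_smul[symmetric] subst_subst)
  show "rep l \<epsilon> \<in> sperms n" using Z I(1) by (cases \<epsilon>) blast+
  show "sg (rep l \<epsilon>) = (- 1) ^ (l - 1) * eps_sg \<epsilon>"
    using conjunct1[OF conjunct2[OF Z]] I(2) by (cases \<epsilon>) (simp_all add: eps_sg_def)
  show "subst (face_subst 1 Zero) (gs (rep l \<epsilon>) v) = face_subst l \<epsilon> v"
    using Z F by (cases \<epsilon>) blast+
qed

lemma sum_eps: "(\<Sum>\<epsilon>\<in>{Zero, Infty}. f \<epsilon>) = f Zero + f Infty"
  by (subst sum.insert) auto

text \<open>The elements \<open>rep l \<epsilon>\<close> represent the cosets of the subgroup that
  acts on the last \<open>m\<close> coordinates only; there is one for each face of codimension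
  1.\<close>

lemma coset_bij:
  "bij_betw (\<lambda>(l, \<epsilon>, g). smul (gsh 1 g) (rep l \<epsilon>)) ({1..Suc m} \<times> {Zero, Infty} \<times> sperms m) (sperms (Suc m))"
proof -
  let ?f = "\<lambda>(l, \<epsilon>, g). smul (gsh 1 g) (rep l \<epsilon>)"
  let ?A = "{1..Suc m} \<times> {Zero, Infty} \<times> sperms m"
  have gin: "gsh 1 g \<in> sperms (Suc m)" if "g \<in> sperms m" for g
    using gsh_props(1)[OF that, of 1] by simp
  have inj: "inj_on ?f ?A"
  proof (rule inj_onI, unfold split_paired_all)
    fix l \<epsilon> E \<pi> l' \<epsilon>' E' \<pi>'
    assume "(l, \<epsilon>, E, \<pi>) \<in> ?A" "(l', \<epsilon>', E', \<pi>') \<in> ?A" "?f (l, \<epsilon>, E, \<pi>) = ?f (l', \<epsilon>', E', \<pi>')"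
    hence l: "l \<in> {1..Suc m}" "l' \<in> {1..Suc m}" and g: "(E, \<pi>) \<in> sperms m" and g': "(E', \<pi>') \<in> sperms m"
      and eq: "smul (gsh 1 (E, \<pi>)) (rep l \<epsilon>) = smul (gsh 1 (E', \<pi>')) (rep l' \<epsilon>')"
      by simp_all
    define x where "x = smul (gsh 1 (E, \<pi>)) (rep l \<epsilon>)"
    have S1: "snd (gsh 1 h) 1 = 1" "1 \<notin> fst (gsh 1 h)" if "h \<in> sperms m" for h
      using spermsD(1)[OF that] by (auto simp: gsh_def)
    \<comment> \<open>The face can be read off from the product: \<open>j\<close> is the index sent
      to 1, and it is inverted exactly for the face at infinity.\<close>
    have key: "snd y j = 1 \<and> (j \<in> fst y \<longleftrightarrow> \<delta> = Infty)"
      if "y = smul (gsh 1 h) (rep j \<delta>)" "h \<in> sperms m" "j \<in> {1..Suc m}" for y h j \<delta>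
      using that S1[OF that(2)] cyperm_l[of j] by (auto simp: smul_def rep_def)
    have k1: "snd x l = 1 \<and> (l \<in> fst x \<longleftrightarrow> \<epsilon> = Infty)" by (rule key[OF x_def g l(1)])
    have k2: "snd x l' = 1 \<and> (l' \<in> fst x \<longleftrightarrow> \<epsilon>' = Infty)" by (rule key[OF _ g' l(2)]) (use eq in \<open>simp add: x_def\<close>)
    have "x \<in> sperms (Suc m)" unfolding x_def using l by (intro smul_in gin g rep_props(1)) auto
    hence "inj (snd x)" by (intro permutes_inj[OF spermsD(2)])
    hence ll: "l = l'" using k1 k2 by (intro injD[of "snd x" l l']) simp_all
    have "\<epsilon> = Infty \<longleftrightarrow> \<epsilon>' = Infty" using k1 k2 ll by simp
    hence ee: "\<epsilon> = \<epsilon>'" by (cases \<epsilon>; cases \<epsilon>') simp_all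
    have r: "rep l \<epsilon> \<in> sperms (Suc m)" using l by (intro rep_props(1)) auto
    have "smul (smul (gsh 1 (E, \<pi>)) (rep l \<epsilon>)) (sinv (rep l \<epsilon>)) = smul (smul (gsh 1 (E', \<pi>')) (rep l \<epsilon>)) (sinv (rep l \<epsilon>))"
      using eq ll ee by simp
    hence gg: "gsh 1 (E, \<pi>) = gsh 1 (E', \<pi>')" by (simp only: smul_assoc smul_sinv(1)[OF r] smul_id)
    have "E = E'" using gg inj_image_eq_iff[of "(+) (1::nat)" E E'] by (simp add: gsh_def)
    moreover have "\<pi> i = \<pi>' i" for i
    proof (cases "i = 0")
      case True
      thus ?thesis using spermsD(5)[OF g, of 0] spermsD(5)[OF g', of 0] by simp
    next
      case False
      have "snd (gsh 1 (E, \<pi>)) (Suc i) = snd (gsh 1 (E', \<pi>')) (Suc i)" by (simp only: gg)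
      thus ?thesis using False by (simp add: gsh_def)
    qed
    ultimately show "(l, \<epsilon>, E, \<pi>) = (l', \<epsilon>', E', \<pi>')" using ll ee by auto
  qed
  have "?f ` ?A = sperms (Suc m)"
  proof (rule card_subset_eq)
    show "?f ` ?A \<subseteq> sperms (Suc m)"
      using gin by (auto intro!: smul_in rep_props(1))
    \<comment> \<open>Surjectivity by counting: the group grows by the factor
      \<open>2 * Suc m\<close>, the number of representatives.\<close>
    have "card (?f ` ?A) = card ?A" by (rule card_image[OF inj])
    also have "\<dots> = Suc m * (2 * card (sperms m))" by (simp add: card_cartesian_product)
    finally show "card (?f ` ?A) = card (sperms (Suc m))" by (simp add: card_sperms algebra_simps)
  qed simp
  thus ?thesis using inj by (simp add: bij_betw_def)
qed

lemma face_gsh: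
  assumes "g \<in> sperms m" "v \<in> cs 1 (Suc m)"
  shows "subst (face_subst 1 Zero) (gs (gsh 1 g) v) = subst (gs g) (face_subst 1 Zero v)"
proof (cases v)
  case (Cube i)
  show ?thesis
  proof (cases "i = 1")
    case True
    thus ?thesis using Cube gs_gsh(1)[OF assms(1), of 1 1] by (simp add: face_subst_def)
  next
    case False
    define j where "j = i - 1"
    have j: "i = 1 + j" "1 \<le> j" using False assms(2) Cube by (auto simp: j_def)
    thus ?thesis using Cube gs_gsh(2)[OF assms(1), of 1 j] snd_pos[OF assms(1) j(2)]
      by (simp add: face_subst_def gs_Cube)
  qed
qed (simp add: face_subst_def)

lemma maps_face: "1 \<le> l \<Longrightarrow> l \<le> Suc m \<Longrightarrow> maps (cs b (Suc m)) (cs b m) (face_subst l \<epsilon>)"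
  unfolding maps_def
proof
  fix v assume l: "1 \<le> l" "l \<le> Suc m" and v: "v \<in> cs b (Suc m)"
  show "face_subst l \<epsilon> v \<in> PV (cs b m)"
  proof (cases v)
    case (Cube i)
    have e: "eps_val \<epsilon> \<in> PV (cs b m)" by (cases \<epsilon>) simp_all
    consider "i < l" | "i = l" | "l < i" by linarith
    thus ?thesis
    proof cases
      case 1
      hence "Cube i \<in> cs b m" using Cube v l by simp
      thus ?thesis using 1 Cube by (simp add: face_subst_def)
    next
      case 3
      hence "1 \<le> i - 1" "i - 1 \<le> m" using Cube v l by simp_all
      hence "Cube (i - 1) \<in> cs b m" by simp
      thus ?thesis using 3 Cube by (simp add: face_subst_def)
    qed (use e Cube in \<open>simp add: face_subst_def\<close>)
  qed (use v in \<open>auto simp: face_subst_def\<close>)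
qed

text \<open>By \<open>bdry_alternating\<close> only the face \<open>u_1 = 0\<close> of the
  alternated cycle matters. Splitting the group sum along \<open>coset_bij\<close>, the
  representative turns this face into the face \<open>u_l = \<epsilon>\<close> with the sign it has
  in the boundary, and the sum over the subgroup rebuilds \<open>Alt\<close> in dimension
  \<open>m\<close>.\<close>

lemma bdry_Alt:
  assumes F: "integral S 1 (Suc m) F" and faces: "\<And>l \<epsilon>. l \<in> {1..Suc m} \<Longrightarrow> integral S 1 m (subst (face_subst l \<epsilon>) ` F)"
  shows "bdry S (Suc m) (Alt S (Suc m) (cyc S 1 (Suc m) F)) = Alt S m (bdry S (Suc m) (cyc S 1 (Suc m) F))"
proof -
  let ?n = "Suc m"
  let ?C = "cyc S 1 ?n F"
  let ?D = "\<lambda>l \<epsilon>. cyc S 1 m (subst (face_subst l \<epsilon>) ` F)"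
  have C: "ks ?C \<subseteq> points S 1 ?n" by (rule cyc_keys[OF F])
  have fp: "face_pull S ?n l \<epsilon> ?C = ?D l \<epsilon>" if "l \<in> {1..?n}" for l \<epsilon>
    unfolding face_pull_def using that maps_face[of l m 1 \<epsilon>] by (simp only: pullback_cyc[OF F] diff_Suc_1 atLeastAtMost_iff)
  have one: "face_pull S ?n 1 Zero (act S ?n (smul (gsh 1 g) (rep l \<epsilon>)) ?C) = act S m g (?D l \<epsilon>)"
    if l: "l \<in> {1..?n}" and g: "g \<in> sperms m" for l \<epsilon> g
  proof -
    have r: "rep l \<epsilon> \<in> sperms ?n" using l by (intro rep_props(1)) auto
    have k: "smul (gsh 1 g) (rep l \<epsilon>) \<in> sperms ?n"
      using gsh_props(1)[OF g, of 1] r by (intro smul_in) auto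
    have eq: "subst (face_subst 1 Zero) (gs (smul (gsh 1 g) (rep l \<epsilon>)) v) = subst (gs g) (face_subst l \<epsilon> v)"
      if v: "v \<in> cs 1 ?n" for v
    proof -
      have "gs (rep l \<epsilon>) v \<in> PV (cs 1 ?n)" using maps_gs[OF r, of 1] v by (auto simp: maps_def)
      hence "subst (\<lambda>w. subst (face_subst 1 Zero) (gs (gsh 1 g) w)) (gs (rep l \<epsilon>) v)
          = subst (\<lambda>w. subst (gs g) (face_subst 1 Zero w)) (gs (rep l \<epsilon>) v)"
        using face_gsh[OF g] by (intro subst_cong) (auto simp: PV_def)
      thus ?thesis using rep_props(3)[of l ?n \<epsilon> v] l
        by (simp only: gs_smul[symmetric] subst_subst) (simp flip: subst_subst)
    qed
    have "face_pull S ?n 1 Zero (act S ?n (smul (gsh 1 g) (rep l \<epsilon>)) ?C)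
        = cyc S 1 m (subst (face_subst 1 Zero) ` subst (gs (smul (gsh 1 g) (rep l \<epsilon>))) ` F)"
      unfolding face_pull_def act_cyc[OF k F] diff_Suc_1
      by (rule pullback_cyc[OF integral_gs[OF k F] maps_face]) auto
    also have "subst (face_subst 1 Zero) ` subst (gs (smul (gsh 1 g) (rep l \<epsilon>))) ` F = subst (gs g) ` subst (face_subst l \<epsilon>) ` F"
      unfolding subst_image_subst using integralD[OF F] eq by (intro image_cong refl subst_cong) (auto simp: PV_def)
    also have "cyc S 1 m \<dots> = act S m g (?D l \<epsilon>)" using faces[OF l] g by (simp only: act_cyc)
    finally show ?thesis .
  qed
  have sgk: "sg (smul (gsh 1 g) (rep l \<epsilon>)) = sg g * ((- 1) ^ (l - 1) * eps_sg \<epsilon>)"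
    if l: "l \<in> {1..?n}" and g: "g \<in> sperms m" for l \<epsilon> g
  proof -
    have r: "rep l \<epsilon> \<in> sperms ?n" "sg (rep l \<epsilon>) = (- 1) ^ (l - 1) * eps_sg \<epsilon>" using l rep_props(1,2)[of l ?n \<epsilon>] by auto
    have "gsh 1 g \<in> sperms ?n" "sg (gsh 1 g) = sg g" using gsh_props[OF g, of 1] by simp_all
    thus ?thesis using sg_smul[of "gsh 1 g" ?n "rep l \<epsilon>"] r by simp
  qed
  let ?h = "\<lambda>k. scale (sg k) (face_pull S ?n 1 Zero (act S ?n k ?C))"
  have "(\<Sum>k\<in>sperms ?n. ?h k) = (\<Sum>(l, \<epsilon>, g)\<in>{1..?n} \<times> {Zero, Infty} \<times> sperms m. ?h (smul (gsh 1 g) (rep l \<epsilon>)))"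
    using sum.reindex_bij_betw[OF coset_bij, of ?h m] by (simp add: case_prod_beta)
  also have "\<dots> = (\<Sum>(l, \<epsilon>, g)\<in>{1..?n} \<times> {Zero, Infty} \<times> sperms m. scale ((- 1) ^ (l - 1) * eps_sg \<epsilon>) (scale (sg g) (act S m g (?D l \<epsilon>))))"
    by (intro sum.cong refl) (auto simp only: one sgk scale_simps mult.commute split: prod.splits)
  also have "\<dots> = (\<Sum>l=1..?n. \<Sum>\<epsilon>\<in>{Zero, Infty}. \<Sum>g\<in>sperms m. scale ((- 1) ^ (l - 1) * eps_sg \<epsilon>) (scale (sg g) (act S m g (?D l \<epsilon>))))"
    by (simp only: sum.cartesian_product)
  also have "\<dots> = (\<Sum>l=1..?n. \<Sum>\<epsilon>\<in>{Zero, Infty}. scale ((- 1) ^ (l - 1) * eps_sg \<epsilon>) (scale (2 ^ m * fact m) (Alt S m (?D l \<epsilon>))))"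
    by (simp only: scale_sum[symmetric] Alt_sperms) (simp only: scale_simps, simp)
  also have "\<dots> = scale (2 ^ m * fact m) (Alt S m (bdry S ?n ?C))"
  proof -
    have "bdry S ?n ?C = (\<Sum>l=1..?n. scale ((- 1) ^ (l - 1)) (?D l Zero - ?D l Infty))"
      unfolding bdry_def by (intro sum.cong refl) (simp only: fp)
    moreover have "scale a (scale b A) + scale (- a) (scale b B) = scale b (scale a (A - B))" for a b A B
      by (rule poly_mapping_eqI) (simp add: lookup_add lookup_minus algebra_simps)
    ultimately show ?thesis
      by (simp only: sum_eps Alt_lin scale_sum eps_sg_def) (simp add: Alt_lin)
  qed
  finally have sum: "(\<Sum>k\<in>sperms ?n. ?h k) = scale (2 ^ m * fact m) (Alt S m (bdry S ?n ?C))" .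
  have "face_pull S ?n 1 Zero (Alt S ?n ?C) = scale (1 / (2 ^ ?n * fact ?n)) (\<Sum>k\<in>sperms ?n. ?h k)"
    by (simp only: Alt_sperms face_pull_def pullback_lin)
  hence "bdry S ?n (Alt S ?n ?C) = scale (2 * of_nat ?n) (scale (1 / (2 ^ ?n * fact ?n)) (scale (2 ^ m * fact m) (Alt S m (bdry S ?n ?C))))"
    using bdry_alternating[OF ks_Alt_points[OF F] act_Alt[OF _ C]] sum by simp
  \<comment> \<open>The \<open>2 * Suc m\<close> equal faces compensate the ratio of the two group
    orders.\<close>
  also have "2 * of_nat ?n * (1 / (2 ^ ?n * fact ?n) * (2 ^ m * fact m)) = (1 :: rat)"
    using of_nat_neq_0[of m, where 'a = rat] by (simp add: fact_Suc del: of_nat_Suc)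
  hence "scale (2 * of_nat ?n) (scale (1 / (2 ^ ?n * fact ?n)) (scale (2 ^ m * fact m) (Alt S m (bdry S ?n ?C)))) = Alt S m (bdry S ?n ?C)"
    by (simp only: scale_simps)
  finally show ?thesis .
qed

section \<open>An upper bound for the length of chains of primes\<close>

text \<open>Monomials in arbitrary ring elements. Exponents are lists because the argument in
  \<open>lex_chain\<close> strips one element and one exponent at a time.\<close>

fun mprod :: "'a::comm_ring_1 list \<Rightarrow> nat list \<Rightarrow> 'a" where
  "mprod (a # as) (k # e) = a ^ k * mprod as e"
| "mprod _ _ = 1"

definition expos :: "nat \<Rightarrow> nat \<Rightarrow> nat list set" where
  "expos r B = {e. set e \<subseteq> {..B} \<and> length e = r}"

lemma finite_expos [simp]: "finite (expos r B)"
  unfolding expos_def by (rule finite_lists_length_eq) simp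

lemma card_expos: "card (expos r B) = Suc B ^ r"
  unfolding expos_def by (subst card_lists_length_eq) auto

lemma mprod_PV: "(\<And>a. a \<in> set as \<Longrightarrow> a \<in> PV V) \<Longrightarrow> mprod as e \<in> PV V"
  by (induction as e rule: mprod.induct) auto

lemma mprod_add:
  "length e = length as \<Longrightarrow> length e' = length as \<Longrightarrow> mprod as (map2 (+) e e') = mprod as e * mprod as e'"
  by (induction as arbitrary: e e') (auto simp: length_Suc_conv power_add ac_simps)

lemma mprod_0: "mprod as (replicate (length as) 0) = 1"
  by (induction as) auto

text \<open>The degree is bounded in each variable separately, so the number of monomials is a plain
  power, see \<open>card_expos\<close>.\<close>

definition mspan :: "coord set \<Rightarrow> coord list \<Rightarrow> nat \<Rightarrow> mpoly set" where
  "mspan V0 xs B = {p. \<exists>c. (\<forall>e. c e \<in> PV V0) \<and> p = (\<Sum>e\<in>expos (length xs) B. c e * mprod (map Var xs) e)}"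

lemma mspan_term: "a \<in> PV V0 \<Longrightarrow> e \<in> expos (length xs) B \<Longrightarrow> a * mprod (map Var xs) e \<in> mspan V0 xs B"
  unfolding mspan_def
  by (intro CollectI exI[of _ "\<lambda>e'. if e' = e then a else 0"] conjI)
     (simp_all add: if_distrib[of "\<lambda>x. x * _"] cong: if_cong)

lemma mspan_add: assumes "p \<in> mspan V0 xs B" "q \<in> mspan V0 xs B" shows "p + q \<in> mspan V0 xs B"
proof -
  obtain c d where "\<forall>e. c e \<in> PV V0" "\<forall>e. d e \<in> PV V0"
    "p = (\<Sum>e\<in>expos (length xs) B. c e * mprod (map Var xs) e)"
    "q = (\<Sum>e\<in>expos (length xs) B. d e * mprod (map Var xs) e)"
    using assms unfolding mspan_def by auto
  thus ?thesis unfolding mspan_def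
    by (intro CollectI exI[of _ "\<lambda>e. c e + d e"]) (simp add: sum.distrib algebra_simps)
qed

lemma mspan_0: "0 \<in> mspan V0 xs B"
  unfolding mspan_def by (intro CollectI exI[of _ "\<lambda>_. 0"]) simp

lemma mspan_sum: "(\<And>x. x \<in> A \<Longrightarrow> f x \<in> mspan V0 xs B) \<Longrightarrow> sum f A \<in> mspan V0 xs B"
  by (induction A rule: infinite_finite_induct) (auto simp: mspan_0 mspan_add)

lemma mspan_mono: assumes "p \<in> mspan V0 xs B" "B \<le> B'" shows "p \<in> mspan V0 xs B'"
proof -
  obtain c where c: "\<forall>e. c e \<in> PV V0" "p = (\<Sum>e\<in>expos (length xs) B. c e * mprod (map Var xs) e)"
    using assms(1) unfolding mspan_def by auto
  have "expos (length xs) B \<subseteq> expos (length xs) B'" using assms(2) by (auto simp: expos_def)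
  thus ?thesis unfolding c(2) using c(1) by (intro mspan_sum mspan_term) auto
qed

lemma mspan_mult: assumes "p \<in> mspan V0 xs B" "q \<in> mspan V0 xs B'" shows "p * q \<in> mspan V0 xs (B + B')"
proof -
  obtain c d where c: "\<forall>e. c e \<in> PV V0" "\<forall>e. d e \<in> PV V0"
    "p = (\<Sum>e\<in>expos (length xs) B. c e * mprod (map Var xs) e)"
    "q = (\<Sum>e\<in>expos (length xs) B'. d e * mprod (map Var xs) e)"
    using assms unfolding mspan_def by auto
  show ?thesis unfolding c(3,4) sum_product
  proof (intro mspan_sum)
    fix e e' assume e: "e \<in> expos (length xs) B" "e' \<in> expos (length xs) B'"
    have "map2 (+) e e' \<in> expos (length xs) (B + B')"
      using e by (fastforce simp: expos_def dest: set_zip_leftD set_zip_rightD intro: add_mono)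
    hence "(c e * d e') * mprod (map Var xs) (map2 (+) e e') \<in> mspan V0 xs (B + B')"
      using c by (intro mspan_term) auto
    thus "c e * mprod (map Var xs) e * (d e' * mprod (map Var xs) e') \<in> mspan V0 xs (B + B')"
      using e by (simp add: mprod_add expos_def ac_simps)
  qed
qed

lemma mspan_const: "a \<in> PV V0 \<Longrightarrow> a \<in> mspan V0 xs 0"
  using mspan_term[of a V0 "replicate (length xs) 0" xs 0] mprod_0[of "map Var xs"]
  by (auto simp: expos_def set_replicate_conv_if)

lemma mprod_Var: "x \<in> set xs \<Longrightarrow> \<exists>e\<in>expos (length xs) 1. mprod (map Var xs) e = Var x"
proof (induction xs)
  case (Cons x' xs)
  show ?case
  proof (cases "x = x'")
    case True
    thus ?thesis using mprod_0[of "map Var xs"]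
      by (intro bexI[of _ "1 # replicate (length xs) 0"]) (auto simp: expos_def)
  next
    case False
    then obtain e where "e \<in> expos (length xs) 1" "mprod (map Var xs) e = Var x" using Cons by auto
    thus ?thesis by (intro bexI[of _ "0 # e"]) (auto simp: expos_def)
  qed
qed auto

lemma mspan_power: "p \<in> mspan V0 xs B \<Longrightarrow> p ^ k \<in> mspan V0 xs (k * B)"
proof (induction k)
  case 0
  show ?case using mspan_const[of 1] by simp
next
  case (Suc k)
  thus ?case using mspan_mult[of p V0 xs B "p ^ k" "k * B"] by simp
qed

lemma mspan_ex: "p \<in> PV (V0 \<union> set xs) \<Longrightarrow> \<exists>B. p \<in> mspan V0 xs B"
proof (induction p rule: PV_induct)
  case (Const a)
  show ?case using mspan_const[of "Const a" V0 xs] by auto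
next
  case (Var v)
  thus ?case
  proof
    assume "v \<in> V0"
    thus ?thesis using mspan_const[of "Var v" V0 xs] by auto
  next
    assume "v \<in> set xs"
    then obtain e where "e \<in> expos (length xs) 1" "mprod (map Var xs) e = Var v" using mprod_Var by blast
    thus ?thesis using mspan_term[of 1 V0 e xs 1] by auto
  qed
next
  case (add p q)
  then obtain B B' where "p \<in> mspan V0 xs B" "q \<in> mspan V0 xs B'" by auto
  hence "p \<in> mspan V0 xs (B + B')" "q \<in> mspan V0 xs (B + B')"
    using mspan_mono[of p V0 xs B "B + B'"] mspan_mono[of q V0 xs B' "B + B'"] by auto
  thus ?case using mspan_add by blast
next
  case (mult p q)
  thus ?case using mspan_mult by blast
qed

lemma mspan_mprod:
  "(\<And>a. a \<in> set as \<Longrightarrow> a \<in> mspan V0 xs D) \<Longrightarrow> e \<in> expos (length as) K \<Longrightarrow> mprod as e \<in> mspan V0 xs (length as * (K * D))"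
proof (induction as arbitrary: e)
  case Nil
  show ?case using mspan_const[of 1 V0 xs] by simp
next
  case (Cons a as)
  from Cons.prems(2) obtain k e' where e: "e = k # e'" "k \<le> K" "e' \<in> expos (length as) K"
    by (auto simp: expos_def length_Suc_conv)
  have "a ^ k \<in> mspan V0 xs (K * D)"
    using e(2) Cons.prems(1)[of a] by (intro mspan_mono[OF mspan_power[of a _ _ D]]) auto
  moreover have "mprod as e' \<in> mspan V0 xs (length as * (K * D))"
    using Cons.IH[OF _ e(3)] Cons.prems(1) by simp
  ultimately show ?case using mspan_mult[of "a ^ k" V0 xs "K * D" "mprod as e'"] e(1) by simp
qed

text \<open>Linear dependence over the residue field of \<open>y\<close>, with denominators cleared.\<close>

lemma lin_dep_mod_prime:
  fixes v :: "'i \<Rightarrow> 'j \<Rightarrow> mpoly"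
  assumes y: "prime_idl V0 y" and "finite J" "finite I" "card J < card I" "\<And>i j. v i j \<in> PV V0"
  shows "\<exists>c. (\<forall>i. c i \<in> PV V0) \<and> (\<exists>i\<in>I. c i \<notin> y) \<and> (\<forall>j\<in>J. (\<Sum>i\<in>I. c i * v i j) \<in> y)"
  using assms(2-5)
proof (induction J arbitrary: I v rule: finite_induct)
  case empty
  hence "I \<noteq> {}" by auto
  thus ?case using prime_idlD(2)[OF y] by (intro exI[of _ "\<lambda>_. 1"]) auto
next
  case (insert j J)
  note yi = prime_idlD(1)[OF y]
  show ?case
  proof (cases "\<forall>i\<in>I. v i j \<in> y")
    case True
    have "card J < card I" using insert.hyps insert.prems by simp
    then obtain c where c: "\<forall>i. c i \<in> PV V0" "\<exists>i\<in>I. c i \<notin> y" "\<forall>j\<in>J. (\<Sum>i\<in>I. c i * v i j) \<in> y"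
      using insert.IH[of I v] insert.prems by auto
    have "(\<Sum>i\<in>I. c i * v i j) \<in> y" using True c(1) by (intro idl_sum[OF yi] idlD(4)[OF yi]) auto
    thus ?thesis using c by (intro exI[of _ c]) auto
  next
    case False
    then obtain m where m: "m \<in> I" "v m j \<notin> y" by auto
    define I' where "I' = I - {m}"
    \<comment> \<open>Fraction-free elimination of column \<open>j\<close> with the pivot
      \<open>v m j\<close>, which is non-zero modulo \<open>y\<close>.\<close>
    define w where "w = (\<lambda>i k. v m j * v i k - v i j * v m k)"
    have I': "finite I'" "card J < card I'" "I = insert m I'" "m \<notin> I'"
      using insert.hyps insert.prems m(1) by (auto simp: I'_def)
    obtain c where c: "\<forall>i. c i \<in> PV V0" "\<exists>i\<in>I'. c i \<notin> y" "\<forall>k\<in>J. (\<Sum>i\<in>I'. c i * w i k) \<in> y"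
      using insert.IH[OF I'(1,2), of w] insert.prems(3) by (auto simp: w_def)
    \<comment> \<open>A relation between the eliminated rows is turned back into one between the
      original rows; the coefficients outside the pivot row are multiplied by the pivot and stay
      outside the prime \<open>y\<close>.\<close>
    define c' where "c' = (\<lambda>i. if i = m then - (\<Sum>i\<in>I'. c i * v i j) else c i * v m j)"
    have sm: "(\<Sum>i\<in>I. c' i * v i k) = (\<Sum>i\<in>I'. c i * w i k)" for k
    proof -
      have "(\<Sum>i\<in>I. c' i * v i k) = c' m * v m k + (\<Sum>i\<in>I'. c' i * v i k)" using I' by simp
      also have "(\<Sum>i\<in>I'. c' i * v i k) = (\<Sum>i\<in>I'. c i * v m j * v i k)"
        using I'(4) by (intro sum.cong) (auto simp: c'_def)
      finally show ?thesis by (simp add: c'_def w_def sum_distrib_left sum_subtractf algebra_simps)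
    qed
    have w0: "w i j = 0" for i by (simp add: w_def)
    have "\<forall>k\<in>insert j J. (\<Sum>i\<in>I. c' i * v i k) \<in> y"
      unfolding sm using c(3) idlD(2)[OF yi] by (simp add: w0)
    moreover have "\<forall>i. c' i \<in> PV V0" using c(1) insert.prems(3) by (auto simp: c'_def intro!: PV_intros(8) PV_sum)
    moreover have "\<exists>i\<in>I. c' i \<notin> y"
    proof -
      obtain i where i: "i \<in> I'" "c i \<notin> y" using c(2) by blast
      have "c i * v m j \<notin> y" using prime_idlD(3)[OF y, of "c i" "v m j"] c(1) insert.prems(3) i(2) m(2) by blast
      thus ?thesis using i(1) I' by (intro bexI[of _ i]) (auto simp: c'_def)
    qed
    ultimately show ?thesis by (intro exI[of _ c']) simp
  qed
qed

text \<open>As functions of \<open>K\<close> the left side has degree \<open>k\<close> and the right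
  side degree \<open>Suc k\<close>; this value of \<open>K\<close> is already large enough for the
  right side to win.\<close>

lemma expo_count: "Suc (r * (K * D)) ^ k < Suc K ^ Suc k" if "K = Suc (r * D) ^ k"
proof -
  have "Suc (r * (K * D)) \<le> Suc (r * D) * Suc K" by (simp add: algebra_simps)
  hence "Suc (r * (K * D)) ^ k \<le> (Suc (r * D) * Suc K) ^ k" by (rule power_mono) simp
  also have "\<dots> = K * Suc K ^ k" by (simp only: power_mult_distrib that)
  also have "\<dots> < Suc K ^ Suc k" by simp
  finally show ?thesis .
qed

text \<open>One element more than there are variables forces algebraic dependence: the products of
  the \<open>as\<close> with exponents up to \<open>K\<close> outnumber the monomials in
  \<open>xs\<close> needed to write them, so linear algebra modulo \<open>y\<close> gives a
  non-trivial relation.\<close>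

lemma alg_dep:
  assumes y: "prime_idl V0 y" and as: "\<And>a. a \<in> set as \<Longrightarrow> a \<in> PV (V0 \<union> set xs)" "length as = Suc (length xs)"
    and Q: "idl V Q" "y \<subseteq> Q" "set xs \<subseteq> V"
  obtains E c where "finite E" "E \<subseteq> {e. length e = length as}" "\<And>e. c e \<in> PV V0" "\<exists>e\<in>E. c e \<notin> y"
    "(\<Sum>e\<in>E. c e * mprod as e) \<in> Q"
proof -
  have "\<exists>D. \<forall>a\<in>set as. a \<in> mspan V0 xs D" using as(1)
  proof (induction as)
    case (Cons a as)
    then obtain D B where D: "\<forall>a\<in>set as. a \<in> mspan V0 xs D" "a \<in> mspan V0 xs B"
      using mspan_ex[of a V0 xs] by auto
    have "b \<in> mspan V0 xs (D + B)" if "b \<in> set (a # as)" for b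
      using that D mspan_mono[of b V0 xs D "D + B"] mspan_mono[of b V0 xs B "D + B"] by auto
    thus ?case by blast
  qed simp
  then obtain D where D: "\<And>a. a \<in> set as \<Longrightarrow> a \<in> mspan V0 xs D" by blast
  define r where "r = length as"
  define K where "K = Suc (r * D) ^ length xs"
  define E where "E = expos (length as) K"
  define J where "J = expos (length xs) (r * (K * D))"
  have "\<forall>e\<in>E. \<exists>c. (\<forall>f. c f \<in> PV V0) \<and> mprod as e = (\<Sum>f\<in>J. c f * mprod (map Var xs) f)"
    using mspan_mprod[of as V0 xs D, OF D] by (auto simp: E_def J_def mspan_def r_def)
  then obtain v where v: "\<forall>e\<in>E. (\<forall>f. v e f \<in> PV V0) \<and> mprod as e = (\<Sum>f\<in>J. v e f * mprod (map Var xs) f)"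
    by metis
  \<comment> \<open>The linear dependence lemma asks for coefficients in \<open>PV V0\<close> at all
    indices; outside \<open>E\<close> the value 0 supplies them.\<close>
  define v' where "v' = (\<lambda>e f. if e \<in> E then v e f else 0)"
  have v': "v' e f \<in> PV V0" for e f using v by (auto simp: v'_def)
  have vE: "mprod as e = (\<Sum>f\<in>J. v' e f * mprod (map Var xs) f)" if "e \<in> E" for e using v that by (auto simp: v'_def)
  have "card J < card E"
    using expo_count[OF K_def] by (simp add: J_def E_def card_expos as(2))
  then obtain c where c: "\<forall>i. c i \<in> PV V0" "\<exists>i\<in>E. c i \<notin> y" "\<forall>j\<in>J. (\<Sum>i\<in>E. c i * v' i j) \<in> y"
    using lin_dep_mod_prime[OF y, of J E v'] v' by (auto simp: J_def E_def)
  have "(\<Sum>e\<in>E. c e * mprod as e) = (\<Sum>e\<in>E. \<Sum>f\<in>J. c e * v' e f * mprod (map Var xs) f)"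
    by (simp add: vE sum_distrib_left mult.assoc)
  also have "\<dots> = (\<Sum>f\<in>J. (\<Sum>e\<in>E. c e * v' e f) * mprod (map Var xs) f)"
    by (subst sum.swap) (simp add: sum_distrib_right)
  also have "\<dots> \<in> Q"
  proof (rule idl_sum[OF Q(1)])
    fix f assume "f \<in> J"
    hence "(\<Sum>e\<in>E. c e * v' e f) \<in> Q" using c(3) Q(2) by blast
    moreover have "mprod (map Var xs) f \<in> PV V" using Q(3) by (intro mprod_PV) auto
    ultimately show "(\<Sum>e\<in>E. c e * v' e f) * mprod (map Var xs) f \<in> Q" by (rule idlD(5)[OF Q(1)])
  qed
  finally show ?thesis using c by (intro that[of E c]) (auto simp: E_def expos_def[of "length as"] finite_lists_length_eq)
qed

text \<open>The lexicographically smallest monomial of a relation between elements climbing a chain of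
  primes can be factored out, one variable and one prime at a time.\<close>

lemma lex_chain:
  assumes "\<And>i. i \<le> length as \<Longrightarrow> prime_idl V (Q i)"
    "\<And>i. i < length as \<Longrightarrow> Q i \<subseteq> Q (Suc i) \<and> as ! i \<in> Q (Suc i) \<and> as ! i \<notin> Q i"
    "finite E" "E \<noteq> {}" "E \<subseteq> {e. length e = length as}" "\<And>e. c e \<in> PV V"
    "\<And>e. e \<in> E \<Longrightarrow> c e \<notin> Q (length as)" "(\<Sum>e\<in>E. c e * mprod as e) \<in> Q 0"
  shows False
  using assms
proof (induction as arbitrary: Q E c)
  case Nil
  hence "E = {[]}" by auto
  thus ?case using Nil.prems(7)[of "[]"] Nil.prems(8) by simp
next
  case (Cons a as)
  note P = Cons.prems
  define \<mu> where "\<mu> = Min (hd ` E)"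
  define E1 where "E1 = {e\<in>E. hd e = \<mu>}"
  define E2 where "E2 = {e\<in>E. hd e \<noteq> \<mu>}"
  define E' where "E' = tl ` E1"
  define s where "s = (\<Sum>e\<in>E2. c e * a ^ (hd e - Suc \<mu>) * mprod as (tl e))"
  define s1 where "s1 = (\<Sum>e\<in>E'. c (\<mu> # e) * mprod as e)"
  have Q0: "prime_idl V (Q 0)" and Q1: "prime_idl V (Q 1)" using P(1)[of 0] P(1)[of 1] by auto
  have aQ: "Q 0 \<subseteq> Q 1" "a \<in> Q 1" "a \<notin> Q 0" using P(2)[of 0] by auto
  have Qm: "b \<in> PV V" if "i < length (a # as)" "b \<in> Q (Suc i)" for b i
    using idlD(1)[OF prime_idlD(1)[OF P(1)[of "Suc i"]]] that by simp
  have asV: "b \<in> PV V" if "b \<in> set (a # as)" for b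
    using that P(2) Qm by (metis in_set_conv_nth)
  have E: "e = hd e # tl e" "length (tl e) = length as" if "e \<in> E" for e
    using P(5) that by (cases e; auto)+
  have ne: "E1 \<noteq> {}"
  proof -
    have "\<mu> \<in> hd ` E" unfolding \<mu>_def using P(3,4) by (intro Min_in) auto
    thus ?thesis by (auto simp: E1_def)
  qed
  have ge: "\<mu> < hd e" if "e \<in> E2" for e
  proof -
    have "\<mu> \<le> hd e" unfolding \<mu>_def using that P(3) by (intro Min_le) (auto simp: E2_def)
    thus ?thesis using that by (auto simp: E2_def)
  qed
  have mp: "mprod (a # as) e = a ^ hd e * mprod as (tl e)" if "e \<in> E" for e
    by (subst E(1)[OF that]) simp
  have inj: "inj_on tl E1"
  proof (rule inj_onI)
    fix e e' assume "e \<in> E1" "e' \<in> E1" "tl e = tl e'"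
    thus "e = e'" using E(1)[of e] E(1)[of e'] by (simp add: E1_def)
  qed
  have "(\<Sum>e\<in>E. c e * mprod (a # as) e) = (\<Sum>e\<in>E1. c e * mprod (a # as) e) + (\<Sum>e\<in>E2. c e * mprod (a # as) e)"
    unfolding E1_def E2_def using P(3) by (subst sum.union_disjoint[symmetric]) (auto intro!: sum.cong)
  also have "(\<Sum>e\<in>E1. c e * mprod (a # as) e) = a ^ \<mu> * s1"
  proof -
    have "s1 = (\<Sum>e\<in>E1. c (\<mu> # tl e) * mprod as (tl e))"
      unfolding s1_def E'_def by (simp add: sum.reindex[OF inj])
    moreover have "c e * mprod (a # as) e = a ^ \<mu> * (c (\<mu> # tl e) * mprod as (tl e))" if "e \<in> E1" for e
      using that E(1)[of e] mp[of e] by (simp add: E1_def ac_simps)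
    ultimately show ?thesis by (simp add: sum_distrib_left)
  qed
  also have "(\<Sum>e\<in>E2. c e * mprod (a # as) e) = a ^ \<mu> * (a * s)"
  proof -
    have "c e * mprod (a # as) e = a ^ \<mu> * (a * (c e * a ^ (hd e - Suc \<mu>) * mprod as (tl e)))" if "e \<in> E2" for e
    proof -
      have "a ^ hd e = a ^ \<mu> * (a * a ^ (hd e - Suc \<mu>))"
        using ge[OF that] by (simp flip: power_Suc power_add)
      thus ?thesis using mp[of e] that by (simp add: E2_def ac_simps)
    qed
    hence "(\<Sum>e\<in>E2. c e * mprod (a # as) e) = (\<Sum>e\<in>E2. a ^ \<mu> * (a * (c e * a ^ (hd e - Suc \<mu>) * mprod as (tl e))))"
      by (rule sum.cong[OF refl])
    thus ?thesis by (simp only: s_def sum_distrib_left)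
  qed
  finally have "a ^ \<mu> * (s1 + a * s) \<in> Q 0" using P(8) by (simp add: distrib_left)
  moreover have sV: "s1 \<in> PV V" "s \<in> PV V" "a \<in> PV V"
    using asV P(6) by (auto simp: s1_def s_def intro!: PV_sum PV_intros mprod_PV)
  \<comment> \<open>The power of \<open>a\<close> cancels because \<open>a\<close> is outside the
    prime \<open>Q 0\<close>. As \<open>a\<close> lies in \<open>Q 1\<close>, only the terms of
    minimal exponent survive there, and they form a relation in the remaining elements.\<close>
  ultimately have "s1 + a * s \<in> Q 0"
    using prime_idlD(3)[OF Q0, of "a ^ \<mu>" "s1 + a * s"] prime_idl_power[OF Q0, of a \<mu>] aQ(3) by auto
  hence "s1 + a * s \<in> Q 1" using aQ by blast
  moreover have "a * s \<in> Q 1" using aQ(2) sV by (intro idlD(5)[OF prime_idlD(1)[OF Q1]])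
  ultimately have "s1 \<in> Q 1" using idl_diff[OF prime_idlD(1)[OF Q1], of "s1 + a * s" "a * s"] by simp
  show False
  proof (rule Cons.IH[of "\<lambda>i. Q (Suc i)" E' "\<lambda>e. c (\<mu> # e)"])
    show "prime_idl V (Q (Suc i))" if "i \<le> length as" for i using P(1)[of "Suc i"] that by simp
    show "Q (Suc i) \<subseteq> Q (Suc (Suc i)) \<and> as ! i \<in> Q (Suc (Suc i)) \<and> as ! i \<notin> Q (Suc i)" if "i < length as" for i
      using P(2)[of "Suc i"] that by simp
    show "finite E'" "E' \<noteq> {}" using P(3) ne by (auto simp: E'_def E1_def)
    show "E' \<subseteq> {e. length e = length as}" using E by (auto simp: E'_def E1_def)
    show "c (\<mu> # e) \<in> PV V" for e by (rule P(6))
    show "c (\<mu> # e) \<notin> Q (Suc (length as))" if eE: "e \<in> E'" for e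
    proof -
      obtain e1 where e1: "e1 \<in> E" "hd e1 = \<mu>" "e = tl e1" using eE by (auto simp: E'_def E1_def)
      hence "\<mu> # e = e1" using E(1)[OF e1(1)] by simp
      thus ?thesis using P(7)[OF e1(1)] by simp
    qed
    show "(\<Sum>e\<in>E'. c (\<mu> # e) * mprod as e) \<in> Q (Suc 0)" using \<open>s1 \<in> Q 1\<close> by (simp add: s1_def)
  qed
qed

lemma chain_mono:
  assumes "\<And>i. i < d \<Longrightarrow> Q i \<subset> Q (Suc i)" "i \<le> j" "j \<le> d"
  shows "Q i \<subseteq> Q j"
  using assms(2,3)
proof (induction j rule: dec_induct)
  case (step j)
  thus ?case using assms(1)[of j] by auto
qed simp

text \<open>A longer chain yields \<open>length xs + 1\<close> elements, each entering at its own
  step, and by \<open>alg_dep\<close> a relation between them. Since the top prime meets the base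
  ring inside \<open>y\<close>, coefficients outside \<open>y\<close> are outside every prime of the
  chain, contradicting \<open>lex_chain\<close>.\<close>

lemma chain_le:
  assumes g: "gdata V U f" and V: "V - U = V0 \<union> set xs" and y: "prime_idl V0 y"
    and Q: "\<And>i. i \<le> d \<Longrightarrow> prime_idl V (Q i)" "\<And>i. i < d \<Longrightarrow> Q i \<subset> Q (Suc i)"
    and Q0: "geq f ` U \<subseteq> Q 0" "y \<subseteq> Q 0" and Qd: "Q d \<inter> PV V0 \<subseteq> y"
  shows "d \<le> length xs"
proof (rule ccontr)
  assume "\<not> d \<le> length xs"
  define r where "r = length xs"
  have d: "r < d" using \<open>\<not> d \<le> length xs\<close> by (simp add: r_def)
  have mono: "i \<le> j \<Longrightarrow> j \<le> d \<Longrightarrow> Q i \<subseteq> Q j" for i j by (rule chain_mono[where Q = Q and d = d, OF Q(2)])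
  \<comment> \<open>The denominators are units modulo the equations, so the element separating two
    consecutive primes can be chosen in the free coordinates.\<close>
  have "\<exists>q. q \<in> PV (V - U) \<and> q \<in> Q (Suc i) \<and> q \<notin> Q i" if i: "i < d" for i
  proof -
    obtain a where a: "a \<in> Q (Suc i)" "a \<notin> Q i" using Q(2)[OF i] by blast
    have Pi: "idl V (Q i)" "idl V (Q (Suc i))" using prime_idlD(1)[OF Q(1)] i by auto
    have aV: "a \<in> PV V" using idlD(1)[OF Pi(2) a(1)] .
    obtain n q where q: "q \<in> PV (V - U)" "gprod U f ^ n * a - q \<in> gen V (geq f ` U)"
      by (rule graph_reduce[OF g aV])
    have sub: "geq f ` U \<subseteq> Q j" if "j \<le> d" for j using Q0(1) mono[of 0 j] that by blast
    have "gen V (geq f ` U) \<subseteq> Q i" "gen V (geq f ` U) \<subseteq> Q (Suc i)"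
      using i by (intro gen_least Pi sub; simp)+
    hence eq: "gprod U f ^ n * a \<in> Q i \<longleftrightarrow> q \<in> Q i" "gprod U f ^ n * a \<in> Q (Suc i) \<longleftrightarrow> q \<in> Q (Suc i)"
      using q(2) by (intro idl_cancel[OF Pi(1)] idl_cancel[OF Pi(2)]; blast)+
    have "gprod U f ^ n * a \<in> Q (Suc i)" using a(1) gdataD(7)[OF g] by (intro idlD(4)[OF Pi(2)]) auto
    moreover have "gprod U f ^ n * a \<notin> Q i"
      using gprod_power_cancel[OF g Pi(1) sub aV, of n] a(2) i by auto
    ultimately show ?thesis using eq q(1) by blast
  qed
  then obtain a where a: "\<And>i. i < d \<Longrightarrow> a i \<in> PV (V - U) \<and> a i \<in> Q (Suc i) \<and> a i \<notin> Q i" by metis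
  define as where "as = map a [0..<Suc r]"
  have las: "length as = Suc (length xs)" by (simp add: as_def r_def)
  have asV: "b \<in> PV (V0 \<union> set xs)" if "b \<in> set as" for b
  proof -
    obtain i where "i < Suc r" "b = a i" using \<open>b \<in> set as\<close> by (auto simp: as_def simp del: upt_Suc)
    thus ?thesis using a[of i] d V by simp
  qed
  have xsV: "set xs \<subseteq> V" "V0 \<subseteq> V" using V by auto
  obtain E c where E: "finite E" "E \<subseteq> {e. length e = length as}" "\<And>e. c e \<in> PV V0" "\<exists>e\<in>E. c e \<notin> y"
    "(\<Sum>e\<in>E. c e * mprod as e) \<in> Q 0"
    using alg_dep[OF y asV las prime_idlD(1)[OF Q(1)[of 0]] Q0(2) xsV(1)] by auto
  define E' where "E' = {e\<in>E. c e \<notin> y}"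
  have cV: "c e \<in> PV V" for e using PV_mono[OF xsV(2) E(3)] .
  show False
  proof (rule lex_chain[of as V Q E' c])
    show "prime_idl V (Q i)" if "i \<le> length as" for i using that d las by (intro Q(1)) (simp add: r_def)
    show "Q i \<subseteq> Q (Suc i) \<and> as ! i \<in> Q (Suc i) \<and> as ! i \<notin> Q i" if "i < length as" for i
    proof -
      have "i < Suc r" using that las by (simp add: r_def)
      hence "as ! i = a i" "i < d" using d by (auto simp: as_def simp del: upt_Suc)
      thus ?thesis using a[of i] Q(2)[of i] by auto
    qed
    show "finite E'" "E' \<noteq> {}" "E' \<subseteq> {e. length e = length as}" using E by (auto simp: E'_def)
    show "c e \<in> PV V" for e by (rule cV)
    show "c e \<notin> Q (length as)" if "e \<in> E'" for e
    proof
      assume "c e \<in> Q (length as)"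
      hence "c e \<in> Q d" using mono[of "length as" d] d las by (auto simp: r_def)
      thus False using Qd E(3)[of e] that by (auto simp: E'_def)
    qed
    have Q00: "idl V (Q 0)" using prime_idlD(1)[OF Q(1)[of 0]] by simp
    \<comment> \<open>Terms with coefficient in \<open>y\<close> already lie in \<open>Q 0\<close>
      and can be removed from the relation.\<close>
    have "(\<Sum>e\<in>E - E'. c e * mprod as e) \<in> Q 0"
    proof (rule idl_sum[OF Q00])
      fix e assume "e \<in> E - E'"
      hence "c e \<in> Q 0" using Q0(2) by (auto simp: E'_def)
      moreover have "mprod as e \<in> PV V"
        using asV PV_mono[of "V0 \<union> set xs" V] xsV by (intro mprod_PV) auto
      ultimately show "c e * mprod as e \<in> Q 0" by (rule idlD(5)[OF Q00])
    qed
    moreover have "(\<Sum>e\<in>E. c e * mprod as e) = (\<Sum>e\<in>E - E'. c e * mprod as e) + (\<Sum>e\<in>E'. c e * mprod as e)"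
      using E(1) by (intro sum.subset_diff) (auto simp: E'_def)
    ultimately show "(\<Sum>e\<in>E'. c e * mprod as e) \<in> Q 0"
      using E(5) idl_diff[OF Q00, of "\<Sum>e\<in>E. c e * mprod as e" "\<Sum>e\<in>E - E'. c e * mprod as e"] by simp
  qed
qed

lemma krull_dim_le:
  assumes "\<And>d c. (\<And>i. i \<le> d \<Longrightarrow> c i \<in> W) \<Longrightarrow> (\<And>i. i < d \<Longrightarrow> c i \<subset> c (Suc i)) \<Longrightarrow> d \<le> r"
  shows "krull_dim W \<le> enat r"
  unfolding krull_dim_def
proof (rule SUP_least)
  fix d assume "d \<in> {d. \<exists>c. (\<forall>i\<le>d. c i \<in> W) \<and> (\<forall>i<d. c i \<subset> c (Suc i))}"
  then obtain c where "\<forall>i\<le>d. c i \<in> W" "\<forall>i<d. c i \<subset> c (Suc i)" unfolding mem_Collect_eq by (elim exE conjE)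
  thus "enat d \<le> enat r" using assms[of d c] by simp
qed

lemma krull_dim_ge:
  assumes "\<And>i. i \<le> d \<Longrightarrow> c i \<in> W" "\<And>i. i < d \<Longrightarrow> c i \<subset> c (Suc i)"
  shows "enat d \<le> krull_dim W"
  unfolding krull_dim_def
proof (rule SUP_upper)
  show "d \<in> {d. \<exists>c. (\<forall>i\<le>d. c i \<in> W) \<and> (\<forall>i<d. c i \<subset> c (Suc i))}"
    unfolding mem_Collect_eq by (rule exI[of _ c]) (use assms in simp)
qed

section \<open>Points of the affine line\<close>

lemma poly_ideal_generator:
  fixes I :: "rat poly set"
  assumes add: "\<And>p q. p \<in> I \<Longrightarrow> q \<in> I \<Longrightarrow> p + q \<in> I" and mult: "\<And>p q. q \<in> I \<Longrightarrow> p * q \<in> I"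
    and nz: "q0 \<in> I" "q0 \<noteq> 0"
  obtains g where "g \<in> I" "g \<noteq> 0" "\<And>q. q \<in> I \<Longrightarrow> g dvd q"
proof -
  define g where "g = arg_min degree (\<lambda>q. q \<in> I \<and> q \<noteq> 0)"
  have g: "g \<in> I" "g \<noteq> 0" and least: "\<And>q. q \<in> I \<Longrightarrow> q \<noteq> 0 \<Longrightarrow> degree g \<le> degree q"
    using arg_min_nat_lemma[of "\<lambda>q. q \<in> I \<and> q \<noteq> 0" q0 degree] nz by (auto simp: g_def)
  have "g dvd q" if "q \<in> I" for q
  proof (rule ccontr)
    assume "\<not> g dvd q"
    hence nz: "q mod g \<noteq> 0" by (simp add: dvd_eq_mod_eq_0)
    have "q + (- (q div g)) * g \<in> I" using that g(1) by (intro add mult)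
    also have "q + (- (q div g)) * g = q mod g" by (simp add: minus_mult_div_eq_mod[symmetric] mult.commute)
    finally have "degree g \<le> degree (q mod g)" using nz by (rule least)
    moreover have "degree (q mod g) < degree g" using degree_mod_less[OF g(2), of q] nz by auto
    ultimately show False by simp
  qed
  thus ?thesis using that g by blast
qed

lemma hom_poly_eval:
  assumes c: "hom_on c"
  shows "hom_on (\<lambda>q. poly (map_poly c q) x)"
proof -
  have 0: "c 0 = 0" by (rule hom_on_0[OF c])
  have add: "map_poly c (p + q) = map_poly c p + map_poly c q" for p q
    by (rule poly_eqI) (simp add: coeff_map_poly 0 hom_on_add[OF c])
  have sm: "map_poly c (smult a p) = smult (c a) (map_poly c p)" for a p
    by (rule poly_eqI) (simp add: coeff_map_poly 0 hom_on_mult[OF c])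
  have pc: "map_poly c (pCons a p) = pCons (c a) (map_poly c p)" for a p
    by (rule map_poly_pCons) (rule 0)
  have "map_poly c (p * q) = map_poly c p * map_poly c q" for p q
    by (induction p) (simp_all add: add sm pc 0)
  moreover have "map_poly c 1 = 1"
    by (simp add: hom_on_1[OF c] map_poly_1')
  ultimately show ?thesis by (simp add: hom_on_def add)
qed

abbreviation t0 :: coord where "t0 \<equiv> Base 0"

text \<open>Makes Euclidean division available on \<open>PV {t0}\<close>. Every variable goes to the
  indeterminate, so injectivity is claimed on \<open>PV {t0}\<close> only.\<close>

definition to_poly :: "mpoly \<Rightarrow> rat poly" where
  "to_poly = ev (\<lambda>a. [:a:]) (\<lambda>_. [:0, 1:])"

lemma hom_pconst: "hom_on (\<lambda>a::rat. [:a:])"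
  by (simp add: hom_on_def one_pCons)

lemma hom_to_poly: "hom_on to_poly"
  unfolding to_poly_def by (rule hom_ev[OF hom_pconst])

lemma to_poly_eval:
  fixes x :: "'b::comm_ring_1"
  assumes c: "hom_on c" and p: "p \<in> PV {t0}"
  shows "poly (map_poly c (to_poly p)) x = ev c (\<lambda>_. x) p"
proof (rule hom_eqI[OF hom_on_comp[OF hom_poly_eval[OF c] hom_to_poly] hom_ev[OF c]])
  show "poly (map_poly c (to_poly (Const a))) x = ev c (\<lambda>_. x) (Const a)" for a
    by (simp add: to_poly_def hom_pconst c map_poly_pCons hom_on_0[OF c])
  show "poly (map_poly c (to_poly (Var v))) x = ev c (\<lambda>_. x) (Var v)" for v
    by (simp add: to_poly_def hom_pconst c map_poly_pCons hom_on_0[OF c] hom_on_1[OF c])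
qed

lemma to_poly_surj: "\<exists>p\<in>PV {t0}. to_poly p = q"
proof (induction q)
  case (pCons a q)
  then obtain p where p: "p \<in> PV {t0}" "to_poly p = q" by auto
  have "to_poly (Const a + Var t0 * p) = pCons a q"
    using p(2) by (simp add: hom_on_simps[OF hom_to_poly]) (simp add: to_poly_def hom_pconst)
  thus ?case using p(1) by (intro bexI[of _ "Const a + Var t0 * p"]) auto
qed (auto intro!: bexI[of _ 0] simp: hom_on_0[OF hom_to_poly])

lemma to_poly_inj:
  assumes "p \<in> PV {t0}" "q \<in> PV {t0}" "to_poly p = to_poly q"
  shows "p = q"
proof -
  have "poly (map_poly Const (to_poly p)) (Var t0) = p" if "p \<in> PV {t0}" for p
  proof -
    have "ev Const (\<lambda>_. Var t0) p = subst Var p"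
      unfolding subst_ev by (rule hom_eqI[OF hom_ev hom_ev]) (use that in \<open>auto simp: hom_Const PV_def\<close>)
    thus ?thesis using to_poly_eval[OF hom_Const that] by simp
  qed
  thus ?thesis using assms by metis
qed

text \<open>A non-zero prime of the affine line is the vanishing ideal of a complex root of its
  generator; this embeds the residue field into the complex numbers.\<close>

lemma point_root:
  assumes y: "prime_idl {t0} y" and nz: "y \<noteq> {0}"
  obtains \<alpha> :: complex where "y = {p\<in>PV {t0}. ev of_rat (\<lambda>_. \<alpha>) p = 0}"
proof -
  note yi = idlD[OF prime_idlD(1)[OF y]]
  define I where "I = to_poly ` y"
  have I: "to_poly p \<in> I \<longleftrightarrow> p \<in> y" if "p \<in> PV {t0}" for p
  proof
    assume "to_poly p \<in> I"
    then obtain p' where "p' \<in> y" "to_poly p = to_poly p'" by (auto simp: I_def)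
    thus "p \<in> y" using to_poly_inj[OF that, of p'] yi(1)[of p'] by simp
  qed (auto simp: I_def)
  have Iadd: "p + q \<in> I" if pq: "p \<in> I" "q \<in> I" for p q
  proof -
    obtain p' q' where "p' \<in> y" "p = to_poly p'" "q' \<in> y" "q = to_poly q'" using pq by (auto simp: I_def)
    thus ?thesis using yi(3)[of p' q'] by (auto simp: I_def hom_on_add[OF hom_to_poly, symmetric])
  qed
  have Imult: "p * q \<in> I" if q: "q \<in> I" for p q
  proof -
    obtain q' where "q' \<in> y" "q = to_poly q'" using q by (auto simp: I_def)
    moreover obtain p' where "p' \<in> PV {t0}" "to_poly p' = p" using to_poly_surj by blast
    ultimately show ?thesis using yi(4)[of p' q'] by (auto simp: I_def hom_on_mult[OF hom_to_poly, symmetric])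
  qed
  obtain p0 where p0: "p0 \<in> y" "p0 \<noteq> 0" using nz yi(2) by blast
  have "to_poly p0 \<noteq> 0" using to_poly_inj[of p0 0] p0 yi(1)[of p0] by (auto simp: hom_on_0[OF hom_to_poly])
  then obtain g where g: "g \<in> I" "g \<noteq> 0" "\<And>q. q \<in> I \<Longrightarrow> g dvd q"
    using poly_ideal_generator[of I "to_poly p0", OF Iadd Imult] p0(1) by (auto simp: I_def)
  have one: "1 \<notin> I" using I[of 1] prime_idlD(2)[OF y] by (simp add: hom_on_1[OF hom_to_poly])
  have deg: "degree g \<noteq> 0"
  proof
    assume "degree g = 0"
    then obtain c where c: "g = [:c:]" by (rule degree_eq_zeroE)
    have "[:1 / c:] * g \<in> I" by (rule Imult[OF g(1)])
    thus False using one g(2) by (simp add: c one_pCons)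
  qed
  have hc: "hom_on (of_rat :: rat \<Rightarrow> complex)" by (simp add: hom_on_def of_rat_add of_rat_mult)
  have "degree (map_poly (of_rat :: rat \<Rightarrow> complex) g) = degree g" by (rule degree_map_poly) simp
  hence "\<not> constant (poly (map_poly (of_rat :: rat \<Rightarrow> complex) g))" using deg by (simp add: constant_degree)
  then obtain \<alpha> :: complex where \<alpha>: "poly (map_poly of_rat g) \<alpha> = 0"
    using fundamental_theorem_of_algebra by blast
  define E where "E = (\<lambda>q. poly (map_poly of_rat q) \<alpha>)"
  have hE: "hom_on E" unfolding E_def by (rule hom_poly_eval[OF hc])
  have Eev: "E (to_poly p) = ev of_rat (\<lambda>_. \<alpha>) p" if "p \<in> PV {t0}" for p
    unfolding E_def by (rule to_poly_eval[OF hc that])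
  have "E g = 0" using \<alpha> by (simp add: E_def)
  \<comment> \<open>A minimal polynomial of \<open>\<alpha>\<close>. It divides \<open>g\<close>,
    and primality of \<open>y\<close> will place it in \<open>I\<close>.\<close>
  obtain m where m: "E m = 0" "m \<noteq> 0" "\<And>q. E q = 0 \<Longrightarrow> m dvd q"
    using poly_ideal_generator[of "{q. E q = 0}" g] g(2) \<open>E g = 0\<close> by (auto simp: hom_on_simps[OF hE])
  have "p \<in> y \<longleftrightarrow> ev of_rat (\<lambda>_. \<alpha>) p = 0" if p: "p \<in> PV {t0}" for p
  proof
    assume "p \<in> y"
    hence "g dvd to_poly p" using g(3) by (auto simp: I_def)
    then obtain s where "to_poly p = g * s" by (rule dvdE)
    hence "E (to_poly p) = 0" using \<open>E g = 0\<close> by (simp add: hom_on_simps[OF hE])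
    thus "ev of_rat (\<lambda>_. \<alpha>) p = 0" using Eev[OF p] by simp
  next
    assume "ev of_rat (\<lambda>_. \<alpha>) p = 0"
    hence "m dvd to_poly p" using Eev[OF p] m(3) by simp
    moreover have "m \<in> I"
    proof -
      obtain s where s: "g = m * s" using m(3)[OF \<open>E g = 0\<close>] by (rule dvdE)
      obtain m' s' where ms: "m' \<in> PV {t0}" "to_poly m' = m" "s' \<in> PV {t0}" "to_poly s' = s"
        using to_poly_surj by metis
      have "to_poly (m' * s') \<in> I" using ms g(1) s by (simp add: hom_on_mult[OF hom_to_poly])
      hence "m' * s' \<in> y" using I[of "m' * s'"] ms by simp
      hence "m' \<in> y \<or> s' \<in> y" using prime_idlD(3)[OF y ms(1,3)] by simp
      \<comment> \<open>If the cofactor \<open>s\<close> were in the ideal, \<open>g\<close> would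
        divide it and \<open>m\<close> would be a non-zero constant with a root.\<close>
      moreover have "s' \<notin> y"
      proof
        assume "s' \<in> y"
        hence "g dvd s" using g(3)[of s] ms(4) by (auto simp: I_def)
        moreover have "s \<noteq> 0" using s g(2) by auto
        ultimately have "degree g \<le> degree s" by (rule dvd_imp_degree_le)
        hence "degree m = 0" using s \<open>s \<noteq> 0\<close> m(2) by (simp add: degree_mult_eq)
        then obtain c where c: "m = [:c:]" by (rule degree_eq_zeroE)
        thus False using m(1,2) by (simp add: E_def map_poly_pCons)
      qed
      ultimately show ?thesis using I[OF ms(1)] ms(2) by simp
    qed
    ultimately have "to_poly p \<in> I" using Imult[of m] by (metis dvdE mult.commute)
    thus "p \<in> y" using I[OF p] by simp
  qed
  hence "y = {p\<in>PV {t0}. ev of_rat (\<lambda>_. \<alpha>) p = 0}" using yi(1) by blast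
  thus ?thesis by (rule that)
qed

section \<open>Dimension of the fibers of a graph\<close>

lemma hom_inj: "hom_on (c :: 'k::field \<Rightarrow> 'b::comm_ring_1) \<Longrightarrow> (1::'b) \<noteq> 0 \<Longrightarrow> c a = c b \<longleftrightarrow> a = b"
proof
  assume c: "hom_on c" "(1::'b) \<noteq> 0" and "c a = c b"
  hence *: "c (a - b) = 0" by (simp add: hom_on_diff)
  show "a = b"
  proof (rule ccontr)
    assume "a \<noteq> b"
    hence "c ((a - b) * inverse (a - b)) = 1" by (simp add: hom_on_1[OF c(1)])
    thus False using * c by (simp add: hom_on_mult)
  qed
qed simp

type_synonym 'k pl = "(coord \<Rightarrow>\<^sub>0 nat) \<Rightarrow>\<^sub>0 'k"

text \<open>The prescribed values are rational, so that the condition \<open>x = cc x\<close> is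
  itself a polynomial over \<open>rat\<close> and can tell two primes apart.\<close>

definition spec :: "(rat \<Rightarrow> 'k::field) \<Rightarrow> (coord \<Rightarrow> rat) \<Rightarrow> coord set \<Rightarrow> coord \<Rightarrow> 'k pl" where
  "spec \<kappa> cc A x = (if x \<in> A then cst (\<kappa> (cc x)) else vr x)"

lemma pl_hom_eqI:
  fixes h h' :: "'k::comm_ring_1 pl \<Rightarrow> 'b::comm_ring_1"
  assumes "hom_on h" "hom_on h'" "\<And>a. h (cst a) = h' (cst a)" "\<And>v. h (vr v) = h' (vr v)"
  shows "h p = h' p"
  using hom_eq_ev[OF assms(1), of p] hom_eq_ev[OF assms(2), of p] assms(3,4) by simp

text \<open>Read as a polynomial in \<open>v\<close> over the domain of polynomials in the other
  variables, \<open>G\<close> has finitely many roots, while the rationals embed as infinitely many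
  values.\<close>

lemma specialise_one:
  fixes G :: "'k::field pl"
  assumes \<kappa>: "hom_on (\<kappa> :: rat \<Rightarrow> 'k)" and G: "G \<noteq> 0"
  shows "\<exists>a. ev cst (vr(v := cst (\<kappa> a))) G \<noteq> 0"
proof -
  define T where "T = ev (\<lambda>k. [:cst k:] :: 'k pl poly) (\<lambda>x. if x = v then [:0, 1:] else [:vr x:])"
  have hc: "hom_on (\<lambda>k. [:cst k:] :: 'k pl poly)"
    by (simp add: hom_on_def hom_on_1[OF hom_cst] hom_on_add[OF hom_cst] hom_on_mult[OF hom_cst] one_pCons)
  have hT: "hom_on T" unfolding T_def by (rule hom_ev[OF hc])
  have hp: "hom_on (\<lambda>q. poly q z)" for z :: "'k pl" by (simp add: hom_on_def)
  have eval: "poly (T G) z = ev cst (vr(v := z)) G" for z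
    by (rule pl_hom_eqI[OF hom_on_comp[OF hp hT] hom_ev[OF hom_cst]])
       (auto simp: T_def hc hom_cst)
  have "T G \<noteq> 0"
  proof
    assume "T G = 0"
    hence "ev cst (vr(v := vr v)) G = 0" using eval[of "vr v"] by simp
    thus False using G by (simp add: ev_cst_vr)
  qed
  hence "finite {z. poly (T G) z = 0}" by (rule poly_roots_finite)
  moreover have "infinite (range (\<lambda>a. cst (\<kappa> a) :: 'k pl))"
  proof
    assume "finite (range (\<lambda>a. cst (\<kappa> a) :: 'k pl))"
    moreover have "inj (\<lambda>a. cst (\<kappa> a) :: 'k pl)" by (rule injI) (simp add: hom_inj[OF \<kappa>])
    ultimately have "finite (UNIV :: rat set)" by (rule finite_imageD)
    thus False using infinite_UNIV_char_0 by blast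
  qed
  ultimately obtain a where "poly (T G) (cst (\<kappa> a)) \<noteq> 0" by (metis (mono_tags, lifting) finite_subset image_subsetI mem_Collect_eq)
  thus ?thesis using eval by auto
qed

lemma specialise:
  fixes G :: "'k::field pl"
  assumes \<kappa>: "hom_on (\<kappa> :: rat \<Rightarrow> 'k)" and "G \<noteq> 0" "finite A"
  shows "\<exists>cc. ev cst (spec \<kappa> cc A) G \<noteq> 0"
  using assms(3,2)
proof (induction A arbitrary: G rule: finite_induct)
  case empty
  have "spec \<kappa> cc {} = vr" for cc by (auto simp: spec_def)
  thus ?case using empty by (simp add: ev_cst_vr)
next
  case (insert v A)
  obtain a where a: "ev cst (vr(v := cst (\<kappa> a))) G \<noteq> 0" using specialise_one[OF \<kappa> insert.prems] by blast
  then obtain cc where cc: "ev cst (spec \<kappa> cc A) (ev cst (vr(v := cst (\<kappa> a))) G) \<noteq> 0"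
    using insert.IH by blast
  have "ev cst (spec \<kappa> cc A) (ev cst (vr(v := cst (\<kappa> a))) G) = ev cst (spec \<kappa> (cc(v := a)) (insert v A)) G"
    by (rule pl_hom_eqI[OF hom_on_comp[OF hom_ev[OF hom_cst] hom_ev[OF hom_cst]] hom_ev[OF hom_cst]])
       (use insert.hyps in \<open>auto simp: hom_cst spec_def\<close>)
  thus ?case using cc by metis
qed

fun mexp :: "coord list \<Rightarrow> nat list \<Rightarrow> (coord \<Rightarrow>\<^sub>0 nat)" where
  "mexp (x # xs) (k # e) = Poly_Mapping.single x k + mexp xs e"
| "mexp _ _ = 0"

lemma mprod_vr: "mprod (map vr xs) e = (Poly_Mapping.single (mexp xs e) 1 :: 'k::comm_ring_1 pl)"
  by (induction xs e rule: mexp.induct) (auto simp: vr_power mult_single)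

lemma lk_mexp_notin: "x \<notin> set xs \<Longrightarrow> lk (mexp xs e) x = 0"
  by (induction xs e rule: mexp.induct) (auto simp: lookup_add lookup_single when_def)

lemma mexp_inj: "distinct xs \<Longrightarrow> length e = length xs \<Longrightarrow> length e' = length xs \<Longrightarrow> mexp xs e = mexp xs e' \<Longrightarrow> e = e'"
proof (induction xs arbitrary: e e')
  case (Cons x xs)
  obtain k f k' f' where e: "e = k # f" "e' = k' # f'" "length f = length xs" "length f' = length xs"
    using Cons.prems(2,3) by (auto simp: length_Suc_conv)
  have "k = k'"
    using arg_cong[OF Cons.prems(4), of "\<lambda>m. lk m x"] Cons.prems(1) by (simp add: e lookup_add lk_mexp_notin)
  moreover have "f = f'" using Cons.IH[of f f'] Cons.prems e \<open>k = k'\<close> by simp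
  ultimately show ?case by (simp add: e)
qed simp

text \<open>Expand \<open>q\<close> in the variables \<open>xs\<close>: its image at
  \<open>t = \<alpha>\<close> vanishes only if every coefficient, a polynomial in \<open>t\<close>,
  vanishes at \<open>\<alpha>\<close>. These coefficients then belong to \<open>y\<close>, hence to
  \<open>Q\<close>.\<close>

lemma generic_fiber_zero:
  fixes \<kappa> :: "rat \<Rightarrow> 'k::field"
  assumes \<kappa>: "hom_on \<kappa>" and xs: "distinct xs" "t0 \<notin> set xs" "set xs \<subseteq> V"
    and y: "y = {p\<in>PV {t0}. ev \<kappa> (\<lambda>_. \<alpha>) p = 0}" and Q: "idl V Q" "y \<subseteq> Q"
    and q: "q \<in> PV (insert t0 (set xs))" "ev (\<lambda>a. cst (\<kappa> a)) (vr(t0 := cst \<alpha>)) q = 0"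
  shows "q \<in> Q"
proof -
  let ?h = "ev (\<lambda>a. cst (\<kappa> a)) (vr(t0 := cst \<alpha>)) :: mpoly \<Rightarrow> 'k pl"
  have hc: "hom_on (\<lambda>a. cst (\<kappa> a) :: 'k pl)" by (rule hom_on_comp[OF hom_cst \<kappa>])
  have h: "hom_on ?h" by (rule hom_ev[OF hc])
  obtain B where "q \<in> mspan {t0} xs B" using mspan_ex[of q "{t0}" xs] q(1) by auto
  then obtain c where c: "\<And>e. c e \<in> PV {t0}" "q = (\<Sum>e\<in>expos (length xs) B. c e * mprod (map Var xs) e)"
    unfolding mspan_def by auto
  have hce: "?h p = cst (ev \<kappa> (\<lambda>_. \<alpha>) p)" if "p \<in> PV {t0}" for p
    by (rule hom_eqI[OF h hom_on_comp[OF hom_cst hom_ev[OF \<kappa>]]]) (use that in \<open>auto simp: hc \<kappa> PV_def\<close>)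
  have hm: "?h (mprod (map Var xs) e) = mprod (map vr xs) e" for e
  proof -
    have "?h (mprod (map Var zs) e) = mprod (map vr zs) e" if "t0 \<notin> set zs" for zs
      using that by (induction zs e rule: mexp.induct) (auto simp: hom_on_simps[OF h] hc)
    thus ?thesis using xs(2) by blast
  qed
  have "(\<Sum>e\<in>expos (length xs) B. Poly_Mapping.single (mexp xs e) (ev \<kappa> (\<lambda>_. \<alpha>) (c e))) = 0"
  proof -
    have "?h q = (\<Sum>e\<in>expos (length xs) B. Poly_Mapping.single (mexp xs e) (ev \<kappa> (\<lambda>_. \<alpha>) (c e)))"
      unfolding c(2) hom_on_sum[OF h]
      by (intro sum.cong refl) (simp add: hom_on_mult[OF h] hce[OF c(1)] hm mprod_vr, simp add: cst_def mult_single)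
    thus ?thesis using q(2) by simp
  qed
  hence z: "(\<Sum>e\<in>expos (length xs) B. lk (Poly_Mapping.single (mexp xs e) (ev \<kappa> (\<lambda>_. \<alpha>) (c e))) m) = 0" for m
    by (simp flip: lookup_sum)
  have "c e \<in> y" if e: "e \<in> expos (length xs) B" for e
  proof -
    have "(\<Sum>e'\<in>expos (length xs) B. lk (Poly_Mapping.single (mexp xs e') (ev \<kappa> (\<lambda>_. \<alpha>) (c e'))) (mexp xs e))
        = (\<Sum>e'\<in>expos (length xs) B. if e' = e then ev \<kappa> (\<lambda>_. \<alpha>) (c e') else 0)"
      using mexp_inj[OF xs(1)] e by (intro sum.cong) (auto simp: lookup_single when_def expos_def)
    also have "\<dots> = ev \<kappa> (\<lambda>_. \<alpha>) (c e)" using e by simp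
    finally show ?thesis using z[of "mexp xs e"] c(1) by (simp add: y)
  qed
  thus ?thesis unfolding c(2)
    using Q xs(3) by (intro idl_sum[OF Q(1)] idlD(5)[OF Q(1)] mprod_PV) auto
qed

text \<open>With \<open>A\<close> empty this is the generic point of the fiber over
  \<open>t = \<alpha>\<close>; enlarging \<open>A\<close> gives the successive members of the chain
  of primes.\<close>

definition fib_psi :: "(rat \<Rightarrow> 'k::field) \<Rightarrow> 'k \<Rightarrow> (coord \<Rightarrow> rat) \<Rightarrow> coord set \<Rightarrow> coord \<Rightarrow> 'k pl" where
  "fib_psi \<kappa> \<alpha> cc A = (spec \<kappa> cc A)(t0 := cst \<alpha>)"

context
  fixes V U f xs S n and \<kappa> :: "rat \<Rightarrow> 'k::field" and \<alpha> :: 'k and y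
  assumes V: "V = cs 1 n" and g: "gdata V U f" and Ut: "t0 \<notin> U"
    and xs: "distinct xs" "set xs = V - U - {t0}"
    and \<kappa>: "hom_on \<kappa>" and y: "y = {p\<in>PV {t0}. ev \<kappa> (\<lambda>_. \<alpha>) p = 0}" "y \<in> points S 1 0"
begin

abbreviation "cc0 \<equiv> (\<lambda>a. cst (\<kappa> a) :: 'k pl)"

abbreviation "graph_pts \<equiv> {Q\<in>points S 1 n. geq f ` U \<subseteq> Q}"

lemma fib_facts:
  shows "hom_on cc0" "t0 \<in> V" "V - U = insert t0 (set xs)" "V - U = {t0} \<union> set xs" "set xs \<subseteq> V" "t0 \<notin> set xs"
    "prime_idl {t0} y" "carrier (coord_ring 1 0) = PV {t0}" "fib_psi \<kappa> \<alpha> cc {} = vr(t0 := cst \<alpha>)"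
proof -
  show "hom_on cc0" by (rule hom_on_comp[OF hom_cst \<kappa>])
  show "t0 \<in> V" by (simp add: V)
  thus "V - U = insert t0 (set xs)" "V - U = {t0} \<union> set xs" "set xs \<subseteq> V" "t0 \<notin> set xs" using xs Ut by auto
  have "cs 1 0 = {t0}" by (auto simp: cs_def)
  thus "prime_idl {t0} y" "carrier (coord_ring 1 0) = PV {t0}" using y(2) by (auto simp: points_iff coord_ring_Rg)
  show "fib_psi \<kappa> \<alpha> cc {} = vr(t0 := cst \<alpha>)" by (auto simp: fib_psi_def spec_def)
qed

lemma ev_fib_base: "p \<in> PV {t0} \<Longrightarrow> ev cc0 (fib_psi \<kappa> \<alpha> cc A) p = cst (ev \<kappa> (\<lambda>_. \<alpha>) p)"
  by (rule hom_eqI[OF hom_ev[OF fib_facts(1)] hom_on_comp[OF hom_cst hom_ev[OF \<kappa>]]])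
     (auto simp: fib_facts(1) \<kappa> PV_def fib_psi_def)

lemma gker_fiber:
  assumes nz: "\<And>w. w \<in> U \<Longrightarrow> ev cc0 (fib_psi \<kappa> \<alpha> cc A) (f w) \<noteq> 0"
  shows "gker V U f cc0 (fib_psi \<kappa> \<alpha> cc A) \<in> fiber_over graph_pts y"
proof -
  let ?K = "gker V U f cc0 (fib_psi \<kappa> \<alpha> cc A)"
  have base: "p \<in> ?K \<longleftrightarrow> p \<in> y" if "p \<in> PV {t0}" for p
  proof -
    have "p \<in> PV (V - U)" using that by (rule PV_mono[rotated]) (simp add: fib_facts(3))
    hence "p \<in> ?K \<longleftrightarrow> ev cc0 (fib_psi \<kappa> \<alpha> cc A) p = 0"
      using gker_poly_iff[OF g fib_facts(1) nz] by simp
    also have "\<dots> \<longleftrightarrow> ev \<kappa> (\<lambda>_. \<alpha>) p = 0" using ev_fib_base[OF that] cst_eq_iff[of _ "0::'k"]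
      by (simp add: hom_on_0[OF hom_cst])
    finally show ?thesis using that y(1) by simp
  qed
  have K: "prime_idl V ?K" "geq f ` U \<subseteq> ?K"
    using prime_gker[OF g fib_facts(1) nz] gker_geq[OF g fib_facts(1) nz] by auto
  have "Var t0 - Const a \<notin> ?K" if "a \<in> S" for a
    using y(2) that base[of "Var t0 - Const a"] by (simp add: points_iff)
  moreover have "?K \<inter> PV {t0} = y" using base y(1) by auto
  ultimately show ?thesis using K
    unfolding fiber_over_def points_iff V[symmetric] fib_facts(8) by simp
qed

lemma fiberD:
  assumes "Q \<in> fiber_over graph_pts y"
  shows "prime_idl V Q" "geq f ` U \<subseteq> Q" "y \<subseteq> Q" "Q \<inter> PV {t0} \<subseteq> y"
  using assms[unfolded fiber_over_def fib_facts(8)] by (auto simp: points_iff V)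

text \<open>A denominator vanishing identically on the fiber turns the equation
  \<open>f w * Var w = 1\<close> into \<open>0 = 1\<close>.\<close>

lemma generic_fiber_empty:
  assumes w: "w \<in> U" "ev cc0 (vr(t0 := cst \<alpha>)) (f w) = 0"
  shows "fiber_over graph_pts y = {}"
proof (rule ccontr)
  assume "fiber_over graph_pts y \<noteq> {}"
  then obtain Q where Q: "Q \<in> fiber_over graph_pts y" by blast
  note QD = fiberD[OF Q]
  note Qi = prime_idlD(1)[OF QD(1)]
  have "f w \<in> Q"
    using gdataD(4)[OF g w(1)] w(2) unfolding fib_facts(3)
    by (rule generic_fiber_zero[OF \<kappa> xs(1) fib_facts(6,5) y(1) Qi QD(3)])
  hence "f w * Var w \<in> Q" using w(1) gdataD(3)[OF g] by (intro idlD(5)[OF Qi]) auto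
  moreover have "geq f w \<in> Q" using QD(2) w(1) by blast
  ultimately have "f w * Var w - geq f w \<in> Q" by (rule idl_diff[OF Qi])
  thus False using prime_idlD(2)[OF QD(1)] by (simp add: geq_def)
qed

lemma fiber_dim:
  assumes nz: "\<And>w. w \<in> U \<Longrightarrow> ev cc0 (vr(t0 := cst \<alpha>)) (f w) \<noteq> 0"
  shows "components (fiber_over graph_pts y) = {gker V U f cc0 (vr(t0 := cst \<alpha>))}" (is "_ = {?Q0}")
    and "krull_dim {Q'\<in>fiber_over graph_pts y. gker V U f cc0 (vr(t0 := cst \<alpha>)) \<subseteq> Q'} = enat (length xs)"
proof -
  have e0: "fib_psi \<kappa> \<alpha> cc {} = vr(t0 := cst \<alpha>)" for cc by (rule fib_facts(9))
  have Q0: "?Q0 \<in> fiber_over graph_pts y" by (rule gker_fiber[where A = "{}" and cc = "\<lambda>_. 0", unfolded e0]) (rule nz)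
  \<comment> \<open>An element of \<open>?Q0\<close> reduces to a polynomial vanishing on the
    generic fiber, and such a polynomial lies in every prime over \<open>y\<close>.\<close>
  have sub: "?Q0 \<subseteq> Q" if Q: "Q \<in> fiber_over graph_pts y" for Q
  proof
    fix p assume p: "p \<in> ?Q0"
    note QD = fiberD[OF Q]
    note Qi = prime_idlD(1)[OF QD(1)]
    have pV: "p \<in> PV V" using p by (simp add: gker_def)
    obtain k q where q: "q \<in> PV (V - U)" "gprod U f ^ k * p - q \<in> gen V (geq f ` U)"
      by (rule graph_reduce[OF g pV])
    have "ev cc0 (vr(t0 := cst \<alpha>)) q = 0" using gker_iff[OF g fib_facts(1) nz pV q] p by simp
    hence "q \<in> Q" using q(1) unfolding fib_facts(3)
      by (intro generic_fiber_zero[OF \<kappa> xs(1) fib_facts(6,5) y(1) Qi QD(3)])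
    moreover have "gprod U f ^ k * p - q \<in> Q" using q(2) gen_least[OF Qi QD(2)] by blast
    ultimately have "gprod U f ^ k * p \<in> Q" using idl_cancel[OF Qi] by blast
    thus "p \<in> Q" by (rule gprod_power_cancel[OF g Qi QD(2) pV])
  qed
  show "components (fiber_over graph_pts y) = {?Q0}" by (rule components_self[OF Q0 sub])
  have "krull_dim {Q'\<in>fiber_over graph_pts y. ?Q0 \<subseteq> Q'} \<le> enat (length xs)"
  proof (rule krull_dim_le)
    fix d c assume c: "\<And>i. i \<le> d \<Longrightarrow> c i \<in> {Q'\<in>fiber_over graph_pts y. ?Q0 \<subseteq> Q'}" "\<And>i. i < d \<Longrightarrow> c i \<subset> c (Suc i)"
    have c': "c i \<in> fiber_over graph_pts y" if "i \<le> d" for i using c(1)[OF that] by blast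
    show "d \<le> length xs"
    proof (rule chain_le[where Q = c and d = d, OF g fib_facts(4,7)])
      show "prime_idl V (c i)" if "i \<le> d" for i by (rule fiberD(1)[OF c'[OF that]])
      show "c i \<subset> c (Suc i)" if "i < d" for i by (rule c(2)[OF that])
      show "geq f ` U \<subseteq> c 0" "y \<subseteq> c 0" by (rule fiberD(2,3)[OF c'[OF le0]])+
      show "c d \<inter> PV {t0} \<subseteq> y" by (rule fiberD(4)[OF c'[OF order_refl]])
    qed
  qed
  moreover have "enat (length xs) \<le> krull_dim {Q'\<in>fiber_over graph_pts y. ?Q0 \<subseteq> Q'}"
  proof -
    let ?G = "ev cc0 (vr(t0 := cst \<alpha>)) (gprod U f)"
    have "?G \<noteq> 0" using nz gdataD(2)[OF g] by (simp add: gprod_def hom_on_prod[OF hom_ev[OF fib_facts(1)]])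
    \<comment> \<open>The values are chosen at once so that no denominator vanishes even after all
      free coordinates have been specialised.\<close>
    then obtain cc where cc: "ev cst (spec \<kappa> cc (set xs)) ?G \<noteq> 0" using specialise[OF \<kappa>] by blast
    define ps where "ps = (\<lambda>i. fib_psi \<kappa> \<alpha> cc (set (take i xs)))"
    define Q where "Q = (\<lambda>i. gker V U f cc0 (ps i))"
    have comp: "ev cst (spec \<kappa> cc A) (ev cc0 (fib_psi \<kappa> \<alpha> cc B) p) = ev cc0 (fib_psi \<kappa> \<alpha> cc A) p"
      if "B \<subseteq> A" "t0 \<notin> A" for A B p
      by (rule hom_eqI[OF hom_on_comp[OF hom_ev[OF hom_cst] hom_ev[OF fib_facts(1)]] hom_ev[OF fib_facts(1)]])
         (use that in \<open>auto simp: fib_facts(1) hom_cst fib_psi_def spec_def\<close>)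
    have tk: "set (take i xs) \<subseteq> set xs" for i by (rule set_take_subset)
    \<comment> \<open>The final specialisation factors through every intermediate one, so a
      denominator vanishing earlier would vanish at the end.\<close>
    have nzi: "ev cc0 (ps i) (f w) \<noteq> 0" if "w \<in> U" for w i
    proof
      assume z: "ev cc0 (ps i) (f w) = 0"
      have "ev cc0 (fib_psi \<kappa> \<alpha> cc (set xs)) (f w) = 0"
        using comp[OF tk[of i] fib_facts(6), of "f w"] z by (simp add: ps_def)
      hence "ev cc0 (fib_psi \<kappa> \<alpha> cc (set xs)) (gprod U f) = 0"
        using that gdataD(2)[OF g] by (auto simp: gprod_def hom_on_prod[OF hom_ev[OF fib_facts(1)]])
      moreover have "ev cst (spec \<kappa> cc (set xs)) ?G = ev cc0 (fib_psi \<kappa> \<alpha> cc (set xs)) (gprod U f)"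
        using comp[OF empty_subsetI fib_facts(6), of "gprod U f"] unfolding e0 .
      ultimately show False using cc by simp
    qed
    have QW: "Q i \<in> fiber_over graph_pts y" for i
      unfolding Q_def ps_def by (rule gker_fiber) (use nzi in \<open>simp add: ps_def\<close>)
    have "Q i \<subset> Q (Suc i)" if i: "i < length xs" for i
    proof
      have tki: "set (take (Suc i) xs) = insert (xs ! i) (set (take i xs))"
        using i by (simp add: take_Suc_conv_app_nth)
      show "Q i \<subseteq> Q (Suc i)"
      proof
        fix p assume p: "p \<in> Q i"
        have pV: "p \<in> PV V" using p by (simp add: Q_def gker_def)
        obtain k q where q: "q \<in> PV (V - U)" "gprod U f ^ k * p - q \<in> gen V (geq f ` U)"
          by (rule graph_reduce[OF g pV])
        have "ev cc0 (ps i) q = 0" using gker_iff[OF g fib_facts(1) nzi pV q] p by (simp add: Q_def)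
        moreover have "t0 \<notin> set (take (Suc i) xs)" using tk[of "Suc i"] fib_facts(6) by blast
        ultimately have "ev cc0 (ps (Suc i)) q = 0"
          using comp[of "set (take i xs)" "set (take (Suc i) xs)" q] by (simp add: ps_def tki subset_insertI)
        thus "p \<in> Q (Suc i)" using gker_iff[OF g fib_facts(1) nzi pV q] by (simp add: Q_def)
      qed
      \<comment> \<open>The condition imposed in step \<open>i\<close> separates the two primes:
        beforehand \<open>xs ! i\<close> is still a free variable.\<close>
      let ?p = "Var (xs ! i) - Const (cc (xs ! i))"
      have xi: "xs ! i \<in> set xs" using i by simp
      have ni: "xs ! i \<noteq> t0" using xi fib_facts(6) by metis
      have pU: "?p \<in> PV (V - U)" using xi by (simp add: fib_facts(3))
      have nt: "xs ! i \<notin> set (take i xs)"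
        using xs(1) i by (auto simp: in_set_conv_nth nth_eq_iff_index_eq)
      have "ev cc0 (ps (Suc i)) ?p = 0"
        using ni by (simp add: hom_on_diff[OF hom_ev[OF fib_facts(1)]] fib_facts(1) ps_def fib_psi_def spec_def tki)
      hence 1: "?p \<in> Q (Suc i)" using gker_poly_iff[OF g fib_facts(1) nzi pU] by (simp add: Q_def)
      have "ev cc0 (ps i) ?p = vr (xs ! i) - cst (\<kappa> (cc (xs ! i)))"
        using ni nt by (simp add: hom_on_diff[OF hom_ev[OF fib_facts(1)]] fib_facts(1) ps_def fib_psi_def spec_def)
      moreover have "vr v \<noteq> (cst k :: 'k pl)" for v k
      proof
        assume "vr v = (cst k :: 'k pl)"
        hence "ev (\<lambda>x. x) (\<lambda>_. k + 1) (vr v) = ev (\<lambda>x. x) (\<lambda>_. k + 1) (cst k :: 'k pl)" by simp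
        thus False by (simp add: hom_on_id)
      qed
      ultimately have "ev cc0 (ps i) ?p \<noteq> 0" by simp
      hence "?p \<notin> Q i" using gker_poly_iff[OF g fib_facts(1) nzi pU] by (simp add: Q_def)
      thus "Q i \<noteq> Q (Suc i)" using 1 by blast
    qed
    moreover have "Q i \<in> {Q'\<in>fiber_over graph_pts y. ?Q0 \<subseteq> Q'}" for i using QW sub by blast
    ultimately show ?thesis by (intro krull_dim_ge)
  qed
  ultimately show "krull_dim {Q'\<in>fiber_over graph_pts y. ?Q0 \<subseteq> Q'} = enat (length xs)" by (rule antisym)
qed

lemma fiber_components_dim:
  "\<forall>Q\<in>components (fiber_over graph_pts y). krull_dim {Q'\<in>fiber_over graph_pts y. Q \<subseteq> Q'} = enat (length xs)"
proof (cases "\<exists>w\<in>U. ev cc0 (vr(t0 := cst \<alpha>)) (f w) = 0")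
  case True
  thus ?thesis using generic_fiber_empty by (auto simp: components_def)
next
  case False
  hence nz: "\<And>w. w \<in> U \<Longrightarrow> ev cc0 (vr(t0 := cst \<alpha>)) (f w) \<noteq> 0" by blast
  have A: "components (fiber_over graph_pts y) = {gker V U f cc0 (vr(t0 := cst \<alpha>))}" by (rule fiber_dim(1)) (rule nz)
  have B: "krull_dim {Q'\<in>fiber_over graph_pts y. gker V U f cc0 (vr(t0 := cst \<alpha>)) \<subseteq> Q'} = enat (length xs)"
    by (rule fiber_dim(2)) (rule nz)
  show ?thesis unfolding A using B by simp
qed

end

text \<open>Dominance holds because \<open>t0\<close> is free. For the fibers, each point of the
  line is presented as the kernel of an evaluation in a field, which is the input of
  \<open>fiber_components_dim\<close>.\<close>

lemma graph_equidimensional: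
  assumes g: "gdata (cs 1 n) U f" and U: "t0 \<notin> U" and nz: "\<And>w. w \<in> U \<Longrightarrow> f w \<noteq> 0"
    and r: "r = int (card (cs 1 n - U - {t0}))"
  shows "equidimensional S {Q\<in>points S 1 n. geq f ` U \<subseteq> Q} r"
  unfolding equidimensional_def
proof (intro conjI ballI)
  let ?W = "{Q\<in>points S 1 n. geq f ` U \<subseteq> Q}"
  let ?P = "gen (cs 1 n) (geq f ` U)"
  have t: "t0 \<in> cs 1 n" by simp
  have car: "carrier (coord_ring 1 0) = PV {t0}"
  proof -
    have "cs 1 0 = {t0}" by (auto simp: cs_def)
    thus ?thesis by (simp add: coord_ring_Rg)
  qed
  have UB: "Base j \<notin> U" for j
    using U gdataD(3)[OF g] by (cases j) auto
  have P: "?P \<in> points S 1 n" by (rule graph_points[OF g nz UB])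
  have comp: "components ?W = {?P}"
  proof (rule components_self)
    show "?P \<in> ?W" using P gen_incl by blast
    show "?P \<subseteq> Q'" if "Q' \<in> ?W" for Q'
      using that by (intro gen_least) (auto simp: points_iff dest: prime_idlD)
  qed
  fix Q assume "Q \<in> components ?W"
  hence Q: "Q = ?P" using comp by simp
  have "p \<in> ?P \<longleftrightarrow> p = 0" if "p \<in> PV {t0}" for p
    using that U by (intro graph_poly_iff[OF g nz] PV_mono[OF _ that]) auto
  thus "Q \<inter> carrier (coord_ring 1 0) = {0}" unfolding Q car by auto
next
  let ?W = "{Q\<in>points S 1 n. geq f ` U \<subseteq> Q}"
  fix y Q assume y: "y \<in> points S 1 0" and Q: "Q \<in> components (fiber_over ?W y)"
  obtain xs where xs: "distinct xs" "set xs = cs 1 n - U - {t0}"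
    using finite_distinct_list[of "cs 1 n - U - {t0}"] by auto
  have len: "int (length xs) = r" using distinct_card[OF xs(1)] xs(2) r by simp
  have yp: "prime_idl {t0} y"
  proof -
    have "cs 1 0 = {t0}" by (auto simp: cs_def)
    thus ?thesis using y by (simp add: points_iff)
  qed
  have "krull_dim {Q'\<in>fiber_over ?W y. Q \<subseteq> Q'} = enat (length xs)"
  proof (cases "y = {0}")
    case True
    \<comment> \<open>The residue field of the generic point is found inside the fraction field of
      all polynomials, with \<open>t0\<close> sent to itself.\<close>
    let ?k = "\<lambda>a. frc (Const a)"
    have hk: "hom_on ?k" by (rule hom_on_comp[OF hom_frc hom_Const])
    have "ev ?k (\<lambda>_. frc (Var t0)) p = frc p" if "p \<in> PV {t0}" for p
      by (rule hom_eqI[OF hom_ev[OF hk] hom_frc]) (use that in \<open>auto simp: hk PV_def\<close>)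
    hence "y = {p\<in>PV {t0}. ev ?k (\<lambda>_. frc (Var t0)) p = 0}" using True by auto
    thus ?thesis using fiber_components_dim[OF refl g U xs hk _ y] Q by blast
  next
    case False
    obtain \<alpha> :: complex where \<alpha>: "y = {p\<in>PV {t0}. ev of_rat (\<lambda>_. \<alpha>) p = 0}"
      by (rule point_root[OF yp False])
    have hk: "hom_on (of_rat :: rat \<Rightarrow> complex)" by (simp add: hom_on_def of_rat_add of_rat_mult)
    show ?thesis using fiber_components_dim[OF refl g U xs hk \<alpha> y] Q by blast
  qed
  thus "\<exists>d. krull_dim {Q'\<in>fiber_over ?W y. Q \<subseteq> Q'} = enat d \<and> int d = r" using len by blast
qed

section \<open>Graphs given by lists\<close>

text \<open>An entry \<open>(i, p)\<close> stands for the equation \<open>p x_i = 1\<close>; with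
  lists the side conditions of concrete graphs become computations.\<close>

definition gset :: "(nat \<times> mpoly) list \<Rightarrow> mpoly set" where
  "gset L = (\<lambda>(i, p). p * Var (Cube i) - 1) ` set L"

definition gvars :: "(nat \<times> mpoly) list \<Rightarrow> coord set" where
  "gvars L = Cube ` fst ` set L"

definition glist :: "nat \<Rightarrow> nat \<Rightarrow> (nat \<times> mpoly) list \<Rightarrow> bool" where
  "glist b n L \<longleftrightarrow> distinct (map fst L) \<and>
     (\<forall>(i, p)\<in>set L. 1 \<le> i \<and> i \<le> n \<and> p \<noteq> 0 \<and> p \<in> PV (cs b n - gvars L))"

lemma gset_simps: "gset [] = {}" "gset ((i, p) # L) = insert (p * Var (Cube i) - 1) (gset L)"
  by (simp_all add: gset_def)

definition gfun :: "(nat \<times> mpoly) list \<Rightarrow> coord \<Rightarrow> mpoly" where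
  "gfun L w = (case w of Cube i \<Rightarrow> (case map_of L i of Some p \<Rightarrow> p | None \<Rightarrow> 0) | Base j \<Rightarrow> 0)"

lemma glist_graph:
  assumes "glist b n L"
  shows "gdata (cs b n) (gvars L) (gfun L)" "gset L = geq (gfun L) ` gvars L"
    "\<And>w. w \<in> gvars L \<Longrightarrow> gfun L w \<noteq> 0" "Base j \<notin> gvars L" "card (gvars L) = length L"
proof -
  have d: "distinct (map fst L)" and L: "\<And>i p. (i, p) \<in> set L \<Longrightarrow> 1 \<le> i \<and> i \<le> n \<and> p \<noteq> 0 \<and> p \<in> PV (cs b n - gvars L)"
    using assms by (auto simp: glist_def)
  have gf: "gfun L (Cube i) = p" if "(i, p) \<in> set L" for i p
    using that d by (simp add: gfun_def)
  show "gset L = geq (gfun L) ` gvars L"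
    unfolding gset_def gvars_def image_image by (intro image_cong refl) (auto simp: geq_def gf)
  show "gfun L w \<noteq> 0" if "w \<in> gvars L" for w using that L gf by (auto simp: gvars_def)
  have "gvars L \<subseteq> cs b n" using L by (auto simp: gvars_def)
  moreover have "gfun L w \<in> PV (cs b n - gvars L)" if "w \<in> gvars L" for w
  proof -
    obtain i p where "(i, p) \<in> set L" "w = Cube i" using \<open>w \<in> gvars L\<close> by (auto simp: gvars_def)
    thus ?thesis using gf L by simp
  qed
  ultimately show "gdata (cs b n) (gvars L) (gfun L)" by (simp add: gdata_def)
  show "Base j \<notin> gvars L" by (auto simp: gvars_def)
  have "card (gvars L) = card (fst ` set L)" unfolding gvars_def by (intro card_image) (simp add: inj_on_def)
  also have "\<dots> = length L" using distinct_card[OF d] by simp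
  finally show "card (gvars L) = length L" .
qed

lemma glist_points: "glist b n L \<Longrightarrow> gen (cs b n) (gset L) \<in> points S b n"
  by (simp only: glist_graph(2)) (rule graph_points[OF glist_graph(1)]; simp add: glist_graph(3,4))

lemma glist_PV: "glist b n L \<Longrightarrow> gset L \<subseteq> PV (cs b n)"
  using gdataD(8)[OF glist_graph(1)] glist_graph(2) by metis

lemma glist_integral: "glist b n L \<Longrightarrow> integral S b n (gset L)"
  using glist_points glist_PV by (auto simp: integral_def)

lemma glist_cyc: "glist b n L \<Longrightarrow> cyc S b n (gset L) = Poly_Mapping.single (gen (cs b n) (gset L)) 1"
  by (simp add: cyc_def fund_cycle_point glist_points)

lemma glist_equidimensional:
  assumes "glist 1 n L" "r = int n - int (length L)"
  shows "equidimensional S {Q\<in>points S 1 n. gset L \<subseteq> Q} r"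
  unfolding glist_graph(2)[OF assms(1)]
proof (rule graph_equidimensional[OF glist_graph(1,4)[OF assms(1)]])
  note G = glist_graph[OF assms(1)]
  show "gfun L w \<noteq> 0" if "w \<in> gvars L" for w by (rule G(3)[OF that])
  have "card (cs 1 n) = Suc n"
  proof -
    have "cs 1 n = insert t0 (Cube ` {1..n})" by (auto simp: cs_def)
    moreover have "card (Cube ` {1..n}) = n" by (subst card_image) (auto simp: inj_on_def)
    moreover have "t0 \<notin> Cube ` {1..n}" by auto
    ultimately show ?thesis by simp
  qed
  moreover have "card (cs 1 n - gvars L - {t0}) = card (cs 1 n) - card (insert t0 (gvars L))"
  proof -
    have "cs 1 n - gvars L - {t0} = cs 1 n - insert t0 (gvars L)" by blast
    thus ?thesis using gdataD(2,3)[OF G(1)] by (simp add: card_Diff_subset)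
  qed
  moreover have "card (insert t0 (gvars L)) = Suc (length L)" using G(4,5) gdataD(2)[OF G(1)] by simp
  moreover have "card (insert t0 (gvars L)) \<le> card (cs 1 n)"
    using gdataD(3)[OF G(1)] by (intro card_mono) auto
  ultimately show "r = int (card (cs 1 n - gvars L - {t0}))" using assms(2) by simp
qed

section \<open>Restriction of ideals to faces\<close>

lemma subst_cong_mod:
  assumes Q: "idl V Q" and \<sigma>: "\<And>v. v \<in> V \<Longrightarrow> Var v - \<sigma> v \<in> Q" "\<And>v. v \<in> V \<Longrightarrow> \<sigma> v \<in> PV V" and p: "p \<in> PV V"
  shows "p - subst \<sigma> p \<in> Q"
  using p
proof (induction p rule: PV_induct)
  case (add p q)
  have "(p - subst \<sigma> p) + (q - subst \<sigma> q) \<in> Q" using add by (intro idlD(3)[OF Q])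
  thus ?case by (simp add: algebra_simps)
next
  case (mult p q)
  have "subst \<sigma> q \<in> PV V" using mult(2) \<sigma>(2) by (rule subst_PV)
  hence "p * (q - subst \<sigma> q) + (p - subst \<sigma> p) * subst \<sigma> q \<in> Q"
    using mult by (intro idlD(3)[OF Q idlD(4)[OF Q] idlD(5)[OF Q]])
  thus ?case by (simp add: algebra_simps)
qed (simp_all add: idlD(2)[OF Q] \<sigma>(1))

lemma subst_mod_iff:
  assumes "idl V Q" "\<And>v. v \<in> V \<Longrightarrow> Var v - \<sigma> v \<in> Q" "\<And>v. v \<in> V \<Longrightarrow> \<sigma> v \<in> PV V" "F \<subseteq> PV V"
  shows "subst \<sigma> ` F \<subseteq> Q \<longleftrightarrow> F \<subseteq> Q"
  using idl_cancel[OF assms(1) subst_cong_mod[OF assms(1-3)]] assms(4) by (auto simp: subset_iff image_iff)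

lemma eps_val_PV [simp]: "eps_val \<epsilon> \<in> PV V" and subst_eps_val [simp]: "subst \<sigma> (eps_val \<epsilon>) = eps_val \<epsilon>"
  by (cases \<epsilon>; simp)+

text \<open>The face restriction, followed by the pull-back along the projection forgetting
  \<open>u_i\<close>, is the identity modulo the equation of the face. A certificate for the unit
  ideal on the face thus lifts to any ideal containing the equations of the graph and of the
  face.\<close>

lemma face_unit:
  assumes unit: "1 \<in> gen (cs 1 m) (subst (face_subst i \<epsilon>) ` F)" and F: "F \<subseteq> PV (cs 1 (Suc m))" and i: "1 \<le> i" "i \<le> Suc m"
    and Q: "idl (cs 1 (Suc m)) Q" "F \<subseteq> Q" "Var (Cube i) - eps_val \<epsilon> \<in> Q"
  shows "1 \<in> Q"
proof -
  \<comment> \<open>The comorphism of the projection forgetting \<open>u_i\<close>.\<close>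
  define \<iota> where "\<iota> = (\<lambda>v. case v of Base j \<Rightarrow> Var (Base j) | Cube l \<Rightarrow> if l < i then Var (Cube l) else Var (Cube (Suc l)))"
  have m: "maps (cs 1 m) (cs 1 (Suc m)) \<iota>"
    unfolding maps_def
  proof
    fix v assume "v \<in> cs 1 m"
    thus "\<iota> v \<in> PV (cs 1 (Suc m))" by (cases v) (auto simp: \<iota>_def)
  qed
  define \<sigma> where "\<sigma> = (\<lambda>v. if v = Cube i then eps_val \<epsilon> else Var v)"
  have comp: "subst \<iota> (face_subst i \<epsilon> v) = \<sigma> v" for v
    by (cases v) (auto simp: \<iota>_def \<sigma>_def face_subst_def)
  have "subst \<sigma> ` F \<subseteq> Q"
    by (subst subst_mod_iff[OF Q(1) _ _ F]) (use Q idlD(2)[OF Q(1)] in \<open>auto simp: \<sigma>_def\<close>)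
  hence "subst \<iota> ` subst (face_subst i \<epsilon>) ` F \<subseteq> Q" by (simp add: subst_image_subst comp)
  moreover have "subst (face_subst i \<epsilon>) ` F \<subseteq> PV (cs 1 m)" using maps_PV[OF maps_face[OF i]] F by blast
  ultimately have "subst \<iota> ` gen (cs 1 m) (subst (face_subst i \<epsilon>) ` F) \<subseteq> Q"
    using subst_gen_subset_iff[OF m Q(1)] by blast
  moreover have "subst \<iota> 1 \<in> subst \<iota> ` gen (cs 1 m) (subst (face_subst i \<epsilon>) ` F)" using unit by (rule imageI)
  ultimately show "1 \<in> Q" by auto
qed

definition dsub :: "nat list \<Rightarrow> coord \<Rightarrow> mpoly" where
  "dsub ds v = (if v \<in> Cube ` set ds then 1 else Var v)"

text \<open>The intersection with a face is described inside the whole cube, by adjoining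
  \<open>x_i = 1\<close> and substituting; it is again a graph, so the fiber dimensions apply to it
  directly.\<close>

definition dlist :: "nat list \<Rightarrow> (nat \<times> mpoly) list \<Rightarrow> (nat \<times> mpoly) list" where
  "dlist ds L = map (\<lambda>i. (i, 1)) ds @ map (\<lambda>(i, p). (i, subst (dsub ds) p)) L"

text \<open>The faces meeting the graph are those with equations \<open>u\<^sub>i = 0\<close>, \<open>i \<in> D\<close>, for the sets \<open>D \<subseteq> A\<close>.\<close>

lemma Zeq_graph:
  assumes L: "glist 1 n L" and p: "length L = p"
    and bad: "\<And>i \<epsilon>. i \<in> {1..n} \<Longrightarrow> i \<notin> A \<or> \<epsilon> = Infty \<Longrightarrow> 1 \<in> gen (cs 1 (n - 1)) (subst (face_subst i \<epsilon>) ` gset L)"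
    and good: "\<And>D. D \<subseteq> A \<Longrightarrow> \<exists>ds. set ds = D \<and> glist 1 n (dlist ds L)"
  shows "gen (cs 1 n) (gset L) \<in> Zeq_gens S p n"
  unfolding Zeq_gens_def
proof (intro CollectI conjI allI impI)
  let ?P = "gen (cs 1 n) (gset L)"
  show "?P \<in> points S 1 n" by (rule glist_points[OF L])
  fix F assume F: "is_face n F"
  let ?W = "{Q\<in>face_points S n F. ?P \<subseteq> Q}"
  have PQ: "?P \<subseteq> Q \<longleftrightarrow> gset L \<subseteq> Q" if "idl (cs 1 n) Q" for Q
    by (rule gen_subset_iff[OF that])
  show "?W = {} \<or> equidimensional S ?W (int (face_dim n F) - int p)"
  proof (cases "\<exists>i \<epsilon>. F i = Some \<epsilon> \<and> (i \<notin> A \<or> \<epsilon> = Infty)")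
    case True
    then obtain i \<epsilon> where i: "F i = Some \<epsilon>" "i \<notin> A \<or> \<epsilon> = Infty" by blast
    have "i \<in> dom F" using i(1) by auto
    hence in1: "i \<in> {1..n}" using F by (auto simp: is_face_def)
    hence n: "n = Suc (n - 1)" by simp
    have "Q \<notin> ?W" for Q
    proof
      assume "Q \<in> ?W"
      hence Q: "prime_idl (cs 1 n) Q" "Var (Cube i) - eps_val \<epsilon> \<in> Q" "?P \<subseteq> Q"
        using i(1) by (simp_all add: face_points_def points_iff)
      have "1 \<in> Q"
      proof (rule face_unit[OF bad[OF in1 i(2)]])
        show "gset L \<subseteq> PV (cs 1 (Suc (n - 1)))" using glist_PV[OF L] n by simp
        show "idl (cs 1 (Suc (n - 1))) Q" using prime_idlD(1)[OF Q(1)] n by simp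
        show "gset L \<subseteq> Q" using Q(3) PQ[OF prime_idlD(1)[OF Q(1)]] by simp
      qed (use in1 Q(2) in auto)
      thus False using prime_idlD(2)[OF Q(1)] by simp
    qed
    thus ?thesis by blast
  next
    case False
    have FZ: "F i = Some Zero \<and> i \<in> A" if "i \<in> dom F" for i
      using False that by (cases "F i") (auto, metis eps.exhaust)
    then obtain ds where ds: "set ds = dom F" "glist 1 n (dlist ds L)" using good[of "dom F"] by blast
    have FS: "F i = Some \<epsilon> \<longleftrightarrow> i \<in> set ds \<and> \<epsilon> = Zero" for i \<epsilon>
      using FZ[of i] ds(1) domI[of F i \<epsilon>] by auto
    have "?W = {Q\<in>points S 1 n. gset (dlist ds L) \<subseteq> Q}"
    proof (intro Collect_cong, unfold face_points_def mem_Collect_eq conj_assoc, intro conj_cong refl)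
      fix Q assume "Q \<in> points S 1 n"
      hence Qi: "idl (cs 1 n) Q" by (auto simp: points_iff dest: prime_idlD)
      have "gset (dlist ds L) = (\<lambda>i. Var (Cube i) - 1) ` set ds \<union> (\<lambda>(i, p). subst (dsub ds) p * Var (Cube i) - 1) ` set L"
        by (auto simp: gset_def dlist_def image_Un image_image split_beta)
      also have "(\<lambda>(i, p). subst (dsub ds) p * Var (Cube i) - 1) ` set L = subst (dsub ds) ` gset L"
      proof -
        have "i \<notin> set ds" if "(i, p) \<in> set L" for i p
          using ds(2) that by (force simp: glist_def dlist_def)
        thus ?thesis unfolding gset_def image_image by (intro image_cong refl) (auto simp: dsub_def)
      qed
      finally have eq: "gset (dlist ds L) = (\<lambda>i. Var (Cube i) - 1) ` set ds \<union> subst (dsub ds) ` gset L" .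
      have key: "subst (dsub ds) ` gset L \<subseteq> Q \<longleftrightarrow> gset L \<subseteq> Q" if "\<forall>i\<in>set ds. Var (Cube i) - 1 \<in> Q"
        by (rule subst_mod_iff[OF Qi _ _ glist_PV[OF L]]) (use that idlD(2)[OF Qi] in \<open>auto simp: dsub_def\<close>)
      have "(\<forall>i \<epsilon>. F i = Some \<epsilon> \<longrightarrow> Var (Cube i) - eps_val \<epsilon> \<in> Q) \<longleftrightarrow> (\<forall>i\<in>set ds. Var (Cube i) - 1 \<in> Q)"
        by (auto simp: FS)
      thus "((\<forall>i \<epsilon>. F i = Some \<epsilon> \<longrightarrow> Var (Cube i) - eps_val \<epsilon> \<in> Q) \<and> ?P \<subseteq> Q) \<longleftrightarrow> gset (dlist ds L) \<subseteq> Q"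
        using key PQ[OF Qi] by (auto simp: eq)
    qed
    \<comment> \<open>The equations of the face are added to those of the graph, which gives the
      relative dimension \<open>n - card (dom F) - p\<close>.\<close>
    moreover have "distinct ds" using ds(2) by (simp add: glist_def dlist_def comp_def)
    hence "length ds = card (dom F)" using distinct_card[of ds] ds(1) by simp
    moreover have "card (dom F) \<le> n"
      using card_mono[of "{1..n}" "dom F"] F by (simp add: is_face_def)
    ultimately show ?thesis
      using glist_equidimensional[OF ds(2) refl, of S] p by (simp add: face_dim_def dlist_def of_nat_diff algebra_simps)
  qed
qed

lemma gen_unit:
  assumes "F \<subseteq> PV V" "f \<in> F" "g \<in> F" "a \<in> PV V" "b \<in> PV V" "a * f + b * g = 1"
  shows "1 \<in> gen V F"
proof -
  have "a * f + b * g \<in> gen V F"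
    using assms(2-5) gen_incl[of F V] by (intro idlD(3)[OF idl_gen[OF assms(1)]] idlD(4)[OF idl_gen[OF assms(1)]]) auto
  thus ?thesis by (simp add: assms(6))
qed

lemma j_pull_Alt:
  assumes "integral base_A1 1 n F" "integral base_X 1 n F"
  shows "j_pull n (Alt base_A1 n (cyc base_A1 1 n F)) = Alt base_X n (cyc base_X 1 n F)"
proof -
  have "pullback base_X 1 n Var (act base_A1 n g (cyc base_A1 1 n F)) = act base_X n g (cyc base_X 1 n F)"
    if g: "g \<in> sperms n" for g
  proof -
    have "maps (cs 1 n) (cs 1 n) Var" by (simp add: maps_def)
    hence "pullback base_X 1 n Var (cyc base_A1 1 n (subst (gs g) ` F)) = cyc base_X 1 n (subst Var ` subst (gs g) ` F)"
      by (rule pullback_cyc[OF integral_gs[OF g assms(1)]])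
    moreover have "subst Var ` A = A" for A by simp
    ultimately show ?thesis by (simp only: act_cyc[OF g assms(1)] act_cyc[OF g assms(2)])
  qed
  thus ?thesis by (simp add: j_pull_def Alt_sperms pullback_lin)
qed

lemma Alt_invariant_zero:
  assumes h: "h \<in> sperms n" "sg h = - 1" and F: "integral S 1 n F" "subst (gs h) ` F = F"
  shows "Alt S n (cyc S 1 n F) = 0"
proof -
  have "Alt S n (cyc S 1 n F) = Alt S n (act S n h (cyc S 1 n F))"
    by (simp only: act_cyc[OF h(1) F(1)] F(2))
  also have "\<dots> = scale (- 1) (Alt S n (cyc S 1 n F))"
    by (simp only: Alt_act[OF h(1) cyc_keys[OF F(1)]] h(2))
  finally have *: "Alt S n (cyc S 1 n F) = - Alt S n (cyc S 1 n F)" by (simp only: scale_minus1)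
  show ?thesis
  proof (rule poly_mapping_eqI)
    fix k
    have "lk (Alt S n (cyc S 1 n F)) k = - lk (Alt S n (cyc S 1 n F)) k"
      by (subst (1) *) (rule lookup_uminus)
    thus "lk (Alt S n (cyc S 1 n F)) k = lk 0 k" by simp
  qed
qed

text \<open>The equation \<open>p * q = 1\<close> fails wherever \<open>p\<close> vanishes. As
  \<open>p\<close> involves only \<open>t\<close>, signed permutations fix it, so every component of
  the alternated cycle misses the fiber.\<close>

lemma empty_fiber_graph:
  assumes F: "integral S 1 n F" and pq: "p * q - 1 \<in> F" "p \<in> PV {t0}" "q \<in> PV (cs 1 n)"
    and p: "\<And>Q. idl (cs 1 n) Q \<Longrightarrow> Var t0 - Const a \<in> Q \<Longrightarrow> p \<in> Q"
  shows "empty_fiber_at S n a (Alt S n (cyc S 1 n F))"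
  unfolding empty_fiber_at_def
proof
  fix P assume "P \<in> ks (Alt S n (cyc S 1 n F))"
  then obtain g where g: "g \<in> sperms n" "P = subst (gs g) ` gen (cs 1 n) F" using ks_Alt_cyc[OF F] by blast
  show "fiber S n a P = {}"
  proof (rule ccontr)
    assume "fiber S n a P \<noteq> {}"
    then obtain Q where Q: "prime_idl (cs 1 n) Q" "P \<subseteq> Q" "Var t0 - Const a \<in> Q"
      unfolding fiber_def points_iff by blast
    have "subst (gs g) (p * q - 1) \<in> P" using g(2) pq(1) gen_incl[of F "cs 1 n"] by blast
    moreover have "subst (gs g) p = subst Var p"
      by (rule subst_cong) (use pq(2) in \<open>auto simp: PV_def\<close>)
    ultimately have 1: "p * subst (gs g) q - 1 \<in> Q" using Q(2) by auto
    note Qi = prime_idlD(1)[OF Q(1)]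
    have "p * subst (gs g) q \<in> Q"
      using p[OF Qi Q(3)] maps_PV[OF maps_gs[OF g(1)] pq(3)] by (rule idlD(5)[OF Qi])
    hence "1 \<in> Q" using idl_diff[OF Qi _ 1] by force
    thus False using prime_idlD(2)[OF Q(1)] by simp
  qed
qed

section \<open>The polylogarithm cycles\<close>

abbreviation gcyc :: "rat set \<Rightarrow> nat \<Rightarrow> (nat \<times> mpoly) list \<Rightarrow> cycle" where
  "gcyc S n L \<equiv> Alt S n (cyc S 1 n (gset L))"

abbreviation T :: mpoly where "T \<equiv> Var t0"
abbreviation cx :: "nat \<Rightarrow> mpoly" where "cx i \<equiv> Var (Cube i)"

text \<open>The value at \<open>t = 2\<close>, \<open>x\<^sub>i = 3\<close>, where none of the denominators below vanishes.\<close>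

definition sample :: "mpoly \<Rightarrow> rat" where
  "sample = ev (\<lambda>a. a) (\<lambda>v. case v of Base _ \<Rightarrow> 2 | Cube _ \<Rightarrow> 3)"

lemma sample_simps [simp]:
  "sample (p + q) = sample p + sample q" "sample (p - q) = sample p - sample q" "sample (p * q) = sample p * sample q"
  "sample 1 = 1" "sample 0 = 0" "sample (Var (Base j)) = 2" "sample (Var (Cube i)) = 3"
  unfolding sample_def by (simp_all add: ev_simps hom_on_id)

lemma glistI:
  assumes "distinct (map fst L)" "\<forall>(i, p)\<in>set L. 1 \<le> i \<and> i \<le> n \<and> sample p \<noteq> 0 \<and> p \<in> PV (cs b n - gvars L)"
  shows "glist b n L"
  unfolding glist_def
proof (intro conjI ballI)
  show "distinct (map fst L)" by (rule assms)
  fix ip assume ip: "ip \<in> set L"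
  obtain i p where "ip = (i, p)" by (cases ip)
  moreover have "p \<noteq> 0" if "sample p \<noteq> 0" using that by auto
  ultimately show "case ip of (i, p) \<Rightarrow> 1 \<le> i \<and> i \<le> n \<and> p \<noteq> 0 \<and> p \<in> PV (cs b n - gvars L)"
    using bspec[OF assms(2) ip] by simp
qed

text \<open>The equation \<open>u = f(t)\<close> reads \<open>(1 - f(t)) x = 1\<close>, which gives
  \<open>G0\<close> and \<open>G1\<close> for \<open>t\<close> and \<open>1 - t\<close>.
  \<open>G01\<close> is their product and \<open>G3\<close> its twisted pull-back. \<open>G4\<close>
  and \<open>G4'\<close> are the products of \<open>G3\<close> and \<open>G1\<close> in the two
  orders; \<open>Gm\<close> and \<open>Gn\<close> are the pull-backs of \<open>G4\<close>, with
  faces \<open>u_2 = 0\<close> given by \<open>Hm\<close> and \<open>Hn\<close>.\<close>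

abbreviation "G0 \<equiv> [(1, 1 - T)]"
abbreviation "G1 \<equiv> [(1, T)]"
abbreviation "G01 \<equiv> [(1, 1 - T), (2, T)]"
abbreviation "G3 \<equiv> [(2, (1 - T) * cx 1), (3, 1 - (1 - T) * cx 1)]"
abbreviation "G4 \<equiv> [(2, (1 - T) * cx 1), (3, 1 - (1 - T) * cx 1), (4, T)]"
abbreviation "G4' \<equiv> [(1, T), (3, (1 - T) * cx 2), (4, 1 - (1 - T) * cx 2)]"
abbreviation "Gm \<equiv> [(3, (1 - T * cx 1) * cx 2), (4, 1 - (1 - T * cx 1) * cx 2), (5, T * cx 1)]"
abbreviation "Gn \<equiv> [(3, (1 - T) * cx 1 * cx 2), (4, 1 - (1 - T) * cx 1 * cx 2), (5, 1 - (1 - T) * cx 1)]"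
abbreviation "Hm \<equiv> [(2, 1 - T * cx 1), (3, T * cx 1), (4, T * cx 1)]"
abbreviation "Hn \<equiv> [(2, (1 - T) * cx 1), (3, 1 - (1 - T) * cx 1), (4, 1 - (1 - T) * cx 1)]"

text \<open>The entries with two base coordinates are the exterior products before restriction to
  the diagonal; their right factor uses \<open>Base 1\<close>.\<close>

lemma glists:
  "glist 1 1 G0" "glist 1 1 G1" "glist 1 2 G01" "glist 1 3 G3" "glist 1 4 G4" "glist 1 4 G4'" "glist 1 5 Gm" "glist 1 5 Gn"
  "glist 1 4 Hm" "glist 1 4 Hn" "glist 2 2 [(1, 1 - T), (2, Var (Base 1))]"
  "glist 2 4 [(2, (1 - T) * cx 1), (3, 1 - (1 - T) * cx 1), (4, Var (Base 1))]"
  "glist 2 4 [(1, T), (3, (1 - Var (Base 1)) * cx 2), (4, 1 - (1 - Var (Base 1)) * cx 2)]"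
  by (rule glistI; simp add: gvars_def)+

lemma cprod_gset:
  assumes "glist 1 n L" "glist 1 m L'" "glist 2 k M2" "glist 1 k M1" "k = n + m"
    "gset L \<union> subst (ext_right n) ` gset L' = gset M2" "gset L \<union> subst (sh n) ` gset L' = gset M1"
  shows "cprod S n m (gcyc S n L) (gcyc S m L') = gcyc S k M1"
  using cprod_Alt[OF glist_integral[OF assms(1)] glist_integral[OF assms(2)]] glist_integral[OF assms(3)] glist_integral[OF assms(4)]
  unfolding assms(5-7) by blast

lemma mhat_simps [simp]: "mhat_subst (Base j) = 1 - (1 - Var (Base j)) * cx 1" "mhat_subst (Cube i) = cx (i + 1)"
  by (simp_all add: mhat_subst_def theta_subst_def m_subst_def)

lemma m_simps [simp]: "m_subst (Base j) = Var (Base j) * cx 1" "m_subst (Cube i) = cx (i + 1)"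
  by (simp_all add: m_subst_def)

lemma nu_gset:
  assumes "glist 1 n L" "glist 1 k L'" "k = n + 1" "subst mhat_subst ` gset L = gset L'"
  shows "nu_pull n (gcyc base_A1 n L) = gcyc base_A1 k L'"
  unfolding nu_pull_def assms(3) using Alt_pullback_shift[of mhat_subst base_A1 n "gset L"]
    glist_integral[OF assms(1)] glist_integral[OF assms(2)] unfolding assms(3,4) by simp

lemma mu_gset:
  assumes "glist 1 n L" "glist 1 k L'" "k = n + 1" "subst m_subst ` gset L = gset L'"
  shows "mu_pull n (gcyc base_A1 n L) = gcyc base_A1 k L'"
  unfolding mu_pull_def assms(3) using Alt_pullback_shift[of m_subst base_A1 n "gset L"]
    glist_integral[OF assms(1)] glist_integral[OF assms(2)] unfolding assms(3,4) by simp

lemma L0_bar_eq: "L0_bar = gcyc base_A1 1 G0"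
  unfolding L0_bar_def graph_cycle_def glist_cyc[OF glists(1)]
  unfolding graph_ideal_def coord_ring_Rg genideal_gen gset_simps ..

lemma L1_bar_eq: "L1_bar = gcyc base_A1 1 G1"
proof -
  have "1 - (1 - T) = T" by simp
  thus ?thesis
    unfolding L1_bar_def graph_cycle_def glist_cyc[OF glists(2)]
    unfolding graph_ideal_def coord_ring_Rg genideal_gen gset_simps by simp
qed

lemma ext_right_simps [simp]: "ext_right n (Base j) = Var (Base (j + 1))" "ext_right n (Cube i) = cx (n + i)"
  by (simp_all add: ext_right_def)

lemma cprod01: "cprod S 1 1 (gcyc S 1 G0) (gcyc S 1 G1) = gcyc S 2 G01"
  by (rule cprod_gset[OF glists(1,2,11,3)]) (simp_all add: gset_simps insert_commute del: One_nat_def)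

lemma cprod31: "cprod S 3 1 (gcyc S 3 G3) (gcyc S 1 G1) = gcyc S 4 G4"
  by (rule cprod_gset[OF glists(4,2,12,5)]) (simp_all add: gset_simps insert_commute del: One_nat_def)

lemma cprod13: "cprod S 1 3 (gcyc S 1 G1) (gcyc S 3 G3) = gcyc S 4 G4'"
  by (rule cprod_gset[OF glists(2,4,13,6)]) (simp_all add: gset_simps insert_commute del: One_nat_def)

lemma L1_01_bar_eq: "L1_01_bar = gcyc base_A1 3 G3"
  unfolding L1_01_bar_def L0_bar_eq L1_bar_eq cprod01
  by (rule nu_gset[OF glists(3,4)]) (simp_all add: gset_simps del: One_nat_def)

lemma L_011_bar_eq: "L_011_bar = gcyc base_A1 5 Gm"
  unfolding L_011_bar_def L1_01_bar_eq L1_bar_eq cprod31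
  by (rule mu_gset[OF glists(5,7)]) (simp_all add: gset_simps del: One_nat_def)

lemma L1_011_bar_eq: "L1_011_bar = gcyc base_A1 5 Gn"
  unfolding L1_011_bar_def L1_01_bar_eq L1_bar_eq cprod31
  by (rule nu_gset[OF glists(5,8)]) (simp_all add: gset_simps del: One_nat_def)

lemma L1_eq: "L1 = gcyc base_X 1 G1"
  unfolding L1_def L1_bar_eq by (intro j_pull_Alt glist_integral glists)

lemma L1_01_eq: "L1_01 = gcyc base_X 3 G3"
  unfolding L1_01_def L1_01_bar_eq by (intro j_pull_Alt glist_integral glists)

lemma L_011_eq: "L_011 = gcyc base_X 5 Gm"
  unfolding L_011_def L_011_bar_eq by (intro j_pull_Alt glist_integral glists)

lemma L1_011_eq: "L1_011 = gcyc base_X 5 Gn"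
  unfolding L1_011_def L1_011_bar_eq by (intro j_pull_Alt glist_integral glists)

section \<open>Faces and boundaries of the graphs in weights two and three\<close>

lemma face_disjointI:
  assumes "glist 1 (Suc m) L" "1 \<le> i" "i \<le> Suc m" "(j, p) \<in> set L" "(k, q) \<in> set L" "a \<in> PV (cs 1 m)" "b \<in> PV (cs 1 m)"
    "a * subst (face_subst i \<epsilon>) (p * cx j - 1) + b * subst (face_subst i \<epsilon>) (q * cx k - 1) = 1"
  shows "1 \<in> gen (cs 1 m) (subst (face_subst i \<epsilon>) ` gset L)"
proof (rule gen_unit[OF _ _ _ assms(6-8)])
  show "subst (face_subst i \<epsilon>) ` gset L \<subseteq> PV (cs 1 m)"
    using maps_PV[OF maps_face[OF assms(2,3)]] glist_PV[OF assms(1)] by blast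
  show "subst (face_subst i \<epsilon>) (p * cx j - 1) \<in> subst (face_subst i \<epsilon>) ` gset L"
    "subst (face_subst i \<epsilon>) (q * cx k - 1) \<in> subst (face_subst i \<epsilon>) ` gset L"
    using assms(4,5) by (intro imageI; force simp: gset_def)+
qed

lemma face_simps [simp]: "face_subst i \<epsilon> (Base j) = Var (Base j)"
  "face_subst i \<epsilon> (Cube l) = (if l < i then cx l else if l = i then eps_val \<epsilon> else cx (l - 1))"
  by (simp_all add: face_subst_def)

text \<open>At infinity some \<open>x_i\<close> vanishes and an equation becomes
  \<open>0 = 1\<close>. On \<open>u_2 = 0\<close> or \<open>u_3 = 0\<close> one of the two
  complementary factors \<open>(1 - t) x_1\<close> and \<open>1 - (1 - t) x_1\<close> equals 1, so
  the other vanishes.\<close>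

lemma face_disjoint_G3:
  assumes "i \<in> {1..3}" "i \<notin> {1} \<or> \<epsilon> = Infty"
  shows "1 \<in> gen (cs 1 (3 - 1)) (subst (face_subst i \<epsilon>) ` gset G3)"
proof -
  have s: "Suc 2 = 3" "3 - 1 = (2::nat)" by simp_all
  note r = face_disjointI[where m = 2 and L = G3, unfolded s, OF glists(4)]
  have "i \<in> {1, 2, 3}" using assms(1) by auto
  hence "(i, \<epsilon>) \<in> {(1, Infty), (2, Infty), (3, Infty), (2, Zero), (3, Zero)}" using assms(2) by (cases \<epsilon>) auto
  thus ?thesis unfolding s
  proof (elim insertE emptyE; elim Pair_inject; hypsubst)
    show "1 \<in> gen (cs 1 2) (subst (face_subst 1 Infty) ` gset G3)"
      by (rule r[of _ 2 "(1 - T) * cx 1" 2 "(1 - T) * cx 1" "- 1" 0]) (simp_all add: algebra_simps)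
    show "1 \<in> gen (cs 1 2) (subst (face_subst 2 Infty) ` gset G3)"
      by (rule r[of _ 2 "(1 - T) * cx 1" 2 "(1 - T) * cx 1" "- 1" 0]) (simp_all add: algebra_simps)
    show "1 \<in> gen (cs 1 2) (subst (face_subst 3 Infty) ` gset G3)"
      by (rule r[of _ 3 "1 - (1 - T) * cx 1" 2 "(1 - T) * cx 1" "- 1" 0]) (simp_all add: algebra_simps)
    show "1 \<in> gen (cs 1 2) (subst (face_subst 2 Zero) ` gset G3)"
      by (rule r[of _ 2 "(1 - T) * cx 1" 3 "1 - (1 - T) * cx 1" "- cx 2" "- 1"]) (simp_all add: algebra_simps)
    show "1 \<in> gen (cs 1 2) (subst (face_subst 3 Zero) ` gset G3)"
      by (rule r[of _ 2 "(1 - T) * cx 1" 3 "1 - (1 - T) * cx 1" "- 1" "- cx 2"]) (simp_all add: algebra_simps)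
  qed
qed

text \<open>Both graphs satisfy \<open>p4 = 1 - p3\<close> and \<open>p3 = (1 - p5) x_2\<close>.
  Hence \<open>x_3 = 1\<close> forces \<open>p4 = 0\<close>, while \<open>x_4 = 1\<close> and
  \<open>x_5 = 1\<close> force \<open>p3 = 0\<close>; at infinity a vanishing \<open>x_i\<close> is
  a factor of the left side of some equation.\<close>

lemma face_disjoint_weight3:
  fixes p3 p4 p5 i \<epsilon>
  defines "L \<equiv> [(3, p3), (4, p4), (5, p5)]"
  assumes L: "L = Gm \<or> L = Gn"
    and i: "i \<in> {1..5}" "i \<notin> {1, 2} \<or> \<epsilon> = Infty"
  shows "1 \<in> gen (cs 1 (5 - 1)) (subst (face_subst i \<epsilon>) ` gset L)"
proof -
  have s: "Suc 4 = 5" "5 - 1 = (4::nat)" by simp_all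
  have ok: "glist 1 5 L" using L glists(7,8) by auto
  note r = face_disjointI[where m = 4 and L = L, unfolded s, OF ok]
  have mem: "(3, p3) \<in> set L" "(4, p4) \<in> set L" "(5, p5) \<in> set L" by (simp_all add: L_def)
  have p: "p4 = 1 - p3" "p3 = (1 - T * cx 1) * cx 2 \<and> p5 = T * cx 1 \<or> p3 = (1 - T) * cx 1 * cx 2 \<and> p5 = 1 - (1 - T) * cx 1"
    using L by (auto simp: L_def)
  have "i \<in> {1, 2, 3, 4, 5}" using i(1) by auto
  hence "(i, \<epsilon>) \<in> {(1, Infty), (2, Infty), (3, Infty), (4, Infty), (5, Infty), (3, Zero), (4, Zero), (5, Zero)}"
    using i(2) by (cases \<epsilon>) auto
  thus ?thesis unfolding s
  proof (elim insertE emptyE; elim Pair_inject; hypsubst)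
    show "1 \<in> gen (cs 1 4) (subst (face_subst 1 Infty) ` gset L)"
      using p(2)
    proof
      assume h: "p3 = (1 - T * cx 1) * cx 2 \<and> p5 = T * cx 1"
      show ?thesis by (rule r[OF _ _ mem(3) mem(3), of _ "- 1" 0]) (simp_all add: h)
    next
      assume h: "p3 = (1 - T) * cx 1 * cx 2 \<and> p5 = 1 - (1 - T) * cx 1"
      show ?thesis by (rule r[OF _ _ mem(1) mem(3), of _ "- 1" 0]) (simp_all add: h)
    qed
    show "1 \<in> gen (cs 1 4) (subst (face_subst 2 Infty) ` gset L)"
      by (rule r[OF _ _ mem(1) mem(3), of _ "- 1" 0], simp, simp, simp, simp)
        ((rule disjE[OF p(2)]; elim conjE; simp only: p(1)); simp add: algebra_simps)
    show "1 \<in> gen (cs 1 4) (subst (face_subst 3 Infty) ` gset L)"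
      by (rule r[OF _ _ mem(1) mem(3), of _ "- 1" 0], simp, simp, simp, simp)
        ((rule disjE[OF p(2)]; elim conjE; simp only: p(1)); simp add: algebra_simps)
    show "1 \<in> gen (cs 1 4) (subst (face_subst 4 Infty) ` gset L)"
      by (rule r[OF _ _ mem(2) mem(3), of _ "- 1" 0], simp, simp, simp, simp)
        ((rule disjE[OF p(2)]; elim conjE; simp only: p(1)); simp add: algebra_simps)
    show "1 \<in> gen (cs 1 4) (subst (face_subst 5 Infty) ` gset L)"
      by (rule r[OF _ _ mem(3) mem(3), of _ "- 1" 0], simp, simp, simp, simp)
        ((rule disjE[OF p(2)]; elim conjE; simp only: p(1)); simp add: algebra_simps)
    show "1 \<in> gen (cs 1 4) (subst (face_subst 3 Zero) ` gset L)"
      \<comment> \<open>On the face \<open>x_3 = 1\<close> the coordinates above it move down by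
        one, so \<open>cx 3\<close> is the former \<open>x_4\<close>.\<close>
      by (rule r[OF _ _ mem(1) mem(2), of _ "- cx 3" "- 1"], simp, simp, simp, simp)
        ((rule disjE[OF p(2)]; elim conjE; simp only: p(1)); simp add: algebra_simps)
    show "1 \<in> gen (cs 1 4) (subst (face_subst 4 Zero) ` gset L)"
      by (rule r[OF _ _ mem(1) mem(2), of _ "- 1" "- cx 3"], simp, simp, simp, simp)
        ((rule disjE[OF p(2)]; elim conjE; simp only: p(1)); simp add: algebra_simps)
    show "1 \<in> gen (cs 1 4) (subst (face_subst 5 Zero) ` gset L)"
      by (rule r[OF _ _ mem(1) mem(3), of _ "- 1" "- (cx 2 * cx 3)"], simp, simp, simp, simp)
        ((rule disjE[OF p(2)]; elim conjE; simp only: p(1)); simp add: algebra_simps)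
  qed
qed

lemmas face_disjoint_Gm = face_disjoint_weight3[OF disjI1[OF refl]]
lemmas face_disjoint_Gn = face_disjoint_weight3[OF disjI2[OF refl]]

lemma dsub_simps [simp]: "dsub ds (Base j) = Var (Base j)" "dsub ds (Cube i) = (if i \<in> set ds then 1 else cx i)"
  by (auto simp: dsub_def)

lemma face_graph_G3: "D \<subseteq> {1} \<Longrightarrow> \<exists>ds. set ds = D \<and> glist 1 3 (dlist ds G3)"
proof -
  assume "D \<subseteq> {1}"
  hence "D = set [] \<or> D = set [1]" by auto
  moreover have "glist 1 3 (dlist [] G3)" "glist 1 3 (dlist [1] G3)"
    by (rule glistI; simp add: gvars_def dlist_def)+
  ultimately show ?thesis by metis
qed

lemma subset_1_2: "D \<subseteq> {1, 2::nat} \<Longrightarrow> D = set [] \<or> D = set [1] \<or> D = set [2] \<or> D = set [1, 2]"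
  by auto

lemma face_graph_weight3:
  assumes "L = Gm \<or> L = Gn" "D \<subseteq> {1, 2}"
  shows "\<exists>ds. set ds = D \<and> glist 1 5 (dlist ds L)"
proof -
  have "glist 1 5 (dlist [] Gm)" "glist 1 5 (dlist [1] Gm)" "glist 1 5 (dlist [2] Gm)" "glist 1 5 (dlist [1, 2] Gm)"
    "glist 1 5 (dlist [] Gn)" "glist 1 5 (dlist [1] Gn)" "glist 1 5 (dlist [2] Gn)" "glist 1 5 (dlist [1, 2] Gn)"
    by (rule glistI; simp add: gvars_def dlist_def)+
  thus ?thesis using assms(1) subset_1_2[OF assms(2)] by metis
qed

lemma Neq_graph:
  assumes L: "glist 1 n L" and Z: "gen (cs 1 n) (gset L) \<in> Zeq_gens S p n" and n: "n = nat (2 * int p - 1)" "1 \<le> p"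
  shows "gcyc S n L \<in> Neq S 1 p"
proof -
  have "ks (cyc S 1 n (gset L)) \<subseteq> Zeq_gens S p n" unfolding glist_cyc[OF L] using Z by simp
  moreover have "(1::int) \<le> 2 * int p" using n(2) by simp
  ultimately show ?thesis unfolding Neq_def Let_def n(1)[symmetric] by simp
qed

lemma Neq_polylog:
  "gcyc S 3 G3 \<in> Neq S 1 2"
  "gcyc S 5 Gm \<in> Neq S 1 3" "gcyc S 5 Gn \<in> Neq S 1 3"
proof -
  show "gcyc S 3 G3 \<in> Neq S 1 2"
    by (rule Neq_graph[OF glists(4) Zeq_graph[OF glists(4) _ face_disjoint_G3 face_graph_G3]]) simp_all
  show "gcyc S 5 Gm \<in> Neq S 1 3"
    by (rule Neq_graph[OF glists(7) Zeq_graph[OF glists(7) _ face_disjoint_Gm face_graph_weight3[OF disjI1[OF refl]]]]) simp_all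
  show "gcyc S 5 Gn \<in> Neq S 1 3"
    by (rule Neq_graph[OF glists(8) Zeq_graph[OF glists(8) _ face_disjoint_Gn face_graph_weight3[OF disjI2[OF refl]]]]) simp_all
qed

lemma bdry_polylog:
  assumes L: "glist 1 5 L" and H: "glist 1 4 H"
    and bad: "\<And>i \<epsilon>. i \<in> {1..5} \<Longrightarrow> i \<notin> {1, 2} \<or> \<epsilon> = Infty \<Longrightarrow> 1 \<in> gen (cs 1 (5 - 1)) (subst (face_subst i \<epsilon>) ` gset L)"
    and f1: "subst (face_subst 1 Zero) ` gset L = gset G4"
    and f2: "subst (face_subst 2 Zero) ` gset L = gset H"
    and inv: "subst (gs ({}, Transposition.transpose 3 4)) ` gset H = gset H"
  shows "bdry S 5 (gcyc S 5 L) = gcyc S 4 G4"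
proof -
  let ?D = "\<lambda>i \<epsilon>. cyc S 1 4 (subst (face_subst i \<epsilon>) ` gset L)"
  have s: "Suc 4 = 5" "5 - 1 = (4::nat)" "Suc 3 = 4" by simp_all
  have PV: "subst (face_subst i \<epsilon>) ` gset L \<subseteq> PV (cs 1 4)" if "i \<in> {1..5}" for i \<epsilon>
    using that maps_PV[OF maps_face[of i 4 1 \<epsilon>]] glist_PV[OF L] unfolding s by auto
  have ok: "integral S 1 4 (subst (face_subst i \<epsilon>) ` gset L)" if i: "i \<in> {1..5}" for i \<epsilon>
  proof (cases "i \<in> {1, 2} \<and> \<epsilon> = Zero")
    case True
    thus ?thesis using f1 f2 glist_integral[OF glists(5)] glist_integral[OF H] by auto
  next
    case False
    hence "1 \<in> gen (cs 1 4) (subst (face_subst i \<epsilon>) ` gset L)"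
      using bad[OF i, of \<epsilon>] unfolding s by (cases \<epsilon>) auto
    thus ?thesis using PV[OF i] by (simp add: integral_def)
  qed
  have fp: "face_pull S 5 i \<epsilon> (cyc S 1 5 (gset L)) = ?D i \<epsilon>" if "i \<in> {1..5}" for i \<epsilon>
    unfolding face_pull_def s using that maps_face[of i 4 1 \<epsilon>]
    by (intro pullback_cyc[OF glist_integral[OF L]]) (simp_all add: s)
  have z: "?D i \<epsilon> = 0" if "i \<in> {1..5}" "i \<notin> {1, 2} \<or> \<epsilon> = Infty" for i \<epsilon>
    using bad[OF that] unfolding cyc_def s by (rule fund_cycle_unit)
  have "bdry S 5 (gcyc S 5 L) = Alt S 4 (bdry S 5 (cyc S 1 5 (gset L)))"
    using bdry_Alt[where m = 4 and F = "gset L" and S = S] glist_integral[OF L] ok unfolding s by blast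
  also have "bdry S 5 (cyc S 1 5 (gset L)) = (\<Sum>i\<in>{1..5}. scale ((- 1) ^ (i - 1)) (?D i Zero - ?D i Infty))"
    unfolding bdry_def by (intro sum.cong refl) (simp only: fp)
  also have "\<dots> = (\<Sum>i\<in>{1, 2}. scale ((- 1) ^ (i - 1)) (?D i Zero))"
    by (rule sum.mono_neutral_cong_right) (auto simp: z simp del: One_nat_def)
  also have "\<dots> = cyc S 1 4 (gset G4) - cyc S 1 4 (gset H)"
    using f1 f2 by (simp add: scale_minus1 del: One_nat_def)
  also have "Alt S 4 \<dots> = gcyc S 4 G4"
  proof -
    have "({}, Transposition.transpose 3 4) \<in> sperms 4" "sg ({}, Transposition.transpose 3 4) = - 1"
      using sperms_elem[of 3 4] unfolding s by simp_all
    hence "gcyc S 4 H = 0" using Alt_invariant_zero[OF _ _ glist_integral[OF H] inv] by blast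
    thus ?thesis by (simp only: Alt_lin diff_zero)
  qed
  finally show ?thesis .
qed

lemma bdry_Gm: "bdry S 5 (gcyc S 5 Gm) = gcyc S 4 G4"
  by (rule bdry_polylog[OF glists(7,9) face_disjoint_Gm])
     (simp_all add: gset_simps gs_Cube Transposition.transpose_def insert_commute)

lemma bdry_Gn: "bdry S 5 (gcyc S 5 Gn) = gcyc S 4 G4"
  by (rule bdry_polylog[OF glists(8,10) face_disjoint_Gn])
     (simp_all add: gset_simps gs_Cube Transposition.transpose_def insert_commute)

text \<open>Moving the last cube factor to the front is a cycle of length 4, hence odd.
  \<open>rep 4 Zero\<close> provides this cycle together with its sign.\<close>

lemma Alt_G4_swap: "gcyc S 4 G4 = - gcyc S 4 G4'"
proof -
  have h: "rep 4 Zero \<in> sperms 4" "sg (rep 4 Zero) = - 1" using rep_props(1,2)[of 4 4 Zero] by (simp_all add: eps_sg_def)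
  have "cyperm 4 1 = 2" "cyperm 4 2 = 3" "cyperm 4 3 = 4" "cyperm 4 4 = 1"
    by (simp_all add: eval_nat_numeral Transposition.transpose_def)
  hence "subst (gs (rep 4 Zero)) ` gset G4 = gset G4'"
    by (auto simp: gset_simps gs_Cube rep_def simp del: One_nat_def)
  hence "act S 4 (rep 4 Zero) (cyc S 1 4 (gset G4)) = cyc S 1 4 (gset G4')"
    using act_cyc[OF h(1) glist_integral[OF glists(5)]] by simp
  hence "gcyc S 4 G4' = scale (- 1) (gcyc S 4 G4)"
    using Alt_act[OF h(1) cyc_keys[OF glist_integral[OF glists(5)]], of S] h(2) by simp
  thus ?thesis by (simp add: scale_minus1)
qed

text \<open>The first graph satisfies \<open>t x_1 x_5 = 1\<close>, impossible at
  \<open>t = 0\<close>; the second satisfies \<open>(1 - t) x_1 x_2 x_3 = 1\<close>, impossible at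
  \<open>t = 1\<close>.\<close>

lemma empty_fibers:
  "empty_fiber_at S 5 0 (gcyc S 5 Gm)" "empty_fiber_at S 5 1 (gcyc S 5 Gn)"
proof -
  show "empty_fiber_at S 5 0 (gcyc S 5 Gm)"
    by (rule empty_fiber_graph[OF glist_integral[OF glists(7)], of T "cx 1 * cx 5"])
       (simp_all add: gset_simps mult.assoc)
  show "empty_fiber_at S 5 1 (gcyc S 5 Gn)"
  proof (rule empty_fiber_graph[OF glist_integral[OF glists(8)], of "1 - T" "cx 1 * cx 2 * cx 3"])
    fix Q assume "idl (cs 1 5) Q" "Var t0 - Const 1 \<in> Q"
    thus "1 - T \<in> Q" using idl_uminus[of "cs 1 5" Q "Var t0 - Const 1"] by simp
  qed (simp_all add: gset_simps mult.assoc)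
qed

section \<open>Admissibility of the weight one cycles\<close>

lemma PV_empty: "p \<in> PV {} \<Longrightarrow> \<exists>k. p = Const k"
proof (induction p rule: PV_induct)
  case (add p q)
  thus ?case by (metis hom_on_add[OF hom_Const])
next
  case (mult p q)
  thus ?case by (metis hom_on_mult[OF hom_Const])
qed auto

lemma prime_const:
  assumes "prime_idl V Q" "Const k \<in> Q"
  shows "k = 0"
proof (rule ccontr)
  assume "k \<noteq> 0"
  have "Const (1 / k) * Const k \<in> Q" using assms(2) by (intro idlD(4)[OF prime_idlD(1)[OF assms(1)]]) auto
  also have "Const (1 / k) * Const k = 1"
    using \<open>k \<noteq> 0\<close> by (simp flip: hom_on_mult[OF hom_Const])
  finally show False using prime_idlD(2)[OF assms(1)] by simp
qed

lemma prime_zero: "prime_idl {} {0}"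
  by (auto simp: prime_idl_def idl_def)

text \<open>The case of \<open>chain_le\<close> whose base is the field of constants: it bounds all
  chains in a graph, not just those in a fiber.\<close>

lemma chain_le_const:
  assumes "gdata V U f" "V - U = set xs"
    and "\<And>i. i \<le> d \<Longrightarrow> prime_idl V (Q i)" "\<And>i. i < d \<Longrightarrow> Q i \<subset> Q (Suc i)" "geq f ` U \<subseteq> Q 0"
  shows "d \<le> length xs"
proof (rule chain_le[where Q = Q and d = d, OF assms(1) _ prime_zero])
  show "V - U = {} \<union> set xs" using assms(2) by simp
  show "prime_idl V (Q i)" if "i \<le> d" for i by (rule assms(3)[OF that])
  show "Q i \<subset> Q (Suc i)" if "i < d" for i by (rule assms(4)[OF that])
  show "geq f ` U \<subseteq> Q 0" by (rule assms(5))
  show "{0} \<subseteq> Q 0" using idlD(2)[OF prime_idlD(1)[OF assms(3)[OF le0]]] by simp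
  show "Q d \<inter> PV {} \<subseteq> {0}"
  proof
    fix p assume p: "p \<in> Q d \<inter> PV {}"
    then obtain k where k: "p = Const k" using PV_empty by blast
    hence "k = 0" using p prime_const[OF assms(3)[OF order_refl], of k] by simp
    thus "p \<in> {0}" using k by simp
  qed
qed

text \<open>The closure of the graph meets the face \<open>u\<^sub>1 = 0\<close> only in the rational point \<open>t = a\<close>; its codimension
  is bounded by extending chains of primes through that point.\<close>

lemma Z_gens_point:
  assumes L: "glist 1 1 [(1, p)]" and p: "p - 1 = T - Const a \<or> p - 1 = - (T - Const a)"
  shows "gen (cs 1 1) (gset [(1, p)]) \<in> Z_gens base_A1 1 1"
proof -
  define V where "V = cs 1 1"
  define P where "P = gen V (gset [(1, p)])"
  \<comment> \<open>The rational point \<open>t = a\<close>, \<open>u_1 = 0\<close>, where the graph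
    meets the face; \<open>M\<close> is its maximal ideal.\<close>
  define \<psi> :: "coord \<Rightarrow> rat" where "\<psi> = (\<lambda>v. case v of Base _ \<Rightarrow> a | Cube _ \<Rightarrow> 1)"
  define M where "M = {q\<in>PV V. ev (\<lambda>x. x) \<psi> q = 0}"
  have \<psi>: "\<psi> t0 = a" "\<psi> (Cube i) = 1" for i by (simp_all add: \<psi>_def)
  have VV: "V = {t0, Cube 1}" by (auto simp: V_def cs_def)
  have pts: "points base_A1 1 1 = {Q. prime_idl V Q}" by (auto simp: points_iff base_A1_def V_def)
  have hid: "hom_on (\<lambda>x::rat. x)" by (rule hom_on_id)
  have hev: "hom_on (ev (\<lambda>x. x) \<psi>)" by (rule hom_ev[OF hid])
  have M: "prime_idl V M"
    unfolding M_def prime_idl_def idl_def by (auto simp: hom_on_simps[OF hev])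
  have e: "p * cx 1 - 1 \<in> gset [(1, p)]" by (simp add: gset_simps)
  have P: "prime_idl V P" using glist_points[OF L, of base_A1] unfolding pts P_def V_def by blast
  have gP: "gset [(1, p)] \<subseteq> P" unfolding P_def by (rule gen_incl)
  have pV: "p \<in> PV V" using L PV_mono[of "V - gvars [(1, p)]" V p] by (auto simp: glist_def V_def)
  have ta: "T - Const a \<in> Q \<longleftrightarrow> p - 1 \<in> Q" if "idl V Q" for Q
  proof -
    have "- x \<in> Q \<longleftrightarrow> x \<in> Q" for x using idl_uminus[OF that, of x] idl_uminus[OF that, of "- x"] by auto
    thus ?thesis using p by (elim disjE) (simp_all only:)
  qed
  have on_face: "T - Const a \<in> Q" if Q: "idl V Q" "p * cx 1 - 1 \<in> Q" "cx 1 - 1 \<in> Q" for Q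
  proof -
    have "(p * cx 1 - 1) - p * (cx 1 - 1) \<in> Q" by (rule idl_diff[OF Q(1,2) idlD(4)[OF Q(1) pV Q(3)]])
    thus ?thesis using ta[OF Q(1)] by (simp add: algebra_simps)
  qed
  have Mmem: "T - Const a \<in> M" "cx 1 - 1 \<in> M"
    using \<psi> by (simp_all add: M_def VV hom_on_diff[OF hev] hid)
  note Mi = prime_idlD(1)[OF M]
  have PM: "P \<subseteq> M"
    unfolding P_def
  proof (rule gen_least[OF Mi])
    have "p * (cx 1 - 1) + (p - 1) \<in> M" using Mmem(1) ta[OF Mi] by (intro idlD(3)[OF Mi idlD(4)[OF Mi pV Mmem(2)]]) simp
    thus "gset [(1, p)] \<subseteq> M" by (simp add: gset_simps algebra_simps)
  qed
  have noT: "T - Const a \<notin> gen V (geq f ` U)" if "gdata V U f" "\<And>w. w \<in> U \<Longrightarrow> f w \<noteq> 0" "t0 \<notin> U" for U f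
    using graph_poly_iff[OF that(1,2), of "T - Const a"] that(3) by (simp add: VV)
  have PneM: "P \<noteq> M"
    using noT[of "gvars [(1, p)]" "gfun [(1, p)]"] glist_graph[OF L] Mmem(1) unfolding P_def V_def by metis
  have maxM: "M \<subseteq> Q" if Q: "idl V Q" "T - Const a \<in> Q" "cx 1 - 1 \<in> Q" for Q
  proof
    fix q assume q: "q \<in> M"
    have "q - subst (\<lambda>v. Const (\<psi> v)) q \<in> Q"
      using q by (intro subst_cong_mod[OF Q(1)]) (use Q in \<open>auto simp: VV \<psi>_def M_def\<close>)
    moreover have "subst (\<lambda>v. Const (\<psi> v)) q = Const (ev (\<lambda>x. x) \<psi> q)"
      by (rule hom_eqI[OF hom_subst hom_on_comp[OF hom_Const hev]]) (simp_all add: hid)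
    ultimately show "q \<in> Q" using q by (simp add: M_def)
  qed
  \<comment> \<open>The zero ideal, written as a graph without equations so that its primality is an
    instance of \<open>prime_graph\<close>.\<close>
  define Z where "Z = gen V (geq (\<lambda>_. 1) ` {})"
  have gd0: "gdata V {} (\<lambda>_. 1)" by (simp add: gdata_def VV)
  have Z: "prime_idl V Z" unfolding Z_def by (rule prime_graph[OF gd0]) simp
  have ZP: "Z \<subset> P"
  proof
    show "Z \<subseteq> P" unfolding Z_def using prime_idlD(1)[OF P] by (intro gen_least) auto
    show "Z \<noteq> P"
    proof
      assume "Z = P"
      hence "p * cx 1 - 1 \<in> Z" using subsetD[OF gP e] by simp
      moreover have "p * cx 1 - 1 \<in> PV (V - {})" using pV by (simp add: VV)
      ultimately have "p * cx 1 - 1 = 0" unfolding Z_def using graph_poly_iff[OF gd0] by simp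
      \<comment> \<open>At \<open>x_1 = 0\<close> the polynomial takes the value -1.\<close>
      hence "ev (\<lambda>x. x) (\<psi>(Cube 1 := 0)) (p * cx 1 - 1) = 0" by simp
      thus False by (simp add: ev_simps hid)
    qed
  qed
  have codim: "krull_dim {Q\<in>points base_A1 1 1. Q \<subseteq> P} = enat 1"
  proof (rule antisym)
    show "enat 1 \<le> krull_dim {Q\<in>points base_A1 1 1. Q \<subseteq> P}"
      by (rule krull_dim_ge[where c = "\<lambda>i. if i = 0 then Z else P"]) (use Z P ZP in \<open>auto simp: pts simp del: One_nat_def\<close>)
    show "krull_dim {Q\<in>points base_A1 1 1. Q \<subseteq> P} \<le> enat 1"
    proof (rule krull_dim_le)
      fix d c assume c: "\<And>i. i \<le> d \<Longrightarrow> c i \<in> {Q\<in>points base_A1 1 1. Q \<subseteq> P}" "\<And>i. i < d \<Longrightarrow> c i \<subset> c (Suc i)"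
      \<comment> \<open>A chain below \<open>P\<close> becomes longer by one when \<open>M\<close>
        is put on top, and chains in two free coordinates have length at most 2.\<close>
      have "Suc d \<le> length [t0, Cube 1]"
      proof (rule chain_le_const[where Q = "\<lambda>i. if i \<le> d then c i else M", OF gd0])
        fix i
        show "prime_idl V (if i \<le> d then c i else M)" using c(1)[of i] M by (simp add: pts del: One_nat_def)
        assume i: "i < Suc d"
        show "(if i \<le> d then c i else M) \<subset> (if Suc i \<le> d then c (Suc i) else M)"
        proof (cases "i = d")
          case True
          have "c d \<subseteq> P" using c(1)[of d] by simp
          thus ?thesis using True PM PneM by auto
        next
          case False
          thus ?thesis using c(2)[of i] i by simp
        qed
      qed (simp_all add: VV)
      thus "d \<le> 1" by simp
    qed
  qed
  have "\<forall>Q\<in>components {Q\<in>face_points base_A1 1 F. P \<subseteq> Q}. krull_dim {Q'\<in>face_points base_A1 1 F. Q' \<subseteq> Q} = enat 1"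
    if F: "is_face 1 F" for F
  proof -
    have dF: "i = 1" if "F i = Some \<epsilon>" for i \<epsilon>
      using F domI[of F i \<epsilon>] that by (auto simp: is_face_def)
    consider "F 1 = None" | "F 1 = Some Infty" | "F 1 = Some Zero" by (metis eps.exhaust not_None_eq)
    thus ?thesis
    proof cases
      case 1
      have "F i \<noteq> Some \<epsilon>" for i \<epsilon>
      proof
        assume h: "F i = Some \<epsilon>"
        hence "i = 1" by (rule dF)
        thus False using h 1 by simp
      qed
      hence fp: "face_points base_A1 1 F = points base_A1 1 1" by (simp add: face_points_def del: One_nat_def)
      have "components {Q\<in>points base_A1 1 1. P \<subseteq> Q} = {P}"
        using P by (intro components_self) (simp_all add: pts del: One_nat_def)
      thus ?thesis unfolding fp using codim by simp
    next
      case 2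
      have "Q \<notin> {Q\<in>face_points base_A1 1 F. P \<subseteq> Q}" for Q
      proof
        assume Q0: "Q \<in> {Q\<in>face_points base_A1 1 F. P \<subseteq> Q}"
        have "cx 1 - eps_val Infty \<in> Q" using Q0 2 unfolding face_points_def by blast
        hence Q: "prime_idl V Q" "P \<subseteq> Q" "cx 1 \<in> Q"
          using Q0 unfolding face_points_def pts by simp_all
        note Qi = prime_idlD(1)[OF Q(1)]
        have "p * cx 1 - (p * cx 1 - 1) \<in> Q"
          by (rule idl_diff[OF Qi idlD(4)[OF Qi pV Q(3)] subsetD[OF Q(2) subsetD[OF gP e]]])
        thus False using prime_idlD(2)[OF Q(1)] by simp
      qed
      hence "components {Q\<in>face_points base_A1 1 F. P \<subseteq> Q} = {}" unfolding components_def by blast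
      thus ?thesis unfolding ball_simps by simp
    next
      case 3
      have fp: "face_points base_A1 1 F = {Q. prime_idl V Q \<and> cx 1 - 1 \<in> Q}"
      proof -
        have "(\<forall>i \<epsilon>. F i = Some \<epsilon> \<longrightarrow> cx i - eps_val \<epsilon> \<in> Q) \<longleftrightarrow> cx 1 - 1 \<in> Q" for Q
        proof
          assume "\<forall>i \<epsilon>. F i = Some \<epsilon> \<longrightarrow> cx i - eps_val \<epsilon> \<in> Q"
          hence "cx 1 - eps_val Zero \<in> Q" using 3 by blast
          thus "cx 1 - 1 \<in> Q" by simp
        next
          assume h: "cx 1 - 1 \<in> Q"
          show "\<forall>i \<epsilon>. F i = Some \<epsilon> \<longrightarrow> cx i - eps_val \<epsilon> \<in> Q"
          proof (intro allI impI)
            fix i \<epsilon> assume f: "F i = Some \<epsilon>"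
            hence "i = 1" by (rule dF)
            thus "cx i - eps_val \<epsilon> \<in> Q" using f 3 h by simp
          qed
        qed
        thus ?thesis unfolding face_points_def pts by simp
      qed
      have comp: "components {Q\<in>face_points base_A1 1 F. P \<subseteq> Q} = {M}"
      proof (rule components_self)
        show "M \<in> {Q\<in>face_points base_A1 1 F. P \<subseteq> Q}" using M Mmem PM by (simp add: fp del: One_nat_def)
        show "M \<subseteq> Q'" if Q': "Q' \<in> {Q\<in>face_points base_A1 1 F. P \<subseteq> Q}" for Q'
        proof -
          have q: "prime_idl V Q'" "cx 1 - 1 \<in> Q'" "P \<subseteq> Q'" using Q' by (auto simp: fp simp del: One_nat_def)
          note qi = prime_idlD(1)[OF q(1)]
          have "p * cx 1 - 1 \<in> Q'" by (rule subsetD[OF q(3) subsetD[OF gP e]])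
          thus ?thesis using q(2) by (intro maxM[OF qi] on_face[OF qi])
        qed
      qed
      \<comment> \<open>The ideal of the face, as the graph of the constant 1; only \<open>t\<close>
        is free on it, so chains there have length at most 1.\<close>
      define H where "H = gen V (geq (\<lambda>_. 1) ` {Cube 1})"
      have gd1: "gdata V {Cube 1} (\<lambda>_. 1)" by (simp add: gdata_def VV)
      have g1: "geq (\<lambda>_. 1) ` {Cube 1} = {cx 1 - 1}" by (simp add: geq_def)
      have H: "prime_idl V H" unfolding H_def by (rule prime_graph[OF gd1]) simp
      have HM: "H \<subset> M"
      proof
        show "H \<subseteq> M" unfolding H_def g1 by (rule gen_least[OF Mi]) (use Mmem in simp)
        show "H \<noteq> M" using noT[OF gd1] Mmem(1) unfolding H_def by auto
      qed
      have "krull_dim {Q'\<in>face_points base_A1 1 F. Q' \<subseteq> M} = enat 1"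
      proof (rule antisym)
        have "cx 1 - 1 \<in> H" unfolding H_def g1 using gen_incl[of "{cx 1 - 1}" V] by blast
        thus "enat 1 \<le> krull_dim {Q'\<in>face_points base_A1 1 F. Q' \<subseteq> M}"
          by (intro krull_dim_ge[where c = "\<lambda>i. if i = 0 then H else M"]) (use H M HM Mmem in \<open>auto simp: fp simp del: One_nat_def\<close>)
        show "krull_dim {Q'\<in>face_points base_A1 1 F. Q' \<subseteq> M} \<le> enat 1"
        proof (rule krull_dim_le)
          fix d c assume c: "\<And>i. i \<le> d \<Longrightarrow> c i \<in> {Q'\<in>face_points base_A1 1 F. Q' \<subseteq> M}" "\<And>i. i < d \<Longrightarrow> c i \<subset> c (Suc i)"
          have "d \<le> length [t0]"
          proof (rule chain_le_const[where Q = c and d = d, OF gd1])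
            show "prime_idl V (c i)" if "i \<le> d" for i using c(1)[OF that] by (simp add: fp del: One_nat_def)
            show "c i \<subset> c (Suc i)" if "i < d" for i by (rule c(2)[OF that])
            show "geq (\<lambda>_. 1) ` {Cube 1} \<subseteq> c 0" using c(1)[of 0] unfolding g1 by (simp add: fp del: One_nat_def)
          qed (auto simp: VV)
          thus "d \<le> 1" by simp
        qed
      qed
      thus ?thesis unfolding comp by simp
    qed
  qed
  moreover have "P \<in> points base_A1 1 1" using P by (simp add: pts del: One_nat_def)
  ultimately show ?thesis using codim unfolding Z_gens_def P_def[symmetric, unfolded V_def] by blast
qed

lemma N_weight_one:
  assumes "glist 1 1 L" "gen (cs 1 1) (gset L) \<in> Z_gens S 1 1"
  shows "gcyc S 1 L \<in> N S 1 1"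
proof -
  have n: "nat (2 * int 1 - 1) = 1" by simp
  have "ks (cyc S 1 1 (gset L)) \<subseteq> Z_gens S 1 1" unfolding glist_cyc[OF assms(1)] using assms(2) by simp
  moreover have "(1::int) \<le> 2 * int 1" by simp
  ultimately show ?thesis unfolding N_def Let_def n by simp
qed

theorem lemma3p18:
  shows
    "(L0_bar \<in> N base_A1 1 1 \<and> L1_bar \<in> N base_A1 1 1 \<and> L1_01_bar \<in> Neq base_A1 1 2)
   \<and> (L_011 \<in> Neq base_X 1 3 \<and> L1_011 \<in> Neq base_X 1 3 \<and>
      L_011_bar \<in> Neq base_A1 1 3 \<and> L1_011_bar \<in> Neq base_A1 1 3)
   \<and> (bdry base_X 5 L_011 = cprod base_X 3 1 L1_01 L1 \<and>
      bdry base_X 5 L1_011 = cprod base_X 3 1 L1_01 L1 \<and>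
      cprod base_X 3 1 L1_01 L1 = - cprod base_X 1 3 L1 L1_01 \<and>
      bdry base_A1 5 L_011_bar = cprod base_A1 3 1 L1_01_bar L1_bar \<and>
      bdry base_A1 5 L1_011_bar = cprod base_A1 3 1 L1_01_bar L1_bar)
   \<and> (empty_fiber_at base_A1 5 0 L_011_bar \<and> empty_fiber_at base_A1 5 1 L1_011_bar)"
proof -
  have "L0_bar \<in> N base_A1 1 1"
    \<comment> \<open>The graph of \<open>t\<close> meets \<open>u_1 = 0\<close> over
      \<open>t = 0\<close>; that of \<open>1 - t\<close> meets it over \<open>t = 1\<close>.\<close>
    unfolding L0_bar_eq by (rule N_weight_one[OF glists(1) Z_gens_point[OF glists(1), of 0]]) simp
  moreover have "L1_bar \<in> N base_A1 1 1"
    unfolding L1_bar_eq by (rule N_weight_one[OF glists(2) Z_gens_point[OF glists(2), of 1]]) simp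
  ultimately show ?thesis
    unfolding L1_01_bar_eq L_011_eq L1_011_eq L_011_bar_eq L1_011_bar_eq L1_01_eq L1_eq L1_bar_eq
      cprod31 cprod13 bdry_Gm bdry_Gn
    using Neq_polylog Alt_G4_swap empty_fibers by blast
qed

end
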